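(* Let $M$ be an orientable smooth $n$-dimensional manifold and let $F:[0,T]\times M\to\mathbb{R}^{n+1}$ be a smooth family of immersions that is stationary for the action $J_V-J_K$, where $$J_K(F):=\int_0^T\int_M\frac12\left|\frac{dF}{dt}\right|^2d\mu_t\,dt,\qquad J_V(F):=\frac n2\int_0^T\int_M d\mu_t\,dt,$$ that is, $$\frac{d}{ds}(J_V-J_K)(F+s\Phi)\Big|_{s=0}=0\qquad\text{for all }\Phi\in C_0^\infty((0,T)\times M,\mathbb{R}^{n+1}).$$ Then $F$ satisfies the equation of motion $$\frac{d^2}{dt^2}F=\alpha\,\nu+A^kF_k,\qquad \alpha=(e-|S|^2)H-\sigma\,d^\dagger S,\qquad A^k=(\sigma H-d^\dagger S)S^k-\nabla^k e.$$
   Context: $\frac{d}{dt}$ is the time derivative at a fixed point of $M$; in local coordinates $F_i:=\partial F/\partial x^i$; $g_{ij}:=\langle F_i,F_j\rangle$ is the induced metric, with Levi-Civita connection $\nabla$ and volume form $d\mu_t$; indices are raised with $g^{ij}$. $\nu$ is the unit normal along the hypersurface (inward pointing when $M$ is compact without boundary), $h_{ij}:=-\langle F_i,\nabla_j\nu\rangle$ the second fundamental form, $H:=g^{ij}h_{ij}$ the mean curvature (so $\Delta F=H\nu$). $\sigma:=\langle\frac{dF}{dt},\nu\rangle$ and $S_i:=\langle\frac{dF}{dt},F_i\rangle$ are the normal and tangential velocities, $d^\dagger S:=\nabla^iS_i$, $|S|^2=g^{ij}S_iS_j$, and $e:=\frac12\left(\left|\frac{dF}{dt}\right|^2+n\right)$.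 If the volume is infinite, the actions are formal, and the derivative in $s$ is understood by restricting the integrals to a compact set containing the support of $\Phi$. *)

theory Defs
  imports "HOL-Analysis.Analysis"
begin

section \<open>Smooth maps and smooth manifolds\<close>

text \<open>\<open>Ck_on k W f\<close> is the usual \<open>k\<close>-fold continuous differentiability on an open set \<open>W\<close> of a
  finite-dimensional space. On an arbitrary set, smoothness means having local smooth extensions;
  this is needed for the time interval \<open>{0..T}\<close>.\<close>

primrec Ck_on :: "nat \<Rightarrow> 'a::euclidean_space set \<Rightarrow> ('a \<Rightarrow> 'b::real_normed_vector) \<Rightarrow> bool" where
  "Ck_on 0 W f \<longleftrightarrow> continuous_on W f"
| "Ck_on (Suc k) W f \<longleftrightarrow>
     (\<forall>x\<in>W. f differentiable (at x)) \<and> (\<forall>v. Ck_on k W (\<lambda>x. frechet_derivative f (at x) v))"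

definition smooth_on :: "'a::euclidean_space set \<Rightarrow> ('a \<Rightarrow> 'b::real_normed_vector) \<Rightarrow> bool" where
  "smooth_on S f \<longleftrightarrow>
     (\<forall>x\<in>S. \<exists>W g. open W \<and> x \<in> W \<and> (\<forall>k. Ck_on k W g) \<and> (\<forall>y\<in>S \<inter> W. g y = f y))"

text \<open>The manifold is the whole type \<open>'m\<close> (Hausdorff and second countable by its type classes)
  together with an atlas; its dimension is \<open>CARD('n)\<close>. A chart is a pair of its domain and its
  coordinate map.\<close>

type_synonym ('m, 'n) chart = "'m set \<times> ('m \<Rightarrow> real ^ 'n)"

abbreviation chart_dom :: "('m, 'n) chart \<Rightarrow> 'm set" where
  "chart_dom c \<equiv> fst c"

abbreviation chart_map :: "('m, 'n) chart \<Rightarrow> 'm \<Rightarrow> real ^ 'n" where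
  "chart_map c \<equiv> snd c"

definition chart_inv :: "('m, 'n) chart \<Rightarrow> real ^ 'n \<Rightarrow> 'm" where
  "chart_inv c = inv_into (chart_dom c) (chart_map c)"

definition is_chart :: "('m::topological_space, 'n::finite) chart \<Rightarrow> bool" where
  "is_chart c \<longleftrightarrow> open (chart_dom c) \<and> open (chart_map c ` chart_dom c) \<and>
     homeomorphism (chart_dom c) (chart_map c ` chart_dom c) (chart_map c) (chart_inv c)"

definition smooth_atlas :: "('m::topological_space, 'n::finite) chart set \<Rightarrow> bool" where
  "smooth_atlas \<A> \<longleftrightarrow>
     (\<forall>c\<in>\<A>. is_chart c) \<and> (\<Union>c\<in>\<A>. chart_dom c) = UNIV \<and>
     (\<forall>c\<in>\<A>. \<forall>d\<in>\<A>. smooth_on (chart_map c ` (chart_dom c \<inter> chart_dom d)) (chart_map d \<circ> chart_inv c))"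

definition orientable :: "('m::topological_space, 'n::finite) chart set \<Rightarrow> bool" where
  "orientable \<A> \<longleftrightarrow>
     (\<exists>\<B>. smooth_atlas \<B> \<and> smooth_atlas (\<A> \<union> \<B>) \<and>
       (\<forall>c\<in>\<B>. \<forall>d\<in>\<B>. \<forall>p\<in>chart_dom c \<inter> chart_dom d.
          det (matrix (frechet_derivative (chart_map d \<circ> chart_inv c) (at (chart_map c p)))) > 0))"

text \<open>Smoothness of a map on \<open>I \<times> M\<close>, jointly in time and space.\<close>

definition smooth_family ::
  "('m::topological_space, 'n::finite) chart set \<Rightarrow> real set \<Rightarrow> (real \<Rightarrow> 'm \<Rightarrow> 'b::real_normed_vector) \<Rightarrow> bool"
  where
  "smooth_family \<A> I f \<longleftrightarrow>
     (\<forall>c\<in>\<A>. smooth_on (I \<times> chart_map c ` chart_dom c) (\<lambda>(t, x). f t (chart_inv c x)))"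

text \<open>\<open>partial c i f\<close> is \<open>\<partial>f/\<partial>x\<^sup>i\<close> in the coordinates of \<open>c\<close>, as a function on \<open>chart_dom c\<close>.\<close>

definition partial ::
  "('m, 'n::finite) chart \<Rightarrow> 'n \<Rightarrow> ('m \<Rightarrow> 'b::real_normed_vector) \<Rightarrow> 'm \<Rightarrow> 'b" where
  "partial c i f p = frechet_derivative (f \<circ> chart_inv c) (at (chart_map c p)) (axis i 1)"

definition immersion ::
  "('m::topological_space, 'n::finite) chart set \<Rightarrow> ('m \<Rightarrow> 'v::euclidean_space) \<Rightarrow> bool" where
  "immersion \<A> f \<longleftrightarrow>
     (\<forall>c\<in>\<A>. \<forall>p\<in>chart_dom c. (f \<circ> chart_inv c) differentiable (at (chart_map c p)) \<and>
        inj (frechet_derivative (f \<circ> chart_inv c) (at (chart_map c p))))"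

section \<open>Geometry of an immersion in local coordinates\<close>

definition metric ::
  "('m, 'n::finite) chart \<Rightarrow> ('m \<Rightarrow> 'v::euclidean_space) \<Rightarrow> 'm \<Rightarrow> real ^ 'n ^ 'n" where
  "metric c f p = (\<chi> i j. partial c i f p \<bullet> partial c j f p)"

definition inv_metric ::
  "('m, 'n::finite) chart \<Rightarrow> ('m \<Rightarrow> 'v::euclidean_space) \<Rightarrow> 'm \<Rightarrow> real ^ 'n ^ 'n" where
  "inv_metric c f p = matrix_inv (metric c f p)"

definition christoffel ::
  "('m, 'n::finite) chart \<Rightarrow> ('m \<Rightarrow> 'v::euclidean_space) \<Rightarrow> 'n \<Rightarrow> 'n \<Rightarrow> 'n \<Rightarrow> 'm \<Rightarrow> real" where
  "christoffel c f k i j p =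
     (\<Sum>l\<in>UNIV. inv_metric c f p $ k $ l / 2 *
        (partial c i (\<lambda>q. metric c f q $ j $ l) p + partial c j (\<lambda>q. metric c f q $ i $ l) p
          - partial c l (\<lambda>q. metric c f q $ i $ j) p))"

text \<open>The measure of the Riemannian volume form: the Borel measure that is \<open>sqrt (det g) dx\<close> in
  every chart of the atlas.\<close>

definition volume_measure ::
  "('m::topological_space, 'n::finite) chart set \<Rightarrow> ('m \<Rightarrow> 'v::euclidean_space) \<Rightarrow> 'm measure" where
  "volume_measure \<A> f =
     (THE \<mu>. sets \<mu> = sets borel \<and>
        (\<forall>c\<in>\<A>. \<forall>B\<in>sets borel. B \<subseteq> chart_dom c \<longrightarrow>
           emeasure \<mu> B =
             (\<integral>\<^sup>+x\<in>chart_map c ` B. ennreal (sqrt (det (metric c f (chart_inv c x)))) \<partial>lborel)))"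

definition second_fund ::
  "('m, 'n::finite) chart \<Rightarrow> ('m \<Rightarrow> 'v::euclidean_space) \<Rightarrow> ('m \<Rightarrow> 'v) \<Rightarrow> 'n \<Rightarrow> 'n \<Rightarrow> 'm \<Rightarrow> real" where
  "second_fund c f \<nu> i j p = - (partial c i f p \<bullet> partial c j \<nu> p)"

definition mean_curv ::
  "('m, 'n::finite) chart \<Rightarrow> ('m \<Rightarrow> 'v::euclidean_space) \<Rightarrow> ('m \<Rightarrow> 'v) \<Rightarrow> 'm \<Rightarrow> real" where
  "mean_curv c f \<nu> p = (\<Sum>i\<in>UNIV. \<Sum>j\<in>UNIV. inv_metric c f p $ i $ j * second_fund c f \<nu> i j p)"

definition unit_normal ::
  "('m::topological_space, 'n::finite) chart set \<Rightarrow> real \<Rightarrow> (real \<Rightarrow> 'm \<Rightarrow> 'v::euclidean_space)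
     \<Rightarrow> (real \<Rightarrow> 'm \<Rightarrow> 'v) \<Rightarrow> bool" where
  "unit_normal \<A> T F \<nu> \<longleftrightarrow>
     smooth_family \<A> {0..T} \<nu> \<and>
     (\<forall>t\<in>{0..T}. \<forall>p. norm (\<nu> t p) = 1) \<and>
     (\<forall>t\<in>{0..T}. \<forall>c\<in>\<A>. \<forall>p\<in>chart_dom c. \<forall>i. \<nu> t p \<bullet> partial c i (F t) p = 0)"

text \<open>In the following, \<open>f\<close> is the immersion and \<open>v\<close> its velocity field, both at a fixed time.\<close>

definition tangential_velocity ::
  "('m, 'n::finite) chart \<Rightarrow> ('m \<Rightarrow> 'v::euclidean_space) \<Rightarrow> ('m \<Rightarrow> 'v) \<Rightarrow> 'n \<Rightarrow> 'm \<Rightarrow> real" where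
  "tangential_velocity c f v i p = v p \<bullet> partial c i f p"

text \<open>\<open>raise c f w k p\<close> is \<open>g\<^sup>k\<^sup>l w\<^sub>l\<close>.\<close>

definition raise ::
  "('m, 'n::finite) chart \<Rightarrow> ('m \<Rightarrow> 'v::euclidean_space) \<Rightarrow> ('n \<Rightarrow> 'm \<Rightarrow> real) \<Rightarrow> 'n \<Rightarrow> 'm \<Rightarrow> real" where
  "raise c f w k p = (\<Sum>l\<in>UNIV. inv_metric c f p $ k $ l * w l p)"

definition covector_norm_sq ::
  "('m, 'n::finite) chart \<Rightarrow> ('m \<Rightarrow> 'v::euclidean_space) \<Rightarrow> ('n \<Rightarrow> 'm \<Rightarrow> real) \<Rightarrow> 'm \<Rightarrow> real" where
  "covector_norm_sq c f w p = (\<Sum>i\<in>UNIV. \<Sum>j\<in>UNIV. inv_metric c f p $ i $ j * w i p * w j p)"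

text \<open>The Levi-Civita covariant derivative \<open>\<nabla>\<^sub>i w\<^sub>j\<close> of a covector field and its trace \<open>\<nabla>\<^sup>i w\<^sub>i\<close>.\<close>

definition cov_deriv ::
  "('m, 'n::finite) chart \<Rightarrow> ('m \<Rightarrow> 'v::euclidean_space) \<Rightarrow> ('n \<Rightarrow> 'm \<Rightarrow> real) \<Rightarrow> 'n \<Rightarrow> 'n \<Rightarrow> 'm \<Rightarrow> real"
  where
  "cov_deriv c f w i j p = partial c i (w j) p - (\<Sum>k\<in>UNIV. christoffel c f k i j p * w k p)"

definition covector_div ::
  "('m, 'n::finite) chart \<Rightarrow> ('m \<Rightarrow> 'v::euclidean_space) \<Rightarrow> ('n \<Rightarrow> 'm \<Rightarrow> real) \<Rightarrow> 'm \<Rightarrow> real" where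
  "covector_div c f w p = (\<Sum>i\<in>UNIV. \<Sum>j\<in>UNIV. inv_metric c f p $ i $ j * cov_deriv c f w i j p)"

section \<open>Time derivatives and actions\<close>

text \<open>Time derivatives are taken within \<open>{0..T}\<close>, hence are one-sided at the end points.\<close>

definition velocity :: "real \<Rightarrow> (real \<Rightarrow> 'm \<Rightarrow> 'v::real_normed_vector) \<Rightarrow> real \<Rightarrow> 'm \<Rightarrow> 'v" where
  "velocity T F t p = vector_derivative (\<lambda>r. F r p) (at t within {0..T})"

definition acceleration :: "real \<Rightarrow> (real \<Rightarrow> 'm \<Rightarrow> 'v::real_normed_vector) \<Rightarrow> real \<Rightarrow> 'm \<Rightarrow> 'v" where
  "acceleration T F = velocity T (velocity T F)"

text \<open>The actions, with the integration restricted to a region \<open>D\<close> of \<open>{0..T} \<times> M\<close>.\<close>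

definition J_K ::
  "('m::topological_space, 'n::finite) chart set \<Rightarrow> real \<Rightarrow> (real \<times> 'm) set
     \<Rightarrow> (real \<Rightarrow> 'm \<Rightarrow> 'v::euclidean_space) \<Rightarrow> real" where
  "J_K \<A> T D F =
     (LINT t:{0..T}|lborel. LINT p:{p. (t, p) \<in> D}|volume_measure \<A> (F t). (norm (velocity T F t p))\<^sup>2 / 2)"

definition J_V ::
  "('m::topological_space, 'n::finite) chart set \<Rightarrow> real \<Rightarrow> (real \<times> 'm) set
     \<Rightarrow> (real \<Rightarrow> 'm \<Rightarrow> 'v::euclidean_space) \<Rightarrow> real" where
  "J_V \<A> T D F =
     real CARD('n) / 2 *
       (LINT t:{0..T}|lborel. LINT p:{p. (t, p) \<in> D}|volume_measure \<A> (F t). 1)"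

text \<open>The integrals defining the unrestricted actions exist (and are finite). This is automatic
  on a compact manifold.\<close>

definition finite_actions ::
  "('m::topological_space, 'n::finite) chart set \<Rightarrow> real \<Rightarrow> (real \<Rightarrow> 'm \<Rightarrow> 'v::euclidean_space) \<Rightarrow> bool" where
  "finite_actions \<A> T F \<longleftrightarrow>
     (\<forall>t\<in>{0..T}. integrable (volume_measure \<A> (F t)) (\<lambda>p. 1 :: real) \<and>
                  integrable (volume_measure \<A> (F t)) (\<lambda>p. (norm (velocity T F t p))\<^sup>2 / 2)) \<and>
     set_integrable lborel {0..T} (\<lambda>t. LINT p|volume_measure \<A> (F t). (1 :: real)) \<and>
     set_integrable lborel {0..T} (\<lambda>t. LINT p|volume_measure \<A> (F t). (norm (velocity T F t p))\<^sup>2 / 2)"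

definition supp :: "(real \<Rightarrow> 'm::topological_space \<Rightarrow> 'v::real_normed_vector) \<Rightarrow> (real \<times> 'm) set" where
  "supp \<Phi> = closure {(t, p). \<Phi> t p \<noteq> 0}"

definition test_field ::
  "('m::topological_space, 'n::finite) chart set \<Rightarrow> real \<Rightarrow> (real \<Rightarrow> 'm \<Rightarrow> 'v::euclidean_space) \<Rightarrow> bool" where
  "test_field \<A> T \<Phi> \<longleftrightarrow>
     smooth_family \<A> {0<..<T} \<Phi> \<and> compact (supp \<Phi>) \<and> supp \<Phi> \<subseteq> {0<..<T} \<times> UNIV"

text \<open>If the actions are not finite, the derivative in \<open>s\<close> is understood by restricting the
  integrals to a compact set containing the support of \<open>\<Phi>\<close>. Which one is immaterial, since the
  integrands outside the support do not depend on \<open>s\<close>.\<close>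

definition stationary ::
  "('m::topological_space, 'n::finite) chart set \<Rightarrow> real \<Rightarrow> (real \<Rightarrow> 'm \<Rightarrow> 'v::euclidean_space) \<Rightarrow> bool" where
  "stationary \<A> T F \<longleftrightarrow>
     (\<forall>\<Phi>. test_field \<A> T \<Phi> \<longrightarrow>
        (let DJ = (\<lambda>D. ((\<lambda>s. J_V \<A> T D (\<lambda>t p. F t p + s *\<^sub>R \<Phi> t p) -
                              J_K \<A> T D (\<lambda>t p. F t p + s *\<^sub>R \<Phi> t p))
                          has_real_derivative 0) (at 0))
         in if finite_actions \<A> T F then DJ ({0..T} \<times> UNIV)
            else (\<forall>D. compact D \<and> supp \<Phi> \<subseteq> D \<and> D \<subseteq> {0..T} \<times> UNIV \<longrightarrow> DJ D)))"

end

theory Submission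
  imports Defs "HOL-Computational_Algebra.Polynomial"
begin

text \<open>Write \<open>w = sqrt (det g)\<close> for the volume density and \<open>v\<close> for the velocity in a chart. Testing
  stationarity against \<open>\<phi> b\<close>, with a bump function \<open>\<phi>\<close> supported in one chart and a constant vector \<open>b\<close>,
  and integrating by parts gives the Euler-Lagrange equation
  \<open>\<partial>\<^sub>t (w v) = \<Sum>j. \<partial>\<^sub>j (L w g\<^sup>i\<^sup>j F\<^sub>i)\<close>, \<open>L = (n - |v|\<^sup>2) / 2\<close>, for \<open>0 < t < T\<close>, and by continuity also at the
  end points. Since \<open>\<Sum>j. \<partial>\<^sub>j (w g\<^sup>i\<^sup>j F\<^sub>i) = w H \<nu>\<close> and \<open>\<partial>\<^sub>t w = w (div S - \<sigma> H)\<close>, it reads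
  \<open>\<partial>\<^sub>t v + (div S - \<sigma> H) v = L H \<nu> - grad e\<close>, and \<open>v = \<sigma> \<nu> + S\<^sup>k F\<^sub>k\<close> together with
  \<open>|v|\<^sup>2 = \<sigma>\<^sup>2 + |S|\<^sup>2\<close> yields the claim.\<close>

section \<open>Directional derivatives and differentiability classes\<close>

text \<open>\<open>volume_measure\<close> is a definite description, so no action can be evaluated
  before such a measure is known to exist and to be unique. Densities of different charts agree on
  overlaps by the change of variables formula, and the manifold splits into countably many Borel
  pieces, each inside one chart. For a test field over one coordinate box, both readings of
  stationarity (finite actions, or restriction to a compact set) then reduce to one integral over a
  box in space-time, up to a term independent of s. The other obstacle is the closed time interval:
  at 0 and T the family has only one-sided time derivatives, whereas the calculus here lives on open
  sets. Pointwise computations therefore concern a smooth extension g of the coordinate expression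
  of F to an open neighbourhood of (t, x). The formula for the divergence of w g^ij F_i is verified
  by pairing with \<nu> and with every F_l, which together span the ambient space. Orthogonality
  handles the first pairing and Jacobi's formula for the derivative of w the second; Christoffel
  symbols enter only through div S.\<close>

abbreviation dd :: "'a::real_normed_vector \<Rightarrow> ('a \<Rightarrow> 'b::real_normed_vector) \<Rightarrow> 'a \<Rightarrow> 'b" where
  "dd v f x \<equiv> frechet_derivative f (at x) v"

lemma has_derivative_frechet:
  "f differentiable (at x) \<Longrightarrow> (f has_derivative (\<lambda>v. dd v f x)) (at x)"
  by (simp add: frechet_derivative_works)

lemma dd_eq: "(f has_derivative f') (at x) \<Longrightarrow> dd v f x = f' v"
  by (metis frechet_derivative_at)

lemma linear_dd: "f differentiable (at x) \<Longrightarrow> linear (\<lambda>v. dd v f x)"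
  by (simp add: linear_frechet_derivative)

text \<open>Holds also at points of non-differentiability: \<open>frechet_derivative\<close> is a
  choice among all derivatives, and f and g have the same derivatives at x, so the choices
  coincide.\<close>

lemma dd_open_cong:
  assumes "open W" "x \<in> W" "\<And>y. y \<in> W \<Longrightarrow> f y = g y"
  shows "dd v f x = dd v g x"
proof -
  have "(f has_derivative D) (at x) = (g has_derivative D) (at x)" for D
    using assms has_derivative_transform_within_open[of f D x UNIV W g]
      has_derivative_transform_within_open[of g D x UNIV W f] by fastforce
  then show ?thesis
    by (simp add: frechet_derivative_def)
qed

lemma differentiable_open_cong:
  assumes "open W" "x \<in> W" "\<And>y. y \<in> W \<Longrightarrow> f y = g y" "f differentiable (at x)"
  shows "g differentiable (at x)"
  using assms unfolding differentiable_def
  using has_derivative_transform_within_open[of f _ x UNIV W g] by blast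

lemma Ck_on_cong:
  assumes "open W" "\<And>x. x \<in> W \<Longrightarrow> f x = g x" "Ck_on k W f"
  shows "Ck_on k W g"
  using assms
proof (induction k arbitrary: f g)
  case 0
  then show ?case by (simp cong: continuous_on_cong)
next
  case (Suc k)
  show ?case
    unfolding Ck_on.simps
  proof (intro conjI ballI allI)
    fix x assume "x \<in> W"
    then show "g differentiable (at x)"
      using Suc.prems differentiable_open_cong[of W x f g] by simp
  next
    fix v
    show "Ck_on k W (\<lambda>x. dd v g x)"
    proof (rule Suc.IH)
      show "dd v f x = dd v g x" if "x \<in> W" for x
        using Suc.prems that by (intro dd_open_cong[of W]) auto
    qed (use Suc.prems in auto)
  qed
qed

lemma Ck_on_subset: "Ck_on k W f \<Longrightarrow> V \<subseteq> W \<Longrightarrow> Ck_on k V f"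
  by (induction k arbitrary: f) (auto intro: continuous_on_subset)

lemma Ck_on_SucD: "Ck_on (Suc k) W f \<Longrightarrow> Ck_on k W f"
proof (induction k arbitrary: f)
  case 0
  then show ?case
    using continuous_at_imp_continuous_on differentiable_imp_continuous_within by fastforce
qed auto

lemma Ck_on_le: "Ck_on k W f \<Longrightarrow> j \<le> k \<Longrightarrow> Ck_on j W f"
  by (induction k) (auto simp: le_Suc_eq dest: Ck_on_SucD simp del: Ck_on.simps)

lemma Ck_on_continuous: "Ck_on k W f \<Longrightarrow> continuous_on W f"
  using Ck_on_le[of k W f 0] by simp

lemma Ck_on_dd: "Ck_on (Suc k) W f \<Longrightarrow> Ck_on k W (dd v f)"
  by simp

lemma Ck_on_differentiable: "Ck_on (Suc k) W f \<Longrightarrow> x \<in> W \<Longrightarrow> f differentiable (at x)"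
  by simp

text \<open>Continuity and differentiability are pointwise, and the induction passes to
  \<open>dd v f\<close> with the same neighbourhoods. This glues functions given by different
  formulas near different points.\<close>

lemma Ck_on_local:
  assumes "\<And>x. x \<in> S \<Longrightarrow> \<exists>W. open W \<and> x \<in> W \<and> Ck_on k W f"
  shows "Ck_on k S f"
  using assms
proof (induction k arbitrary: f)
  case 0
  then show ?case
    by (metis Ck_on.simps(1) continuous_on_eq_continuous_at continuous_at_imp_continuous_on)
next
  case (Suc k)
  show ?case
    unfolding Ck_on.simps
  proof (intro conjI ballI allI)
    show "f differentiable (at x)" if "x \<in> S" for x
      using Suc.prems[OF that] by auto
    show "Ck_on k S (dd v f)" for v
      by (rule Suc.IH) (use Suc.prems in fastforce)
  qed
qed

lemma Ck_on_const [simp]: "Ck_on k W (\<lambda>x. c)"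
  by (induction k arbitrary: c) auto

lemma Ck_on_bounded_linear_comp:
  assumes "bounded_linear L" "open W" "Ck_on k W f"
  shows "Ck_on k W (\<lambda>x. L (f x))"
  using assms(3)
proof (induction k arbitrary: f)
  case 0
  then show ?case
    using assms(1) by (simp add: linear_continuous_on_compose bounded_linear.linear
        bounded_linear.continuous_on)
next
  case (Suc k)
  have der: "((\<lambda>x. L (f x)) has_derivative (\<lambda>v. L (dd v f x))) (at x)" if "x \<in> W" for x
    using Suc.prems that
    by (intro bounded_linear.has_derivative[OF assms(1)] has_derivative_frechet) auto
  show ?case
    unfolding Ck_on.simps
  proof (intro conjI ballI allI)
    show "(\<lambda>x. L (f x)) differentiable (at x)" if "x \<in> W" for x
      using der[OF that] by (auto simp: differentiable_def)
    show "Ck_on k W (dd v (\<lambda>x. L (f x)))" for v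
    proof (rule Ck_on_cong[OF assms(2)])
      show "L (dd v f x) = dd v (\<lambda>x. L (f x)) x" if "x \<in> W" for x
        using dd_eq[OF der[OF that]] by simp
      show "Ck_on k W (\<lambda>x. L (dd v f x))"
        using Suc by simp
    qed
  qed
qed

lemma Ck_on_ident [simp]: "Ck_on k W (\<lambda>x. x)"
proof (cases k)
  case (Suc m)
  have "dd v (\<lambda>x. x) x = v" for v x :: 'a
    by (rule dd_eq) (rule has_derivative_ident)
  then show ?thesis
    using Suc by simp
qed simp

lemma Ck_on_add:
  assumes "open W" "Ck_on k W f" "Ck_on k W g"
  shows "Ck_on k W (\<lambda>x. f x + g x)"
  using assms(2,3)
proof (induction k arbitrary: f g)
  case 0
  then show ?case
    by (simp add: continuous_on_add)
next
  case (Suc k)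
  have der: "((\<lambda>x. f x + g x) has_derivative (\<lambda>v. dd v f x + dd v g x)) (at x)" if "x \<in> W" for x
    using Suc.prems that by (intro has_derivative_add has_derivative_frechet) auto
  show ?case
    unfolding Ck_on.simps
  proof (intro conjI ballI allI)
    show "(\<lambda>x. f x + g x) differentiable (at x)" if "x \<in> W" for x
      using der[OF that] by (auto simp: differentiable_def)
    show "Ck_on k W (dd v (\<lambda>x. f x + g x))" for v
    proof (rule Ck_on_cong[OF assms(1)])
      show "dd v f x + dd v g x = dd v (\<lambda>x. f x + g x) x" if "x \<in> W" for x
        using dd_eq[OF der[OF that]] by simp
      show "Ck_on k W (\<lambda>x. dd v f x + dd v g x)"
        using Suc by simp
    qed
  qed
qed

lemma Ck_on_sum:
  assumes "open W" "\<And>i. i \<in> I \<Longrightarrow> Ck_on k W (f i)"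
  shows "Ck_on k W (\<lambda>x. \<Sum>i\<in>I. f i x)"
  using assms(2) by (induction I rule: infinite_finite_induct) (auto intro: Ck_on_add[OF assms(1)])

text \<open>One product rule for scaling, inner product and multiplication. Each term of the
  derivative keeps one factor undifferentiated, so the factors are also needed one class lower,
  which \<open>Ck_on_SucD\<close> supplies.\<close>

lemma Ck_on_bilinear:
  assumes "bounded_bilinear B" "open W" "Ck_on k W f" "Ck_on k W g"
  shows "Ck_on k W (\<lambda>x. B (f x) (g x))"
  using assms(3,4)
proof (induction k arbitrary: f g)
  case 0
  then show ?case
    by (simp add: bounded_bilinear.continuous_on[OF assms(1)])
next
  case (Suc k)
  have der: "((\<lambda>x. B (f x) (g x)) has_derivative (\<lambda>v. B (f x) (dd v g x) + B (dd v f x) (g x))) (at x)"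
    if "x \<in> W" for x
    using Suc.prems that by (intro bounded_bilinear.FDERIV[OF assms(1)] has_derivative_frechet) auto
  show ?case
    unfolding Ck_on.simps
  proof (intro conjI ballI allI)
    show "(\<lambda>x. B (f x) (g x)) differentiable (at x)" if "x \<in> W" for x
      using der[OF that] by (auto simp: differentiable_def)
    show "Ck_on k W (dd v (\<lambda>x. B (f x) (g x)))" for v
    proof (rule Ck_on_cong[OF assms(2)])
      show "B (f x) (dd v g x) + B (dd v f x) (g x) = dd v (\<lambda>x. B (f x) (g x)) x" if "x \<in> W" for x
        using dd_eq[OF der[OF that]] by simp
      show "Ck_on k W (\<lambda>x. B (f x) (dd v g x) + B (dd v f x) (g x))"
        using Suc Ck_on_SucD[OF Suc.prems(1)] Ck_on_SucD[OF Suc.prems(2)]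
        by (intro Ck_on_add[OF assms(2)]) simp_all
    qed
  qed
qed

lemmas Ck_on_scaleR = Ck_on_bilinear[OF bounded_bilinear_scaleR]
lemmas Ck_on_inner = Ck_on_bilinear[OF bounded_bilinear_inner]
lemmas Ck_on_mult = Ck_on_bilinear[OF bounded_bilinear_mult]

lemma Ck_on_diff:
  assumes "open W" "Ck_on k W f" "Ck_on k W g"
  shows "Ck_on k W (\<lambda>x. f x - g x)"
  using Ck_on_add[OF assms(1,2) Ck_on_bounded_linear_comp[OF bounded_linear_minus[OF bounded_linear_ident] assms(1,3)]]
  by simp

lemma Ck_on_prod:
  fixes f :: "'i \<Rightarrow> 'a::euclidean_space \<Rightarrow> real"
  assumes "open W" "\<And>i. i \<in> I \<Longrightarrow> Ck_on k W (f i)"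
  shows "Ck_on k W (\<lambda>x. \<Prod>i\<in>I. f i x)"
  using assms(2) by (induction I rule: infinite_finite_induct) (auto intro: Ck_on_mult[OF assms(1)])

lemma dd_Basis_sum:
  fixes f :: "'a::euclidean_space \<Rightarrow> 'b::real_normed_vector"
  assumes "f differentiable (at x)"
  shows "dd v f x = (\<Sum>b\<in>Basis. (v \<bullet> b) *\<^sub>R dd b f x)"
proof -
  have "dd v f x = dd (\<Sum>b\<in>Basis. (v \<bullet> b) *\<^sub>R b) f x"
    by (simp add: euclidean_representation)
  also have "\<dots> = (\<Sum>b\<in>Basis. dd ((v \<bullet> b) *\<^sub>R b) f x)"
    by (rule linear_sum[OF linear_dd[OF assms]])
  also have "\<dots> = (\<Sum>b\<in>Basis. (v \<bullet> b) *\<^sub>R dd b f x)"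
    by (intro sum.cong refl linear_cmul[OF linear_dd[OF assms]])
  finally show ?thesis .
qed

lemma dd_compose:
  fixes f :: "'a::euclidean_space \<Rightarrow> 'b::euclidean_space" and g :: "'b \<Rightarrow> 'c::real_normed_vector"
  assumes "f differentiable (at x)" "g differentiable (at (f x))"
  shows "dd v (\<lambda>x. g (f x)) x = dd (dd v f x) g (f x)"
    and "(\<lambda>x. g (f x)) differentiable (at x)"
proof -
  have "((\<lambda>x. g (f x)) has_derivative (\<lambda>v. dd (dd v f x) g (f x))) (at x)"
    using has_derivative_compose[OF has_derivative_frechet[OF assms(1)] has_derivative_frechet[OF assms(2)]] .
  then show "dd v (\<lambda>x. g (f x)) x = dd (dd v f x) g (f x)" "(\<lambda>x. g (f x)) differentiable (at x)"
    by (auto simp: dd_eq differentiable_def)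
qed

text \<open>The chain rule differentiates g in the moving direction \<open>dd v f x\<close>, while
  \<open>Ck_on\<close> controls only fixed directions. Expanding that direction in the basis gives a
  sum of products, to which the induction hypothesis for \<open>dd b g\<close> applies.\<close>

lemma Ck_on_compose:
  fixes f :: "'a::euclidean_space \<Rightarrow> 'b::euclidean_space" and g :: "'b \<Rightarrow> 'c::real_normed_vector"
  assumes "open W" "Ck_on k W f" "Ck_on k V g" "f ` W \<subseteq> V"
  shows "Ck_on k W (\<lambda>x. g (f x))"
  using assms(2,3)
proof (induction k arbitrary: g)
  case 0
  then show ?case
    using assms(4) by (auto intro: continuous_on_compose2)
next
  case (Suc k)
  have fx: "f x \<in> V" if "x \<in> W" for x
    using that assms(4) by auto
  show ?case
    unfolding Ck_on.simps
  proof (intro conjI ballI allI)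
    show "(\<lambda>x. g (f x)) differentiable (at x)" if "x \<in> W" for x
      by (rule dd_compose(2)[OF Ck_on_differentiable[OF Suc.prems(1) that] Ck_on_differentiable[OF Suc.prems(2) fx[OF that]]])
    show "Ck_on k W (dd v (\<lambda>x. g (f x)))" for v
    proof (rule Ck_on_cong[OF assms(1)])
      show "(\<Sum>b\<in>Basis. (dd v f x \<bullet> b) *\<^sub>R dd b g (f x)) = dd v (\<lambda>x. g (f x)) x" if "x \<in> W" for x
      proof -
        have "f differentiable (at x)" "g differentiable (at (f x))"
          using Ck_on_differentiable[OF Suc.prems(1) that] Ck_on_differentiable[OF Suc.prems(2) fx[OF that]]
          by blast+
        then show ?thesis
          using dd_compose(1)[of f x g v] dd_Basis_sum[of g "f x" "dd v f x"] by simp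
      qed
      show "Ck_on k W (\<lambda>x. \<Sum>b\<in>Basis. (dd v f x \<bullet> b) *\<^sub>R dd b g (f x))"
        using Suc.prems Ck_on_SucD[OF Suc.prems(1)]
        by (intro Ck_on_sum Ck_on_scaleR Suc.IH Ck_on_inner assms(1)) auto
    qed
  qed
qed

lemma Ck_on_real_SucI:
  fixes f :: "real \<Rightarrow> real"
  assumes "open W" "\<And>x. x \<in> W \<Longrightarrow> (f has_real_derivative f' x) (at x)" "Ck_on k W f'"
  shows "Ck_on (Suc k) W f"
proof -
  have der: "(f has_derivative (\<lambda>v. v * f' x)) (at x)" if "x \<in> W" for x
    using assms(2)[OF that] by (simp add: has_field_derivative_def mult.commute[of _ "f' x"])
  show ?thesis
    unfolding Ck_on.simps
  proof (intro conjI ballI allI)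
    show "f differentiable (at x)" if "x \<in> W" for x
      using der[OF that] by (auto simp: differentiable_def)
    show "Ck_on k W (dd v f)" for v
    proof (rule Ck_on_cong[OF assms(1)])
      show "v * f' x = dd v f x" if "x \<in> W" for x
        using dd_eq[OF der[OF that]] by simp
      show "Ck_on k W (\<lambda>x. v * f' x)"
        by (intro Ck_on_mult assms(1,3)) simp
    qed
  qed
qed

text \<open>The derivative is again built from \<open>inverse\<close>, so the induction on k closes;
  \<open>sqrt\<close> works the same way with the help of this lemma.\<close>

lemma Ck_on_inverse: "Ck_on k (- {0}) (inverse :: real \<Rightarrow> real)"
proof (induction k)
  case (Suc k)
  have "Ck_on k (- {0}) (\<lambda>x::real. (- 1) * (inverse x * inverse x))"
    by (intro Ck_on_mult Suc Ck_on_const) auto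
  then show ?case
    by (intro Ck_on_real_SucI[where f' = "\<lambda>x. (- 1) * (inverse x * inverse x)"])
      (auto intro!: derivative_eq_intros)
qed (auto intro!: continuous_intros)

lemma Ck_on_sqrt: "Ck_on k {0<..} sqrt"
proof (induction k)
  case (Suc k)
  have "Ck_on k {0<..} (\<lambda>x. inverse (sqrt x) * (1 / 2))"
    by (intro Ck_on_mult Ck_on_compose[OF _ Suc Ck_on_inverse] Ck_on_const) auto
  then show ?case
    by (intro Ck_on_real_SucI[where f' = "\<lambda>x. inverse (sqrt x) * (1 / 2)"])
      (auto intro!: derivative_eq_intros simp: field_simps)
qed (auto intro!: continuous_intros)

lemma smooth_on_open_Ck_on:
  assumes "open S" "smooth_on S f"
  shows "Ck_on k S f"
proof (rule Ck_on_local)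
  fix x assume "x \<in> S"
  then obtain W g where W: "open W" "x \<in> W" "\<And>k. Ck_on k W g" "\<And>y. y \<in> S \<inter> W \<Longrightarrow> g y = f y"
    using assms(2) unfolding smooth_on_def by meson
  have "Ck_on k (S \<inter> W) f"
    by (rule Ck_on_cong[where f = g]) (use W assms Ck_on_subset[OF W(3)] in auto)
  then show "\<exists>W. open W \<and> x \<in> W \<and> Ck_on k W f"
    using W \<open>x \<in> S\<close> assms(1) by (intro exI[of _ "S \<inter> W"]) auto
qed

lemma Ck_on_open_smooth_on:
  assumes "open S" "\<And>k. Ck_on k S f"
  shows "smooth_on S f"
  unfolding smooth_on_def using assms by (intro ballI exI[of _ S] exI[of _ f]) auto

lemma has_vector_derivative_dd_compose:
  assumes "(\<gamma> has_vector_derivative u) (at a)" "f differentiable (at (\<gamma> a))"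
  shows "((\<lambda>a. f (\<gamma> a)) has_vector_derivative dd u f (\<gamma> a)) (at a)"
proof -
  have "((\<lambda>a. f (\<gamma> a)) has_derivative (\<lambda>r. dd (r *\<^sub>R u) f (\<gamma> a))) (at a)"
    using assms(1)[unfolded has_vector_derivative_def] has_derivative_frechet[OF assms(2)]
    by (rule has_derivative_compose[where g = f and f = \<gamma>])
  then show ?thesis
    using linear_cmul[OF linear_dd[OF assms(2)]] by (simp add: has_vector_derivative_def)
qed

section \<open>Symmetry of second directional derivatives\<close>

text \<open>The second difference of f over the parallelogram with sides h v and h w is symmetric in
  v and w, and it equals h^2 times either mixed derivative at some nearby point. As h tends to 0,
  continuity identifies the two limits.\<close>

lemma dd_symmetric_real:
  fixes f :: "'a::euclidean_space \<Rightarrow> real"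
  assumes W: "open W" "x \<in> W" and f: "Ck_on 2 W f"
  shows "dd w (dd v f) x = dd v (dd w f) x"
proof -
  \<comment> \<open>The summand 1 makes N positive and places the closed parallelogram strictly
    inside the ball of radius h N.\<close>
  define N where "N = norm v + norm w + 1"
  have N: "N > 0" by (simp add: N_def add_nonneg_pos)
  obtain e where e: "e > 0" "ball x e \<subseteq> W"
    using W open_contains_ball by blast
  have f2: "Ck_on (Suc (Suc 0)) W f"
    using f by (simp add: numeral_2_eq_2)
  have diff: "f differentiable (at y)" "dd u f differentiable (at y)" if "y \<in> W" for y u
    using f2 that by auto
  \<comment> \<open>The mean value theorem is used twice: along u for the difference of f in
    direction z, then along z for \<open>dd u f\<close>.\<close>
  have mean: "\<exists>y. dist y x < h * N \<and>
      f (x + h *\<^sub>R u + h *\<^sub>R z) - f (x + h *\<^sub>R u) - f (x + h *\<^sub>R z) + f x = h * h * dd z (dd u f) y"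
    if h: "h > 0" "h * N < e" and uz: "norm u + norm z + 1 = N" for h u z
  proof -
    have inW: "x + a *\<^sub>R u + b *\<^sub>R z \<in> W" and close: "dist (x + a *\<^sub>R u + b *\<^sub>R z) x < h * N"
      if "0 \<le> a" "a \<le> h" "0 \<le> b" "b \<le> h" for a b
    proof -
      have "dist (x + a *\<^sub>R u + b *\<^sub>R z) x \<le> a * norm u + b * norm z"
        using norm_triangle_ineq[of "a *\<^sub>R u" "b *\<^sub>R z"] that by (simp add: dist_norm algebra_simps)
      also have "\<dots> \<le> h * norm u + h * norm z"
        using that by (intro add_mono mult_right_mono) auto
      also have "\<dots> < h * N"
        using h by (simp add: uz[symmetric] algebra_simps)
      finally show *: "dist (x + a *\<^sub>R u + b *\<^sub>R z) x < h * N" .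
      then show "x + a *\<^sub>R u + b *\<^sub>R z \<in> W"
        using h e by (auto simp: dist_commute)
    qed
    let ?g = "\<lambda>a. f (x + a *\<^sub>R u + h *\<^sub>R z) - f (x + a *\<^sub>R u + 0 *\<^sub>R z)"
    have g': "(?g has_real_derivative (dd u f (x + a *\<^sub>R u + h *\<^sub>R z) - dd u f (x + a *\<^sub>R u + 0 *\<^sub>R z))) (at a)"
      if a: "0 \<le> a" "a \<le> h" for a
    proof -
      have *: "((\<lambda>a. f (x + a *\<^sub>R u + b *\<^sub>R z)) has_real_derivative dd u f (x + a *\<^sub>R u + b *\<^sub>R z)) (at a)"
        if b: "0 \<le> b" "b \<le> h" for b
      proof -
        have "((\<lambda>a. x + a *\<^sub>R u + b *\<^sub>R z) has_vector_derivative u) (at a)"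
          by (auto intro!: derivative_eq_intros)
        then show ?thesis
          unfolding has_real_derivative_iff_has_vector_derivative
          by (rule has_vector_derivative_dd_compose) (rule diff(1)[OF inW[OF a b]])
      qed
      show ?thesis
        using *[of h] *[of 0] h by (intro DERIV_diff) auto
    qed
    obtain a where a: "0 < a" "a < h"
      and ga: "?g h - ?g 0 = (h - 0) * (dd u f (x + a *\<^sub>R u + h *\<^sub>R z) - dd u f (x + a *\<^sub>R u + 0 *\<^sub>R z))"
      using MVT2[of 0 h ?g, OF h(1) g'] by blast
    have k': "((\<lambda>b. dd u f (x + a *\<^sub>R u + b *\<^sub>R z)) has_real_derivative dd z (dd u f) (x + a *\<^sub>R u + b *\<^sub>R z)) (at b)"
      if b: "0 \<le> b" "b \<le> h" for b
    proof -
      have in1: "x + a *\<^sub>R u + b *\<^sub>R z \<in> W"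
        using a b by (intro inW) auto
      have "((\<lambda>b. x + a *\<^sub>R u + b *\<^sub>R z) has_vector_derivative z) (at b)"
        by (auto intro!: derivative_eq_intros)
      then show ?thesis
        unfolding has_real_derivative_iff_has_vector_derivative
        by (rule has_vector_derivative_dd_compose) (rule diff(2)[OF in1])
    qed
    obtain b where b: "0 < b" "b < h"
      and "dd u f (x + a *\<^sub>R u + h *\<^sub>R z) - dd u f (x + a *\<^sub>R u + 0 *\<^sub>R z) = (h - 0) * dd z (dd u f) (x + a *\<^sub>R u + b *\<^sub>R z)"
      using MVT2[of 0 h "\<lambda>b. dd u f (x + a *\<^sub>R u + b *\<^sub>R z)", OF h(1) k'] by blast
    then show ?thesis
      using ga close[of a b] a by (intro exI[of _ "x + a *\<^sub>R u + b *\<^sub>R z"]) (simp add: algebra_simps)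
  qed
  \<comment> \<open>Scaled so that \<open>h n * N\<close> is e / (2 (n + 1)), which is below e and
    tends to 0.\<close>
  define h where "h = (\<lambda>n::nat. e / (2 * N) / real (Suc n))"
  have h: "h n > 0" "h n * N < e" for n
  proof -
    show "h n > 0" using e N by (simp add: h_def)
    have "h n * N = e / (2 * real (Suc n))"
      using N by (simp add: h_def del: of_nat_Suc)
    also have "\<dots> < e" using e by (simp add: field_simps add_strict_increasing)
    finally show "h n * N < e" .
  qed
  have "h \<longlonglongrightarrow> 0"
  proof -
    have "(\<lambda>n. e / (2 * N) * inverse (real (Suc n))) \<longlonglongrightarrow> e / (2 * N) * 0"
      by (rule tendsto_mult_left[OF LIMSEQ_inverse_real_of_nat])
    then show ?thesis
      unfolding h_def divide_inverse by (simp only: mult_zero_right)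
  qed
  then have h0: "(\<lambda>n. h n * N) \<longlonglongrightarrow> 0"
    using tendsto_mult_right[of h 0 sequentially N] by simp
  have lim: "(\<lambda>n. dd z (dd u f) (y n)) \<longlonglongrightarrow> dd z (dd u f) x"
    if "\<And>n. dist (y n) x < h n * N" for y u z
  proof -
    have "(\<lambda>n. dist (y n) x) \<longlonglongrightarrow> 0"
    proof (rule tendsto_sandwich[OF _ _ tendsto_const h0])
      show "\<forall>\<^sub>F n in sequentially. dist (y n) x \<le> h n * N"
        using that by (simp add: less_imp_le)
    qed simp
    then have "y \<longlonglongrightarrow> x"
      by (rule tendsto_dist_iff[THEN iffD2])
    moreover have "isCont (dd z (dd u f)) x"
    proof -
      have "continuous_on W (dd z (dd u f))"
        using f2 by simp
      then show ?thesis
        using W by (simp add: continuous_on_eq_continuous_at)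
    qed
    ultimately show ?thesis
      by (rule isCont_tendsto_compose[where g = "dd z (dd u f)", rotated])
  qed
  define \<Delta> where "\<Delta> n = f (x + h n *\<^sub>R v + h n *\<^sub>R w) - f (x + h n *\<^sub>R v) - f (x + h n *\<^sub>R w) + f x" for n
  have "\<exists>y. dist y x < h n * N \<and> \<Delta> n = h n * h n * dd w (dd v f) y" for n
  proof -
    have "norm v + norm w + 1 = N"
      by (simp only: N_def)
    from mean[OF h this, of n] show ?thesis
      unfolding \<Delta>_def .
  qed
  then have "\<exists>y. \<forall>n. dist (y n) x < h n * N \<and> \<Delta> n = h n * h n * dd w (dd v f) (y n)"
    by (intro choice allI)
  then obtain y where "\<forall>n. dist (y n) x < h n * N \<and> \<Delta> n = h n * h n * dd w (dd v f) (y n)" ..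
  then have y: "dist (y n) x < h n * N" "\<Delta> n = h n * h n * dd w (dd v f) (y n)" for n
    by auto
  have "\<exists>y. dist y x < h n * N \<and> \<Delta> n = h n * h n * dd v (dd w f) y" for n
  proof -
    have "norm w + norm v + 1 = N"
      by (simp add: N_def)
    moreover have "\<Delta> n = f (x + h n *\<^sub>R w + h n *\<^sub>R v) - f (x + h n *\<^sub>R w) - f (x + h n *\<^sub>R v) + f x"
    proof -
      have eq: "x + h n *\<^sub>R w + h n *\<^sub>R v = x + h n *\<^sub>R v + h n *\<^sub>R w"
        by (simp only: add.assoc add.commute[of "h n *\<^sub>R w"])
      show ?thesis
        unfolding \<Delta>_def eq by simp
    qed
    ultimately show ?thesis
      using mean[OF h, of w v n] by presburger
  qed
  then have "\<exists>y. \<forall>n. dist (y n) x < h n * N \<and> \<Delta> n = h n * h n * dd v (dd w f) (y n)"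
    by (intro choice allI)
  then obtain y' where "\<forall>n. dist (y' n) x < h n * N \<and> \<Delta> n = h n * h n * dd v (dd w f) (y' n)" ..
  then have y': "dist (y' n) x < h n * N" "\<Delta> n = h n * h n * dd v (dd w f) (y' n)" for n
    by auto
  have "dd w (dd v f) (y n) = dd v (dd w f) (y' n)" for n
  proof -
    have "h n * h n * dd w (dd v f) (y n) = h n * h n * dd v (dd w f) (y' n)"
      using y(2)[of n] y'(2)[of n] by (simp only:)
    then show ?thesis
      using h(1)[of n] by simp
  qed
  then have "(\<lambda>n. dd v (dd w f) (y' n)) \<longlonglongrightarrow> dd w (dd v f) x"
    using lim[of y v w, OF y(1)] by (simp only:)
  with lim[of y' w v, OF y'(1)] show ?thesis
    by (rule LIMSEQ_unique[rotated])
qed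

lemma dd_inner_const:
  assumes "f differentiable (at x)"
  shows "dd v (\<lambda>y. f y \<bullet> b) x = dd v f x \<bullet> b"
  by (rule dd_eq) (intro has_derivative_inner_left has_derivative_frechet assms)

lemma dd_symmetric:
  fixes f :: "'a::euclidean_space \<Rightarrow> 'b::euclidean_space"
  assumes W: "open W" "x \<in> W" and f: "Ck_on 2 W f"
  shows "dd w (dd v f) x = dd v (dd w f) x"
proof (rule euclidean_eqI)
  fix b :: 'b
  have f2: "Ck_on (Suc (Suc 0)) W f"
    using f by (simp add: numeral_2_eq_2)
  have *: "dd w (dd v f) x \<bullet> b = dd w (dd v (\<lambda>y. f y \<bullet> b)) x" for v w
  proof -
    have "dd w (dd v f) x \<bullet> b = dd w (\<lambda>y. dd v f y \<bullet> b) x"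
      using f2 W by (intro dd_inner_const[symmetric]) auto
    also have "\<dots> = dd w (dd v (\<lambda>y. f y \<bullet> b)) x"
      using f2 W by (intro dd_open_cong[OF W]) (simp add: dd_inner_const)
    finally show ?thesis .
  qed
  have "Ck_on 2 W (\<lambda>y. f y \<bullet> b)"
    by (intro Ck_on_inner W f Ck_on_const)
  from dd_symmetric_real[OF W this, of w v] show "dd w (dd v f) x \<bullet> b = dd v (dd w f) x \<bullet> b"
    by (simp add: *)
qed

section \<open>Bump functions\<close>

text \<open>The functions \<open>p (1 / x) exp (- 1 / x)\<close>, \<open>p\<close> a polynomial, are closed under differentiation.\<close>

definition flat :: "real poly \<Rightarrow> real \<Rightarrow> real" where
  "flat p x = (if x > 0 then poly p (1 / x) * exp (- (1 / x)) else 0)"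

lemma poly_times_exp_tendsto_0: "((\<lambda>y::real. poly p y * exp (- y)) \<longlongrightarrow> 0) at_top"
proof -
  have "((\<lambda>y::real. \<Sum>i\<le>degree p. coeff p i * (y ^ i / exp y)) \<longlongrightarrow> (\<Sum>i\<le>degree p. coeff p i * 0)) at_top"
    by (intro tendsto_sum tendsto_mult tendsto_const tendsto_power_div_exp_0)
  then show ?thesis
    by (simp add: poly_altdef sum_distrib_right exp_minus divide_inverse mult.assoc)
qed

text \<open>For x > 0 the derivative of p(1/x) exp(-1/x) is (p(1/x) - p'(1/x)) exp(-1/x) / x^2,
  whence the factor \<open>[:0, 0, 1:]\<close>, the square of the variable. At 0 the exponential
  beats every power of 1/x.\<close>

lemma flat_has_real_derivative:
  "(flat p has_real_derivative flat ([:0, 0, 1:] * (p - pderiv p)) x) (at x)"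
proof (cases x "0 :: real" rule: linorder_cases)
  case less
  have "((\<lambda>x. 0) has_real_derivative 0) (at x)"
    by simp
  then have "(flat p has_real_derivative 0) (at x)"
    by (rule has_field_derivative_transform_within_open[where S = "{..<0}"]) (use less in \<open>auto simp: flat_def\<close>)
  then show ?thesis
    using less by (simp add: flat_def)
next
  case greater
  have "((\<lambda>x. poly p (1 / x) * exp (- (1 / x))) has_real_derivative flat ([:0, 0, 1:] * (p - pderiv p)) x) (at x)"
    using greater unfolding flat_def
    by (auto intro!: derivative_eq_intros DERIV_chain2[OF poly_DERIV] simp: field_simps power2_eq_square)
  then show ?thesis
    by (rule has_field_derivative_transform_within_open[where S = "{0<..}"]) (use greater in \<open>auto simp: flat_def\<close>)
next
  case equal
  have "((\<lambda>h. (flat p (0 + h) - flat p 0) / h) \<longlongrightarrow> 0) (at 0)"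
  proof (rule filterlim_split_at)
    show "((\<lambda>h. (flat p (0 + h) - flat p 0) / h) \<longlongrightarrow> 0) (at_left 0)"
      by (rule tendsto_eventually) (auto simp: eventually_at_filter flat_def)
    \<comment> \<open>Dividing the difference by h multiplies the polynomial by its variable, giving
      \<open>pCons 0 p\<close>.\<close>
    have "((\<lambda>h. poly (pCons 0 p) (inverse h) * exp (- inverse h)) \<longlongrightarrow> 0) (at_right (0::real))"
      by (rule filterlim_compose[OF poly_times_exp_tendsto_0 filterlim_inverse_at_top_right])
    then show "((\<lambda>h. (flat p (0 + h) - flat p 0) / h) \<longlongrightarrow> 0) (at_right 0)"
      by (rule Lim_transform_eventually)
        (auto simp: eventually_at_filter flat_def field_simps)
  qed
  then show ?thesis
    using equal by (simp add: DERIV_def flat_def)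
qed

lemma Ck_on_flat: "Ck_on k UNIV (flat p)"
proof (induction k arbitrary: p)
  case 0
  show ?case
    using flat_has_real_derivative[of p] DERIV_isCont continuous_at_imp_continuous_on
    unfolding Ck_on.simps by blast
next
  case (Suc k)
  show ?case
    by (rule Ck_on_real_SucI[OF open_UNIV flat_has_real_derivative Suc])
qed

lemma smooth_bump_exists:
  fixes z0 :: "'a::euclidean_space"
  assumes "r > 0"
  obtains \<phi> :: "'a \<Rightarrow> real" where "\<And>k. Ck_on k UNIV \<phi>" "\<And>z. \<phi> z \<ge> 0" "\<phi> z0 > 0"
    "\<And>z. z \<notin> cball z0 r \<Longrightarrow> \<phi> z = 0"
proof
  \<comment> \<open>The argument of \<open>flat\<close> is positive exactly on the open ball of
    radius r around z0.\<close>
  let ?\<phi> = "\<lambda>z. flat 1 (r\<^sup>2 - (z - z0) \<bullet> (z - z0))"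
  show "Ck_on k UNIV ?\<phi>" for k
    by (intro Ck_on_compose[OF _ _ Ck_on_flat] Ck_on_diff Ck_on_inner Ck_on_const Ck_on_ident open_UNIV) simp
  show "?\<phi> z \<ge> 0" for z
    by (simp add: flat_def)
  show "?\<phi> z0 > 0"
    using assms by (simp add: flat_def)
  show "?\<phi> z = 0" if "z \<notin> cball z0 r" for z
  proof -
    have "r < norm (z - z0)"
      using that by (simp add: dist_norm norm_minus_commute)
    then have "r\<^sup>2 < (norm (z - z0))\<^sup>2"
      using assms by (intro power_strict_mono) auto
    then show ?thesis
      by (simp add: flat_def power2_norm_eq_inner)
  qed
qed

section \<open>Gram matrices\<close>

text \<open>Every matrix on the segment from the identity to A has a positive quadratic form, hence
  trivial kernel. The determinant has no zero along the segment and keeps the sign it has at the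
  identity.\<close>

lemma det_pos_of_pos_def:
  fixes A :: "real^'n::finite^'n"
  assumes "\<And>x. x \<noteq> 0 \<Longrightarrow> x \<bullet> (A *v x) > 0"
  shows "det A > 0"
proof -
  define B where "B s = (1 - s) *\<^sub>R mat 1 + s *\<^sub>R A" for s
  have nz: "det (B s) \<noteq> 0" if "0 \<le> s" "s \<le> 1" for s
  proof -
    have "x = 0" if "B s *v x = 0" for x
    proof (rule ccontr)
      assume "x \<noteq> 0"
      have "B s *v x = (1 - s) *\<^sub>R x + s *\<^sub>R (A *v x)"
        by (simp add: B_def matrix_vector_mult_add_rdistrib scaleR_matrix_vector_assoc[symmetric])
      then have "x \<bullet> (B s *v x) = (1 - s) * (x \<bullet> x) + s * (x \<bullet> (A *v x))"
        by (simp add: inner_add_right)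
      moreover have "\<dots> > 0"
      proof (cases "s = 0")
        case False
        then show ?thesis
          using assms[OF \<open>x \<noteq> 0\<close>] \<open>0 \<le> s\<close> \<open>s \<le> 1\<close> by (intro add_nonneg_pos mult_nonneg_nonneg mult_pos_pos) auto
      qed (use \<open>x \<noteq> 0\<close> in simp)
      ultimately show False
        using that by simp
    qed
    then have "invertible (B s)"
      by (simp add: invertible_left_inverse matrix_left_invertible_ker)
    then show ?thesis
      by (simp add: invertible_det_nz)
  qed
  have cont: "continuous_on {0..1} (\<lambda>s. det (B s))"
    unfolding det_def B_def by (intro continuous_intros)
  show ?thesis
  proof (rule ccontr)
    assume "\<not> det A > 0"
    then have "det (B 1) \<le> 0"
      by (simp add: B_def)
    moreover have "det (B 0) \<ge> 0"
      by (simp add: B_def)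
    ultimately obtain s where "0 \<le> s" "s \<le> 1" "det (B s) = 0"
      using IVT2'[of "\<lambda>s. det (B s)" 1 0 0] cont by auto
    then show False
      using nz by blast
  qed
qed

lemma gram_det_pos:
  fixes a :: "'n::finite \<Rightarrow> 'v::real_inner"
  assumes "\<And>x :: real^'n. (\<Sum>i\<in>UNIV. (x $ i) *\<^sub>R a i) = 0 \<Longrightarrow> x = 0"
  shows "det (\<chi> i j. a i \<bullet> a j) > 0"
proof (rule det_pos_of_pos_def)
  fix x :: "real^'n" assume "x \<noteq> 0"
  have "x \<bullet> ((\<chi> i j. a i \<bullet> a j) *v x) = (\<Sum>i\<in>UNIV. (x $ i) *\<^sub>R a i) \<bullet> (\<Sum>i\<in>UNIV. (x $ i) *\<^sub>R a i)"
    by (simp add: inner_vec_def matrix_vector_mult_def inner_sum_left inner_sum_right sum_distrib_left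
        sum_distrib_right mult_ac inner_commute)
  moreover have "\<dots> > 0"
    using assms \<open>x \<noteq> 0\<close> by auto
  ultimately show "x \<bullet> ((\<chi> i j. a i \<bullet> a j) *v x) > 0"
    by simp
qed

text \<open>Covers dependent vectors too: a varied map need not be an immersion, yet its volume
  density must be a nonnegative real. A linear relation among the vectors lies in the kernel of the
  Gram matrix, so the determinant is then 0.\<close>

lemma gram_det_nonneg:
  fixes a :: "'n::finite \<Rightarrow> 'v::real_inner"
  shows "det (\<chi> i j. a i \<bullet> a j) \<ge> 0"
proof (cases "\<exists>x :: real^'n. x \<noteq> 0 \<and> (\<Sum>i\<in>UNIV. (x $ i) *\<^sub>R a i) = 0")
  case True
  then obtain x :: "real^'n" where x: "x \<noteq> 0" "(\<Sum>j\<in>UNIV. (x $ j) *\<^sub>R a j) = 0"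
    by blast
  have "((\<chi> i j. a i \<bullet> a j) *v x) $ i = a i \<bullet> (\<Sum>j\<in>UNIV. (x $ j) *\<^sub>R a j)" for i
    by (simp add: matrix_vector_mult_def inner_sum_right mult.commute)
  then have "(\<chi> i j. a i \<bullet> a j) *v x = 0"
    by (simp add: x(2) vec_eq_iff)
  then have "det (\<chi> i j. a i \<bullet> a j) = 0"
    using x(1) matrix_left_invertible_ker invertible_left_inverse invertible_det_nz by metis
  then show ?thesis
    by simp
next
  case False
  then show ?thesis
    by (intro less_imp_le gram_det_pos) blast
qed

section \<open>Inverse matrices and the derivative of a determinant\<close>

lemma matrix_inv_mult:
  fixes A :: "real^'n::finite^'n"
  assumes "det A \<noteq> 0"
  shows "A ** matrix_inv A = mat 1" "matrix_inv A ** A = mat 1"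
proof -
  have "\<exists>B. A ** B = mat 1 \<and> B ** A = mat 1"
    using assms unfolding invertible_det_nz[symmetric] invertible_def .
  then have "A ** matrix_inv A = mat 1 \<and> matrix_inv A ** A = mat 1"
    unfolding matrix_inv_def by (rule someI_ex)
  then show "A ** matrix_inv A = mat 1" "matrix_inv A ** A = mat 1"
    by auto
qed

text \<open>Writes the entries of the inverse as quotients of polynomials in the entries of A; their
  differentiability and continuity are read off from this form.\<close>

lemma matrix_inv_cramer:
  fixes A :: "real^'n::finite^'n"
  assumes "det A \<noteq> 0"
  shows "matrix_inv A $ k $ l = det (\<chi> i j. if j = k then (if i = l then 1 else 0) else A $ i $ j) / det A"
proof -
  have "A *v (matrix_inv A *v axis l 1) = axis l 1"
    by (simp add: matrix_vector_mul_assoc matrix_inv_mult[OF assms])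
  then have "matrix_inv A *v axis l 1 = (\<chi> k. det (\<chi> i j. if j = k then axis l 1 $ i else A $ i $ j) / det A)"
    using cramer[OF assms] by blast
  then have "(matrix_inv A *v axis l 1) $ k = det (\<chi> i j. if j = k then axis l 1 $ i else A $ i $ j) / det A"
    by simp
  then show ?thesis
    by (simp add: axis_def matrix_vector_mul_component inner_vec_def if_distrib cong: if_cong)
qed

lemma matrix_inv_sym:
  fixes A :: "real^'n::finite^'n"
  assumes "det A \<noteq> 0" "\<And>i j. A $ i $ j = A $ j $ i"
  shows "matrix_inv A $ k $ l = matrix_inv A $ l $ k"
proof -
  have "transpose A = A"
    by (simp add: transpose_def vec_eq_iff assms(2))
  then have "transpose (matrix_inv A) ** A = mat 1"
    using matrix_inv_mult(1)[OF assms(1)] matrix_transpose_mul[of A "matrix_inv A"] by (simp add: transpose_mat)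
  then have "transpose (matrix_inv A) ** A ** matrix_inv A = matrix_inv A"
    by simp
  then have "transpose (matrix_inv A) = matrix_inv A"
    by (simp add: matrix_mul_assoc[symmetric] matrix_inv_mult[OF assms(1)])
  then have "transpose (matrix_inv A) $ k $ l = matrix_inv A $ k $ l"
    by simp
  then show ?thesis
    by (simp add: transpose_def)
qed

text \<open>Jacobi's formula. The product rule gives a sum of determinants, each with one row of A
  replaced by the same row of A'. That row is a combination of the rows of A, with coefficients from
  A' times the inverse of A, so each determinant is a single coefficient times det A.\<close>

lemma has_real_derivative_det:
  fixes A :: "real \<Rightarrow> real^'n::finite^'n"
  assumes "\<And>i j. ((\<lambda>s. A s $ i $ j) has_real_derivative A' $ i $ j) (at s within S)"
    and nz: "det (A s) \<noteq> 0"
  shows "((\<lambda>s. det (A s)) has_real_derivative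
    det (A s) * (\<Sum>i\<in>UNIV. \<Sum>j\<in>UNIV. matrix_inv (A s) $ i $ j * A' $ j $ i)) (at s within S)"
proof -
  let ?I = "matrix_inv (A s)"
  have der: "((\<lambda>s. A s $ i $ j) has_derivative (\<lambda>h. h * A' $ i $ j)) (at s within S)" for i j
    using assms(1)[of i j] by (simp add: has_field_derivative_def mult.commute[of _ "A' $ i $ j"])
  have "((\<lambda>s. det (A s)) has_derivative
      (\<lambda>h. \<Sum>p | p permutes UNIV. of_int (sign p) *
        (\<Sum>i\<in>UNIV. h * A' $ i $ p i * (\<Prod>j\<in>UNIV - {i}. A s $ j $ p j)))) (at s within S)"
    unfolding det_def by (intro has_derivative_sum has_derivative_mult_right has_derivative_prod der)
  also have "(\<lambda>h. \<Sum>p | p permutes (UNIV::'n set). of_int (sign p) *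
        (\<Sum>i\<in>UNIV. h * A' $ i $ p i * (\<Prod>j\<in>UNIV - {i}. A s $ j $ p j))) =
      (\<lambda>h. h * (\<Sum>i\<in>UNIV. \<Sum>p | p permutes (UNIV::'n set). of_int (sign p) * (A' $ i $ p i * (\<Prod>j\<in>UNIV - {i}. A s $ j $ p j))))"
    by (subst sum.swap) (simp add: sum_distrib_left mult_ac)
  also have "(\<Sum>i\<in>UNIV. \<Sum>p | p permutes (UNIV::'n set). of_int (sign p) * (A' $ i $ p i * (\<Prod>j\<in>UNIV - {i}. A s $ j $ p j))) =
      (\<Sum>i\<in>UNIV. det (\<chi> k. if k = i then A' $ i else A s $ k))"
    unfolding det_def
    by (intro sum.cong refl arg_cong2[where f = "(*)"]) (subst prod.remove[of UNIV], auto intro!: prod.cong)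
  also have "\<dots> = (\<Sum>i\<in>UNIV. (\<Sum>j\<in>UNIV. A' $ i $ j * ?I $ j $ i) * det (A s))"
  proof (rule sum.cong[OF refl])
    fix i
    have comb: "(\<Sum>k\<in>UNIV. (\<chi> k. \<Sum>j\<in>UNIV. A' $ i $ j * ?I $ j $ k) $ k *s A s $ k) = A' $ i"
    proof -
      have "(\<Sum>k\<in>UNIV. (\<Sum>j\<in>UNIV. A' $ i $ j * ?I $ j $ k) * A s $ k $ l) = A' $ i $ l" for l
      proof -
        have "(\<Sum>k\<in>UNIV. (\<Sum>j\<in>UNIV. A' $ i $ j * ?I $ j $ k) * A s $ k $ l) =
            (\<Sum>j\<in>UNIV. A' $ i $ j * (?I ** A s) $ j $ l)"
          by (simp add: matrix_matrix_mult_def sum_distrib_left sum_distrib_right mult.assoc)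
            (rule sum.swap)
        also have "\<dots> = A' $ i $ l"
          by (simp add: matrix_inv_mult[OF nz] mat_def if_distrib cong: if_cong)
        finally show ?thesis .
      qed
      then show ?thesis
        by (simp add: vec_eq_iff)
    qed
    have row: "row k (A s) = A s $ k" for k
      by (simp add: row_def)
    have eq: "(\<chi> k. if k = i then A' $ i else A s $ k) =
        (\<chi> k. if k = i then \<Sum>k\<in>UNIV. (\<chi> k. \<Sum>j\<in>UNIV. A' $ i $ j * ?I $ j $ k) $ k *s row k (A s) else row k (A s))"
      by (simp only: row comb)
    show "det (\<chi> k. if k = i then A' $ i else A s $ k) = (\<Sum>j\<in>UNIV. A' $ i $ j * ?I $ j $ i) * det (A s)"
      unfolding eq by (subst cramer_lemma_transpose) simp
  qed
  also have "\<dots> = det (A s) * (\<Sum>i\<in>UNIV. \<Sum>j\<in>UNIV. ?I $ i $ j * A' $ j $ i)"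
    by (subst sum.swap) (simp add: sum_distrib_left sum_distrib_right mult_ac)
  finally show ?thesis
    unfolding has_field_derivative_def by (rule has_derivative_eq_rhs) (rule ext, rule mult.commute)
qed

lemma Ck_on_det:
  fixes A :: "'a::euclidean_space \<Rightarrow> real^'n::finite^'n"
  assumes "open W" "\<And>i j. Ck_on k W (\<lambda>x. A x $ i $ j)"
  shows "Ck_on k W (\<lambda>x. det (A x))"
  unfolding det_def by (intro Ck_on_sum Ck_on_mult Ck_on_prod Ck_on_const assms)

lemma Ck_on_divide:
  fixes f g :: "'a::euclidean_space \<Rightarrow> real"
  assumes "open W" "Ck_on k W f" "Ck_on k W g" "\<And>x. x \<in> W \<Longrightarrow> g x \<noteq> 0"
  shows "Ck_on k W (\<lambda>x. f x / g x)"
  unfolding divide_inverse using assms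
  by (intro Ck_on_mult Ck_on_compose[OF assms(1,3) Ck_on_inverse]) auto

lemma Ck_on_matrix_inv:
  fixes A :: "'a::euclidean_space \<Rightarrow> real^'n::finite^'n"
  assumes "open W" "\<And>i j. Ck_on k W (\<lambda>x. A x $ i $ j)" "\<And>x. x \<in> W \<Longrightarrow> det (A x) \<noteq> 0"
  shows "Ck_on k W (\<lambda>x. matrix_inv (A x) $ i $ j)"
proof (rule Ck_on_cong[OF assms(1)])
  show "det (\<chi> a b. if b = i then (if a = j then 1 else 0) else A x $ a $ b) / det (A x) =
      matrix_inv (A x) $ i $ j" if "x \<in> W" for x
    by (rule matrix_inv_cramer[OF assms(3)[OF that], symmetric])
  have "Ck_on k W (\<lambda>x. (\<chi> a b. if b = i then (if a = j then 1 else 0) else A x $ a $ b) $ c $ d)" for c d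
    by (cases "d = i"; cases "c = j") (simp_all add: assms(2))
  then show "Ck_on k W (\<lambda>x. det (\<chi> a b. if b = i then (if a = j then 1 else 0) else A x $ a $ b) / det (A x))"
    by (intro Ck_on_divide Ck_on_det assms)
qed

section \<open>Change of variables\<close>

text \<open>The change of variables theorem of the library needs a well-ordered index type, which a finite type
  is not. It is transferred along a copy of the index type, ordered by an enumeration.\<close>

typedef 'n wo = "UNIV :: 'n set" ..

lemma inj_Rep_wo: "inj Rep_wo"
  by (simp add: inj_def Rep_wo_inject)

lemma bij_Rep_wo: "bij Rep_wo"
  using inj_Rep_wo type_definition.Rep_range[OF type_definition_wo] by (simp only: bij_def)

instance wo :: (finite) finite
proof
  show "finite (UNIV :: 'a wo set)"
    using finite_imageI[of "UNIV :: 'a set" Abs_wo] by (simp only: type_definition.Abs_image[OF type_definition_wo] finite)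
qed

instantiation wo :: (finite) wellorder
begin

definition less_eq_wo :: "'a wo \<Rightarrow> 'a wo \<Rightarrow> bool" where
  "less_eq_wo a b \<longleftrightarrow> to_nat (Rep_wo a) \<le> to_nat (Rep_wo b)"

definition less_wo :: "'a wo \<Rightarrow> 'a wo \<Rightarrow> bool" where
  "less_wo a b \<longleftrightarrow> to_nat (Rep_wo a) < to_nat (Rep_wo b)"

instance
proof
  fix P :: "'a wo \<Rightarrow> bool" and a
  assume step: "\<And>x. (\<And>y. y < x \<Longrightarrow> P y) \<Longrightarrow> P x"
  show "P a"
    by (rule measure_induct_rule[of "\<lambda>a. to_nat (Rep_wo a)"]) (rule step, simp add: less_wo_def)
qed (auto simp: less_eq_wo_def less_wo_def Rep_wo_inject)

end

definition wo_vec :: "real^'n \<Rightarrow> real^('n wo)" where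
  "wo_vec x = (\<chi> a. x $ Rep_wo a)"

definition unwo_vec :: "real^('n wo) \<Rightarrow> real^'n" where
  "unwo_vec x = (\<chi> i. x $ Abs_wo i)"

lemma wo_vec_inverse [simp]: "unwo_vec (wo_vec x) = x" "wo_vec (unwo_vec y) = y"
  by (simp_all add: wo_vec_def unwo_vec_def vec_eq_iff Abs_wo_inverse Rep_wo_inverse)

lemma wo_vec_inject: "wo_vec x = wo_vec y \<longleftrightarrow> x = y"
  by (metis wo_vec_inverse(1))

lemma bounded_linear_wo_vec: "bounded_linear (wo_vec :: real^'n::finite \<Rightarrow> _)"
  and bounded_linear_unwo_vec: "bounded_linear (unwo_vec :: _ \<Rightarrow> real^'n::finite)"
  unfolding linear_conv_bounded_linear[symmetric]
  by (auto intro!: linearI simp: wo_vec_def unwo_vec_def vec_eq_iff)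

lemma Basis_cart_eq: "(Basis :: (real^'n::finite) set) = (\<lambda>i. axis i 1) ` UNIV"
  by (auto simp: Basis_vec_def)

lemma inj_axis_1: "inj (\<lambda>i. axis i (1::real) :: real^'n::finite)"
  by (simp add: inj_def axis_eq_axis)

lemma prod_Basis_cart:
  fixes x :: "real^'n::finite"
  shows "(\<Prod>b\<in>Basis. x \<bullet> b) = (\<Prod>i\<in>UNIV. x $ i)"
  unfolding Basis_cart_eq by (subst prod.reindex[OF inj_axis_1]) (simp add: inner_axis)

text \<open>Relabelling coordinates turns a box into a box with the same side lengths, and Lebesgue
  measure is determined by its values on boxes.\<close>

lemma distr_unwo_vec: "distr lborel borel (unwo_vec :: _ \<Rightarrow> real^'n::finite) = lborel"
proof (rule lborel_eqI[symmetric])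
  fix l u :: "real^'n"
  assume le: "\<And>b. b \<in> Basis \<Longrightarrow> l \<bullet> b \<le> u \<bullet> b"
  have le': "l $ i \<le> u $ i" for i
    using le[of "axis i 1"] by (simp add: inner_axis)
  have meas: "unwo_vec \<in> borel_measurable borel"
    by (intro borel_measurable_continuous_onI linear_continuous_on bounded_linear_unwo_vec)
  have "unwo_vec -` box l u = box (wo_vec l) (wo_vec u)"
  proof -
    have "(\<forall>i. l $ i < x $ Abs_wo i \<and> x $ Abs_wo i < u $ i) \<longleftrightarrow>
        (\<forall>a. l $ Rep_wo a < x $ a \<and> x $ a < u $ Rep_wo a)" for x :: "real^('n wo)"
      by (metis Abs_wo_inverse Rep_wo_inverse UNIV_I)
    then show ?thesis
      by (auto simp: mem_box_cart unwo_vec_def wo_vec_def)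
  qed
  moreover have "wo_vec l \<bullet> b \<le> wo_vec u \<bullet> b" if "b \<in> Basis" for b
    using that le' by (auto simp: Basis_vec_def inner_axis wo_vec_def)
  ultimately have "emeasure lborel (unwo_vec -` box l u) = (\<Prod>b\<in>Basis. (wo_vec u - wo_vec l) \<bullet> b)"
    by (simp only: emeasure_lborel_box)
  moreover have "emeasure (distr lborel borel unwo_vec) (box l u) = emeasure lborel (unwo_vec -` box l u \<inter> space lborel)"
    by (rule emeasure_distr) (use meas in simp_all)
  ultimately have "emeasure (distr lborel borel unwo_vec) (box l u) = (\<Prod>b\<in>Basis. (wo_vec u - wo_vec l) \<bullet> b)"
    by simp
  also have "(\<Prod>b\<in>Basis. (wo_vec u - wo_vec l) \<bullet> b) = (\<Prod>a\<in>UNIV. (u - l) $ Rep_wo a)"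
    unfolding prod_Basis_cart by (simp add: wo_vec_def)
  also have "\<dots> = (\<Prod>i\<in>UNIV. (u - l) $ i)"
    by (rule prod.reindex_bij_betw) (rule bij_Rep_wo)
  finally show "emeasure (distr lborel borel unwo_vec) (box l u) = (\<Prod>b\<in>Basis. (u - l) \<bullet> b)"
    by (simp only: prod_Basis_cart)
qed simp

lemma nn_integral_unwo_vec:
  assumes "f \<in> borel_measurable borel"
  shows "(\<integral>\<^sup>+y. f (unwo_vec y) \<partial>lborel) = (\<integral>\<^sup>+x. f x \<partial>(lborel :: (real^'n::finite) measure))"
proof -
  have "unwo_vec \<in> lborel \<rightarrow>\<^sub>M (borel :: (real^'n) measure)"
    using borel_measurable_continuous_onI[OF linear_continuous_on[OF bounded_linear_unwo_vec]] by simp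
  then have "(\<integral>\<^sup>+x. f x \<partial>distr lborel borel (unwo_vec :: _ \<Rightarrow> real^'n)) = (\<integral>\<^sup>+y. f (unwo_vec y) \<partial>lborel)"
    by (rule nn_integral_distr) (use assms in simp)
  then show ?thesis
    by (simp add: distr_unwo_vec)
qed

text \<open>Conjugation by the bijection \<open>Rep_wo\<close> matches the permutations of the two
  index types and preserves their signs, so the Leibniz sums agree term by term.\<close>

lemma det_reindex_wo:
  fixes A :: "real^'n::finite^'n"
  shows "det (\<chi> a b. A $ Rep_wo a $ Rep_wo b) = det A"
proof -
  let ?F = "\<lambda>\<pi> x. if x \<in> UNIV then Rep_wo (\<pi> (inv_into UNIV Rep_wo x)) else x"
  have inv: "inv_into UNIV Rep_wo (Rep_wo a) = a" for a
    by (rule inv_f_f[OF inj_Rep_wo])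
  have sgn: "sign (?F p) = sign p" if "p permutes (UNIV :: 'n wo set)" for p
  proof -
    have "?F p = map_permutation UNIV Rep_wo p"
      using bij_Rep_wo by (auto simp: map_permutation_def restrict_id_def fun_eq_iff bij_def)
    then show ?thesis
      using sign_map_permutation[OF inj_Rep_wo that] by simp
  qed
  have "det A = (\<Sum>p | p permutes (UNIV :: 'n wo set). of_int (sign (?F p)) * (\<Prod>i\<in>UNIV. A $ i $ ?F p i))"
    unfolding det_def
    by (rule sum.reindex_bij_betw[OF bij_betw_permutations[OF bij_Rep_wo], symmetric])
  also have "\<dots> = (\<Sum>p | p permutes (UNIV :: 'n wo set). of_int (sign p) * (\<Prod>a\<in>UNIV. A $ Rep_wo a $ Rep_wo (p a)))"
  proof (rule sum.cong[OF refl])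
    fix p :: "'n wo \<Rightarrow> 'n wo" assume p: "p \<in> {p. p permutes UNIV}"
    have "(\<Prod>i\<in>UNIV. A $ i $ ?F p i) = (\<Prod>a\<in>UNIV. A $ Rep_wo a $ ?F p (Rep_wo a))"
      by (rule prod.reindex_bij_betw[OF bij_Rep_wo, symmetric])
    also have "\<dots> = (\<Prod>a\<in>UNIV. A $ Rep_wo a $ Rep_wo (p a))"
      by (simp add: inv)
    finally show "of_int (sign (?F p)) * (\<Prod>i\<in>UNIV. A $ i $ ?F p i) =
        of_int (sign p) * (\<Prod>a\<in>UNIV. A $ Rep_wo a $ Rep_wo (p a))"
      using sgn p by simp
  qed
  finally show ?thesis
    unfolding det_def by simp
qed

text \<open>The pulled back integrand is passed as a separate function w, Borel on the whole space,
  because the product of the Jacobian with \<open>f (g x)\<close> is controlled only on S.\<close>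

lemma nn_integral_change_of_variables_wellorder:
  fixes g :: "real^'m::{finite,wellorder} \<Rightarrow> real^'m::_" and f w :: "real^'m::_ \<Rightarrow> real"
  assumes S: "S \<in> sets borel" and gS: "g ` S \<in> sets borel"
    and der: "\<And>x. x \<in> S \<Longrightarrow> (g has_derivative g' x) (at x within S)"
    and inj: "inj_on g S"
    and f: "f \<in> borel_measurable borel" "\<And>y. y \<in> g ` S \<Longrightarrow> f y \<ge> 0"
    and w: "w \<in> borel_measurable borel" "\<And>x. x \<in> S \<Longrightarrow> w x = \<bar>det (matrix (g' x))\<bar> * f (g x)"
  shows "(\<integral>\<^sup>+x\<in>S. ennreal (w x) \<partial>lborel) = (\<integral>\<^sup>+y\<in>g ` S. ennreal (f y) \<partial>lborel)"
proof -
  have key: "w absolutely_integrable_on S \<and> integral S w = b \<longleftrightarrow>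
      f absolutely_integrable_on g ` S \<and> integral (g ` S) f = b" for b
  proof -
    \<comment> \<open>Vectors of length one fit real integrands to the vector-valued change of
      variables theorem.\<close>
    have "(\<lambda>x. \<bar>det (matrix (g' x))\<bar> *\<^sub>R vec (f (g x)) :: real ^ 1) absolutely_integrable_on S \<and>
        integral S (\<lambda>x. \<bar>det (matrix (g' x))\<bar> *\<^sub>R vec (f (g x))) = (vec b :: real ^ 1) \<longleftrightarrow>
        (\<lambda>x. vec (f x) :: real ^ 1) absolutely_integrable_on (g ` S) \<and>
        integral (g ` S) (\<lambda>x. vec (f x)) = (vec b :: real ^ 1)"
      using S by (intro has_absolute_integral_change_of_variables der inj) auto
    then have "(\<lambda>x. \<bar>det (matrix (g' x))\<bar> * f (g x)) absolutely_integrable_on S \<and>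
        integral S (\<lambda>x. \<bar>det (matrix (g' x))\<bar> * f (g x)) = b \<longleftrightarrow>
        f absolutely_integrable_on (g ` S) \<and> integral (g ` S) f = b"
      by (simp add: absolutely_integrable_on_1_iff integral_on_1_eq)
    moreover have "(\<lambda>x. \<bar>det (matrix (g' x))\<bar> * f (g x)) absolutely_integrable_on S \<longleftrightarrow> w absolutely_integrable_on S"
      using w(2) by (intro set_integrable_cong) auto
    moreover have "integral S (\<lambda>x. \<bar>det (matrix (g' x))\<bar> * f (g x)) = integral S w"
      using w(2) by (intro integral_cong) auto
    ultimately show ?thesis
      by simp
  qed
  \<comment> \<open>For a nonnegative function, failure of absolute integrability means an infinite
    integral. Hence \<open>key\<close> settles the finite and the infinite case together.\<close>
  have conv: "(\<integral>\<^sup>+x\<in>A. ennreal (h x) \<partial>lborel) = (if h absolutely_integrable_on A then ennreal (integral A h) else \<infinity>)"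
    if A: "A \<in> sets borel" and h: "h \<in> borel_measurable borel" and nn: "\<And>x. x \<in> A \<Longrightarrow> h x \<ge> 0"
    for A :: "(real^'m::_) set" and h :: "real^'m::_ \<Rightarrow> real"
  proof -
    let ?h = "\<lambda>x. indicator A x *\<^sub>R h x"
    have meas: "?h \<in> borel_measurable borel"
      using A h by measurable
    have nn': "?h x \<ge> 0" for x
      using nn by (auto simp: indicator_def)
    have eq: "(\<integral>\<^sup>+x\<in>A. ennreal (h x) \<partial>lborel) = (\<integral>\<^sup>+x. ennreal (?h x) \<partial>lborel)"
      by (intro nn_integral_cong) (auto simp: indicator_def)
    have ai: "h absolutely_integrable_on A \<longleftrightarrow> integrable lborel ?h"
      unfolding set_integrable_def using meas by (simp add: integrable_completion)
    show ?thesis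
    proof (cases "integrable lborel ?h")
      case True
      then have "(\<integral>\<^sup>+x. ennreal (?h x) \<partial>lborel) = ennreal (\<integral>x. ?h x \<partial>lborel)"
        using nn' by (intro nn_integral_eq_integral) auto
      also have "(\<integral>x. ?h x \<partial>lborel) = integral A h"
      proof -
        have "(\<integral>x. ?h x \<partial>lborel) = (LINT x:A|lebesgue. h x)"
          unfolding set_lebesgue_integral_def using meas by (simp add: integral_completion)
        also have "\<dots> = integral A h"
          using True ai by (intro set_lebesgue_integral_eq_integral(2)) simp
        finally show ?thesis .
      qed
      finally show ?thesis
        using True ai eq by simp
    next
      case False
      then have "(\<integral>\<^sup>+x. ennreal (?h x) \<partial>lborel) = \<infinity>"
        using integrableI_nonneg[of ?h lborel] meas nn' by (auto simp: less_top[symmetric])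
      then show ?thesis
        using False ai eq by simp
    qed
  qed
  have wnn: "w x \<ge> 0" if "x \<in> S" for x
    using that w(2) f(2) by simp
  show ?thesis
    using conv[OF S w(1) wnn] conv[OF gS f(1,2)] key[of "integral S w"] key[of "integral (g ` S) f"]
    by (cases "w absolutely_integrable_on S") simp_all
qed

lemma nn_integral_change_of_variables:
  fixes g :: "real^'n::finite \<Rightarrow> real^'n" and f w :: "real^'n \<Rightarrow> real"
  assumes S: "S \<in> sets borel" and gS: "g ` S \<in> sets borel"
    and der: "\<And>x. x \<in> S \<Longrightarrow> (g has_derivative g' x) (at x within S)"
    and inj: "inj_on g S"
    and f: "f \<in> borel_measurable borel" "\<And>y. y \<in> g ` S \<Longrightarrow> f y \<ge> 0"
    and w: "w \<in> borel_measurable borel" "\<And>x. x \<in> S \<Longrightarrow> w x = \<bar>det (matrix (g' x))\<bar> * f (g x)"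
  shows "(\<integral>\<^sup>+x\<in>S. ennreal (w x) \<partial>lborel) = (\<integral>\<^sup>+y\<in>g ` S. ennreal (f y) \<partial>lborel)"
proof -
  \<comment> \<open>Seeing the image as a preimage under a continuous map gives its Borel
    measurability at once.\<close>
  have vim: "wo_vec ` A = unwo_vec -` A" for A :: "(real^'n) set"
    by (auto simp: image_iff intro: wo_vec_inverse(2)[symmetric])
  have meas: "unwo_vec \<in> borel_measurable (borel :: (real^('n wo)) measure)"
    by (intro borel_measurable_continuous_onI linear_continuous_on bounded_linear_unwo_vec)
  have borel: "wo_vec ` A \<in> sets borel" if "A \<in> sets borel" for A :: "(real^'n) set"
    unfolding vim using measurable_sets[OF meas that] by simp
  have ind: "indicator (wo_vec ` A) y = indicator A (unwo_vec y)" for A :: "(real^'n) set" and y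
    unfolding vim by (simp add: indicator_def)
  have img: "(\<lambda>y. wo_vec (g (unwo_vec y))) ` wo_vec ` S = wo_vec ` g ` S"
    by (simp add: image_image)
  have "(\<integral>\<^sup>+y\<in>wo_vec ` S. ennreal (w (unwo_vec y)) \<partial>lborel) =
      (\<integral>\<^sup>+y\<in>(\<lambda>y. wo_vec (g (unwo_vec y))) ` wo_vec ` S. ennreal (f (unwo_vec y)) \<partial>lborel)"
  proof (rule nn_integral_change_of_variables_wellorder)
    show "((\<lambda>y. wo_vec (g (unwo_vec y))) has_derivative (\<lambda>h. wo_vec (g' (unwo_vec y) (unwo_vec h))))
        (at y within wo_vec ` S)" if "y \<in> wo_vec ` S" for y
    proof -
      have "(g has_derivative g' (unwo_vec y)) (at (unwo_vec y) within unwo_vec ` wo_vec ` S)"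
        using that der by (auto simp: image_image)
      then have "((\<lambda>y. g (unwo_vec y)) has_derivative (\<lambda>h. g' (unwo_vec y) (unwo_vec h))) (at y within wo_vec ` S)"
        by (rule has_derivative_in_compose[OF bounded_linear_imp_has_derivative[OF bounded_linear_unwo_vec]])
      then show ?thesis
        by (rule bounded_linear.has_derivative[OF bounded_linear_wo_vec])
    qed
    show "inj_on (\<lambda>y. wo_vec (g (unwo_vec y))) (wo_vec ` S)"
      using inj by (auto simp: inj_on_def wo_vec_inject)
    show "w (unwo_vec y) = \<bar>det (matrix (\<lambda>h. wo_vec (g' (unwo_vec y) (unwo_vec h))))\<bar> *
        f (unwo_vec (wo_vec (g (unwo_vec y))))" if "y \<in> wo_vec ` S" for y
    proof -
      have "unwo_vec (axis a 1) = axis (Rep_wo a) 1" for a :: "'n wo"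
        by (auto simp: unwo_vec_def axis_def vec_eq_iff Abs_wo_inverse Rep_wo_inverse)
      then have "matrix (\<lambda>h. wo_vec (g' (unwo_vec y) (unwo_vec h))) =
          (\<chi> a b. matrix (g' (unwo_vec y)) $ Rep_wo a $ Rep_wo b)"
        by (simp add: matrix_def wo_vec_def)
      then show ?thesis
        using that w(2) by (auto simp: det_reindex_wo)
    qed
  qed (use borel S gS f w meas in \<open>auto simp: img\<close>)
  moreover have "(\<integral>\<^sup>+y\<in>wo_vec ` A. ennreal (h (unwo_vec y)) \<partial>lborel) = (\<integral>\<^sup>+x\<in>A. ennreal (h x) \<partial>lborel)"
    if "A \<in> sets borel" "h \<in> borel_measurable borel" for A :: "(real^'n) set" and h :: "real^'n \<Rightarrow> real"
  proof -
    have m: "(\<lambda>x. ennreal (h x) * indicator A x) \<in> borel_measurable borel"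
      using that by measurable
    show ?thesis
      unfolding ind using nn_integral_unwo_vec[OF m] by simp
  qed
  ultimately show ?thesis
    using S gS f(1) w(1) unfolding img by simp
qed

section \<open>Charts and the volume measure\<close>

abbreviation chart_img :: "('m, 'n) chart \<Rightarrow> (real^'n) set" where
  "chart_img c \<equiv> chart_map c ` chart_dom c"

text \<open>Off the image of the chart, \<open>chart_inv\<close> takes arbitrary values; a constant one makes it Borel
  measurable.\<close>

definition total_chart_inv :: "('m, 'n) chart \<Rightarrow> real^'n \<Rightarrow> 'm" where
  "total_chart_inv c x = (if x \<in> chart_img c then chart_inv c x else undefined)"

context
  fixes c :: "('m::topological_space, 'n::finite) chart"
  assumes c: "is_chart c"
begin

lemma open_chart_dom: "open (chart_dom c)" and open_chart_img: "open (chart_img c)"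
  using c by (auto simp: is_chart_def)

lemma chart_inv_map: "p \<in> chart_dom c \<Longrightarrow> chart_inv c (chart_map c p) = p"
  and chart_map_inv: "x \<in> chart_img c \<Longrightarrow> chart_map c (chart_inv c x) = x"
  and chart_inv_mem: "x \<in> chart_img c \<Longrightarrow> chart_inv c x \<in> chart_dom c"
  using c homeomorphism_apply1 homeomorphism_apply2 homeomorphism_image2 unfolding is_chart_def by fastforce+

lemma continuous_on_chart_map: "continuous_on (chart_dom c) (chart_map c)"
  and continuous_on_chart_inv: "continuous_on (chart_img c) (chart_inv c)"
  using c by (auto simp: is_chart_def homeomorphism_def)

lemma open_chart_image:
  assumes "open V" "V \<subseteq> chart_dom c"
  shows "open (chart_map c ` V)"
proof -
  have "chart_map c ` V = chart_img c \<inter> chart_inv c -` V"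
    using assms(2) chart_inv_map chart_map_inv by force
  then show ?thesis
    using continuous_open_preimage[OF continuous_on_chart_inv open_chart_img assms(1)] by simp
qed

lemma inj_on_chart_map: "inj_on (chart_map c) (chart_dom c)"
  by (rule inj_on_inverseI[where g = "chart_inv c"]) (rule chart_inv_map)

lemma partial_chart_inv:
  "x \<in> chart_img c \<Longrightarrow> partial c i f (chart_inv c x) = dd (axis i 1) (\<lambda>x. f (chart_inv c x)) x"
  by (simp add: partial_def chart_map_inv comp_def)

lemma total_chart_inv_measurable: "total_chart_inv c \<in> borel_measurable borel"
  unfolding total_chart_inv_def[abs_def]
  using open_chart_img continuous_on_chart_inv
  by (intro borel_measurable_continuous_on_if) auto

lemma vimage_total_chart_inv:
  assumes "B \<subseteq> chart_dom c" "x \<in> chart_img c"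
  shows "total_chart_inv c x \<in> B \<longleftrightarrow> x \<in> chart_map c ` B"
proof
  assume "total_chart_inv c x \<in> B"
  then show "x \<in> chart_map c ` B"
    using assms(2) chart_map_inv[OF assms(2)] by (intro image_eqI[of _ _ "chart_inv c x"]) (auto simp: total_chart_inv_def)
next
  assume "x \<in> chart_map c ` B"
  then obtain p where "p \<in> B" "x = chart_map c p" by blast
  then show "total_chart_inv c x \<in> B"
    using assms chart_inv_map[of p] by (simp add: total_chart_inv_def subset_iff)
qed

lemma borel_chart_image:
  assumes "B \<in> sets borel" "B \<subseteq> chart_dom c"
  shows "chart_map c ` B \<in> sets borel"
proof -
  have "chart_map c ` B = chart_img c \<inter> (total_chart_inv c -` B \<inter> space borel)"
    using vimage_total_chart_inv[OF assms(2)] assms(2) by auto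
  then show ?thesis
    using measurable_sets[OF total_chart_inv_measurable assms(1)] open_chart_img by auto
qed

end

definition vol_density :: "('m, 'n::finite) chart \<Rightarrow> ('m \<Rightarrow> 'v::euclidean_space) \<Rightarrow> real^'n \<Rightarrow> real" where
  "vol_density c f x = sqrt (det (metric c f (chart_inv c x)))"

text \<open>The regularity that makes the volume density continuous in every chart; it is asked of
  each time slice, including the slices of a varied map.\<close>

definition C1_field :: "('m, 'n::finite) chart set \<Rightarrow> ('m \<Rightarrow> 'v::euclidean_space) \<Rightarrow> bool" where
  "C1_field M f \<longleftrightarrow> (\<forall>c\<in>M. Ck_on 1 (chart_img c) (\<lambda>x. f (chart_inv c x)))"

lemma vol_density_altdef:
  assumes "is_chart c" "x \<in> chart_img c"
  shows "vol_density c f x = sqrt (det (\<chi> i j. dd (axis i 1) (\<lambda>x. f (chart_inv c x)) x \<bullet>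
    dd (axis j 1) (\<lambda>x. f (chart_inv c x)) x))"
  unfolding vol_density_def metric_def partial_chart_inv[OF assms] ..

lemma vol_density_nonneg: "vol_density c f x \<ge> 0"
  by (simp add: vol_density_def metric_def gram_det_nonneg)

lemma continuous_on_vol_density:
  fixes f :: "'m::topological_space \<Rightarrow> 'v::euclidean_space" and c :: "('m, 'n::finite) chart"
  assumes "is_chart c" "Ck_on 1 (chart_img c) (\<lambda>x. f (chart_inv c x))"
  shows "continuous_on (chart_img c) (vol_density c f)"
proof -
  have "continuous_on (chart_img c) (dd v (\<lambda>x. f (chart_inv c x)))" for v
    using assms(2) by simp
  then have "continuous_on (chart_img c) (\<lambda>x. sqrt (det (\<chi> i j. dd (axis i 1) (\<lambda>x. f (chart_inv c x)) x \<bullet>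
    dd (axis j 1) (\<lambda>x. f (chart_inv c x)) x)))"
    unfolding det_def by (simp only: vec_lambda_beta) (intro continuous_intros)
  then show ?thesis
    by (rule continuous_on_eq) (simp add: vol_density_altdef[OF assms(1)])
qed

text \<open>By the chain rule the metric of c is J^T A J, with J the Jacobian of the coordinate
  change and A the metric of d. The determinant picks up (det J)^2, and the square root turns this
  into |det J|.\<close>

lemma vol_density_transition:
  fixes M :: "('m::topological_space, 'n::finite) chart set" and f :: "'m \<Rightarrow> 'v::euclidean_space"
  assumes M: "smooth_atlas M" "c \<in> M" "d \<in> M" and f: "C1_field M f"
    and x: "x \<in> chart_map c ` (chart_dom c \<inter> chart_dom d)"
  defines "g \<equiv> \<lambda>x. chart_map d (chart_inv c x)"
  shows "g differentiable (at x)"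
    and "vol_density c f x = \<bar>det (matrix (\<lambda>v. dd v g x))\<bar> * vol_density d f (g x)"
proof -
  have c: "is_chart c" and d: "is_chart d"
    using M by (auto simp: smooth_atlas_def)
  let ?S = "chart_map c ` (chart_dom c \<inter> chart_dom d)"
  have S: "open ?S"
    using open_chart_dom[OF c] open_chart_dom[OF d] by (intro open_chart_image[OF c]) auto
  have sm: "smooth_on ?S (chart_map d \<circ> chart_inv c)"
    using M by (simp add: smooth_atlas_def)
  have gk: "Ck_on k ?S g" for k
    using smooth_on_open_Ck_on[OF S sm, of k] by (simp add: g_def comp_def)
  show dg: "g differentiable (at x)"
    using Ck_on_differentiable[of 0 ?S g x] gk[of "Suc 0"] x by blast
  have xc: "x \<in> chart_img c" and gx: "g x \<in> chart_img d"
    using x by (auto simp: g_def chart_inv_map[OF c])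
  let ?fc = "\<lambda>x. f (chart_inv c x)" and ?fd = "\<lambda>x. f (chart_inv d x)"
  have dfd: "?fd differentiable (at (g x))"
    using Ck_on_differentiable[of 0 "chart_img d" ?fd "g x"] f M(3) gx by (simp add: C1_field_def del: Ck_on.simps)
  have fc: "dd v ?fc x = dd (dd v g x) ?fd (g x)" for v
  proof -
    have "dd v ?fc x = dd v (\<lambda>x. ?fd (g x)) x"
    proof (rule dd_open_cong[OF S x])
      show "f (chart_inv c y) = f (chart_inv d (g y))" if "y \<in> ?S" for y
        using that by (auto simp: g_def chart_inv_map[OF c] chart_inv_map[OF d])
    qed
    also have "\<dots> = dd (dd v g x) ?fd (g x)"
      by (rule dd_compose(1)[OF dg dfd])
    finally show ?thesis .
  qed
  define J where "J = matrix (\<lambda>v. dd v g x)"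
  define A where "A = (\<chi> i j. dd (axis i 1) ?fd (g x) \<bullet> dd (axis j 1) ?fd (g x))"
  have exp: "dd (axis i 1) ?fc x = (\<Sum>k\<in>UNIV. J $ k $ i *\<^sub>R dd (axis k 1) ?fd (g x))" for i
  proof -
    have lin: "linear (\<lambda>v. dd v ?fd (g x))"
      by (rule linear_dd[OF dfd])
    have "dd (axis i 1) g x = (\<Sum>k\<in>UNIV. J $ k $ i *\<^sub>R axis k 1)"
      unfolding J_def matrix_def by (simp add: vec_eq_iff axis_def if_distrib cong: if_cong)
    then have "dd (axis i 1) ?fc x = dd (\<Sum>k\<in>UNIV. J $ k $ i *\<^sub>R axis k 1) ?fd (g x)"
      by (simp add: fc)
    also have "\<dots> = (\<Sum>k\<in>UNIV. dd (J $ k $ i *\<^sub>R axis k 1) ?fd (g x))"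
      by (rule linear_sum[OF lin])
    also have "\<dots> = (\<Sum>k\<in>UNIV. J $ k $ i *\<^sub>R dd (axis k 1) ?fd (g x))"
      by (intro sum.cong refl linear_cmul[OF lin])
    finally show ?thesis .
  qed
  have "(\<chi> i j. dd (axis i 1) ?fc x \<bullet> dd (axis j 1) ?fc x) = transpose J ** A ** J"
  proof (rule vec_eq_iff[THEN iffD2, rule_format], rule vec_eq_iff[THEN iffD2, rule_format])
    fix i j
    have "(transpose J ** A ** J) $ i $ j = (\<Sum>l\<in>UNIV. (\<Sum>k\<in>UNIV. J $ k $ i * A $ k $ l) * J $ l $ j)"
      by (simp add: matrix_matrix_mult_def transpose_def)
    also have "\<dots> = dd (axis i 1) ?fc x \<bullet> dd (axis j 1) ?fc x"
      unfolding exp A_def by (simp add: inner_sum_left inner_sum_right sum_distrib_right sum_distrib_left mult_ac)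
    finally show "(\<chi> i j. dd (axis i 1) ?fc x \<bullet> dd (axis j 1) ?fc x) $ i $ j = (transpose J ** A ** J) $ i $ j"
      by simp
  qed
  then have "det (\<chi> i j. dd (axis i 1) ?fc x \<bullet> dd (axis j 1) ?fc x) = (det J)\<^sup>2 * det A"
    by (simp add: det_mul det_transpose power2_eq_square mult_ac)
  then show "vol_density c f x = \<bar>det (matrix (\<lambda>v. dd v g x))\<bar> * vol_density d f (g x)"
    unfolding vol_density_altdef[OF c xc] vol_density_altdef[OF d gx] A_def[symmetric] J_def[symmetric]
    by (simp add: real_sqrt_mult)
qed

section \<open>Existence and uniqueness of the volume measure\<close>

text \<open>The property under the description operator in \<open>volume_measure\<close>, isolated
  so that existence and uniqueness can be stated for it.\<close>

definition is_volume :: "('m::topological_space, 'n::finite) chart set \<Rightarrow> ('m \<Rightarrow> 'v::euclidean_space) \<Rightarrow> 'm measure \<Rightarrow> bool" where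
  "is_volume M f \<mu> \<longleftrightarrow> sets \<mu> = sets borel \<and>
     (\<forall>c\<in>M. \<forall>B\<in>sets borel. B \<subseteq> chart_dom c \<longrightarrow>
        emeasure \<mu> B = (\<integral>\<^sup>+x\<in>chart_map c ` B. ennreal (vol_density c f x) \<partial>lborel))"

text \<open>Lindelof's theorem extracts a countable cover from the chart domains, and disjointing
  this cover keeps the pieces Borel. Measures can then be compared and assembled piece by piece
  through countable additivity.\<close>

lemma countable_chart_partition:
  fixes M :: "('m::second_countable_topology, 'n::finite) chart set"
  assumes "smooth_atlas M"
  obtains cs :: "nat \<Rightarrow> ('m, 'n) chart" and A :: "nat \<Rightarrow> 'm set"
  where "\<forall>n. cs n \<in> M" "\<forall>n. A n \<in> sets borel" "\<forall>n. A n \<subseteq> chart_dom (cs n)"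
    "disjoint_family A" "(\<Union>n. A n) = UNIV"
proof -
  have M: "\<And>c. c \<in> M \<Longrightarrow> is_chart c" "(\<Union>c\<in>M. chart_dom c) = UNIV"
    using assms by (auto simp: smooth_atlas_def)
  obtain F where F: "F \<subseteq> chart_dom ` M" "countable F" "\<Union>F = \<Union>(chart_dom ` M)"
    using Lindelof[of "chart_dom ` M"] M(1) open_chart_dom by (metis (no_types, lifting) imageE)
  have "F \<noteq> {}"
    using F(3) M(2) by auto
  have "\<forall>n. \<exists>c. c \<in> M \<and> chart_dom c = from_nat_into F n"
  proof
    fix n
    have "from_nat_into F n \<in> chart_dom ` M"
      using from_nat_into[OF \<open>F \<noteq> {}\<close>] F(1) by blast
    then show "\<exists>c. c \<in> M \<and> chart_dom c = from_nat_into F n"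
      by auto
  qed
  then obtain cs where cs: "\<forall>n. cs n \<in> M \<and> chart_dom (cs n) = from_nat_into F n"
    by (rule choice[THEN exE])
  have "(\<Union>n. chart_dom (cs n)) = \<Union>(range (from_nat_into F))"
    using cs by simp
  also have "\<dots> = UNIV"
    using range_from_nat_into[OF \<open>F \<noteq> {}\<close> F(2)] F(3) M(2) by simp
  finally have cover: "(\<Union>n. chart_dom (cs n)) = UNIV" .
  have csc: "is_chart (cs n)" for n
    using cs M(1) by simp
  let ?A = "disjointed (\<lambda>n. chart_dom (cs n))"
  have "range (\<lambda>n. chart_dom (cs n)) \<subseteq> sets borel"
    using open_chart_dom[OF csc] by auto
  then have "range ?A \<subseteq> sets borel"
    by (rule sets.range_disjointed_sets)
  then show thesis
    using cs cover
    by (intro that[of cs ?A]) (auto simp: UN_disjointed_eq disjoint_family_disjointed dest: subsetD[OF disjointed_subset])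
qed

lemma measure_eqI_charts:
  fixes M :: "('m::second_countable_topology, 'n::finite) chart set"
  assumes M: "smooth_atlas M" and sets: "sets \<mu> = sets borel" "sets \<mu>' = sets borel"
    and eq: "\<And>c B. c \<in> M \<Longrightarrow> B \<in> sets borel \<Longrightarrow> B \<subseteq> chart_dom c \<Longrightarrow> emeasure \<mu> B = emeasure \<mu>' B"
  shows "\<mu> = \<mu>'"
proof (rule measure_eqI)
  obtain cs :: "nat \<Rightarrow> ('m, 'n) chart" and A :: "nat \<Rightarrow> 'm set"
    where *: "\<forall>n. cs n \<in> M" "\<forall>n. A n \<in> sets borel" "\<forall>n. A n \<subseteq> chart_dom (cs n)"
    and disj: "disjoint_family A" and UA: "(\<Union>n. A n) = UNIV"
    by (rule countable_chart_partition[OF M])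
  then have csM: "cs n \<in> M" and csc: "is_chart (cs n)"
    and A: "A n \<in> sets borel" "A n \<subseteq> chart_dom (cs n)" for n
    using M by (auto simp: smooth_atlas_def)
  fix B assume "B \<in> sets \<mu>"
  then have B: "B \<in> sets borel"
    using sets by simp
  have split: "emeasure \<nu> B = (\<Sum>n. emeasure \<nu> (B \<inter> A n))" if "sets \<nu> = sets borel" for \<nu> :: "'m measure"
  proof -
    have "(\<Sum>n. emeasure \<nu> (B \<inter> A n)) = emeasure \<nu> (\<Union>n. B \<inter> A n)"
      using A(1) B that disjoint_family_subset[OF disj, of "\<lambda>n. B \<inter> A n"] by (intro suminf_emeasure) auto
    also have "(\<Union>n. B \<inter> A n) = B"
      using UA by auto
    finally show ?thesis ..
  qed
  have "emeasure \<mu> (B \<inter> A n) = emeasure \<mu>' (B \<inter> A n)" for n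
    using A[of n] B by (intro eq[OF csM]) auto
  then show "emeasure \<mu> B = emeasure \<mu>' B"
    using split sets by simp
qed (use sets in simp)

text \<open>The coordinate density restricted to X and pushed forward to the manifold. The parameter
  X lets one construction serve a piece of the partition, a whole chart and a coordinate
  box.\<close>

definition chart_measure :: "('m::topological_space, 'n::finite) chart \<Rightarrow> ('m \<Rightarrow> 'v::euclidean_space) \<Rightarrow> (real^'n) set \<Rightarrow> 'm measure" where
  "chart_measure c f X = distr (density lborel (\<lambda>x. ennreal (indicator X x *\<^sub>R vol_density c f x))) borel (total_chart_inv c)"

lemma borel_vol_density:
  fixes f :: "'m::topological_space \<Rightarrow> 'v::euclidean_space" and c :: "('m, 'n::finite) chart"
  assumes "is_chart c" "Ck_on 1 (chart_img c) (\<lambda>x. f (chart_inv c x))" "X \<in> sets borel" "X \<subseteq> chart_img c"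
  shows "(\<lambda>x. indicator X x *\<^sub>R vol_density c f x) \<in> borel_measurable borel"
  using continuous_on_subset[OF continuous_on_vol_density[OF assms(1,2)] assms(4)] assms(3)
  by (rule borel_measurable_continuous_on_indicator[rotated])

text \<open>The density vanishes off X, so the constant value of \<open>total_chart_inv\<close>
  outside the chart image adds no mass.\<close>

lemma emeasure_chart_measure:
  fixes f :: "'m::topological_space \<Rightarrow> 'v::euclidean_space" and c :: "('m, 'n::finite) chart"
  assumes c: "is_chart c" and f: "Ck_on 1 (chart_img c) (\<lambda>x. f (chart_inv c x))"
    and X: "X \<in> sets borel" "X \<subseteq> chart_img c" and B: "B \<in> sets borel"
  shows "emeasure (chart_measure c f X) B =
    (\<integral>\<^sup>+x\<in>chart_map c ` (B \<inter> chart_dom c) \<inter> X. ennreal (vol_density c f x) \<partial>lborel)"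
proof -
  note m = total_chart_inv_measurable[OF c]
  note v = borel_vol_density[OF c f X]
  have "emeasure (chart_measure c f X) B =
      emeasure (density lborel (\<lambda>x. ennreal (indicator X x *\<^sub>R vol_density c f x))) (total_chart_inv c -` B \<inter> UNIV)"
    unfolding chart_measure_def using m B by (subst emeasure_distr) auto
  also have "\<dots> = (\<integral>\<^sup>+x. ennreal (indicator X x *\<^sub>R vol_density c f x) * indicator (total_chart_inv c -` B) x \<partial>lborel)"
    using measurable_sets[OF m B] v by (subst emeasure_density) auto
  also have "\<dots> = (\<integral>\<^sup>+x\<in>chart_map c ` (B \<inter> chart_dom c) \<inter> X. ennreal (vol_density c f x) \<partial>lborel)"
  proof (rule nn_integral_cong)
    fix x
    have "total_chart_inv c x \<in> B \<longleftrightarrow> x \<in> chart_map c ` (B \<inter> chart_dom c)" if "x \<in> X"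
    proof -
      have x: "x \<in> chart_img c"
        using that X(2) by blast
      then have "total_chart_inv c x \<in> chart_dom c"
        using chart_inv_mem[OF c] by (simp add: total_chart_inv_def)
      then have "total_chart_inv c x \<in> B \<longleftrightarrow> total_chart_inv c x \<in> B \<inter> chart_dom c"
        by simp
      also have "(total_chart_inv c x \<in> B \<inter> chart_dom c) \<longleftrightarrow> x \<in> chart_map c ` (B \<inter> chart_dom c)"
        by (rule vimage_total_chart_inv[OF c _ x]) simp
      finally show ?thesis .
    qed
    then show "ennreal (indicator X x *\<^sub>R vol_density c f x) * indicator (total_chart_inv c -` B) x =
        ennreal (vol_density c f x) * indicator (chart_map c ` (B \<inter> chart_dom c) \<inter> X) x"
      by (auto simp: indicator_def)
  qed
  finally show ?thesis .
qed

text \<open>Coordinate independence of volume: the transition law of the densities is exactly the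
  Jacobian factor in the change of variables formula for the coordinate change.\<close>

lemma volume_transition:
  fixes M :: "('m::topological_space, 'n::finite) chart set" and f :: "'m \<Rightarrow> 'v::euclidean_space"
  assumes M: "smooth_atlas M" "c \<in> M" "d \<in> M" and f: "C1_field M f"
    and B: "B \<in> sets borel" "B \<subseteq> chart_dom c \<inter> chart_dom d"
  shows "(\<integral>\<^sup>+x\<in>chart_map c ` B. ennreal (vol_density c f x) \<partial>lborel) =
    (\<integral>\<^sup>+x\<in>chart_map d ` B. ennreal (vol_density d f x) \<partial>lborel)"
proof -
  have c: "is_chart c" and d: "is_chart d"
    using M by (auto simp: smooth_atlas_def)
  define g where "g = (\<lambda>x. chart_map d (chart_inv c x))"
  let ?S = "chart_map c ` B"
  \<comment> \<open>The indicators make both densities Borel functions on the whole coordinate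
    space; on the sets of integration they equal 1.\<close>
  let ?w = "\<lambda>x. indicator (chart_img c) x *\<^sub>R vol_density c f x"
  let ?h = "\<lambda>x. indicator (chart_img d) x *\<^sub>R vol_density d f x"
  have gS: "g ` ?S = chart_map d ` B"
    using B(2) by (force simp: g_def image_image chart_inv_map[OF c])
  have sub: "?S \<subseteq> chart_map c ` (chart_dom c \<inter> chart_dom d)"
    using B(2) by auto
  have fc: "Ck_on 1 (chart_img c) (\<lambda>x. f (chart_inv c x))" "Ck_on 1 (chart_img d) (\<lambda>x. f (chart_inv d x))"
    using f M by (auto simp: C1_field_def)
  have "(\<integral>\<^sup>+x\<in>?S. ennreal (?w x) \<partial>lborel) = (\<integral>\<^sup>+x\<in>g ` ?S. ennreal (?h x) \<partial>lborel)"
  proof (rule nn_integral_change_of_variables)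
    show "?S \<in> sets borel" "g ` ?S \<in> sets borel"
      unfolding gS using B by (auto intro!: borel_chart_image[OF c] borel_chart_image[OF d])
    show "(g has_derivative (\<lambda>v. dd v g x)) (at x within ?S)" if "x \<in> ?S" for x
    proof -
      have "g differentiable (at x)"
        unfolding g_def by (rule vol_density_transition(1)[OF M f]) (rule subsetD[OF sub that])
      then show ?thesis
        by (rule has_derivative_at_withinI[OF has_derivative_frechet])
    qed
    show "inj_on g ?S"
    proof (rule inj_onI)
      fix x y assume "x \<in> ?S" "y \<in> ?S" "g x = g y"
      then obtain p q where pq: "p \<in> B" "q \<in> B" "x = chart_map c p" "y = chart_map c q" by auto
      then have dom: "p \<in> chart_dom c" "p \<in> chart_dom d" "q \<in> chart_dom c" "q \<in> chart_dom d"
        using B(2) by auto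
      have "chart_map d p = chart_map d q"
        using \<open>g x = g y\<close> by (simp add: g_def pq chart_inv_map[OF c] dom)
      then have "p = q"
        using inj_onD[OF inj_on_chart_map[OF d]] dom by simp
      then show "x = y"
        using pq by simp
    qed
    show "?h \<in> borel_measurable borel" "?w \<in> borel_measurable borel"
      using borel_vol_density[OF c fc(1)] borel_vol_density[OF d fc(2)] open_chart_img[OF c] open_chart_img[OF d]
      by auto
    show "?h y \<ge> 0" for y
      by (simp add: vol_density_nonneg)
    show "?w x = \<bar>det (matrix (\<lambda>v. dd v g x))\<bar> * ?h (g x)" if x: "x \<in> ?S" for x
    proof -
      have "g x \<in> chart_map d ` B"
        using imageI[OF x, of g] by (simp only: gS)
      then have "x \<in> chart_img c" "g x \<in> chart_img d"
        using x B(2) by auto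
      moreover have "vol_density c f x = \<bar>det (matrix (\<lambda>v. dd v g x))\<bar> * vol_density d f (g x)"
        unfolding g_def by (rule vol_density_transition(2)[OF M f subsetD[OF sub x]])
      ultimately show ?thesis
        by simp
    qed
  qed
  moreover have "(\<integral>\<^sup>+x\<in>?S. ennreal (?w x) \<partial>lborel) = (\<integral>\<^sup>+x\<in>?S. ennreal (vol_density c f x) \<partial>lborel)"
    using B(2) by (intro nn_integral_cong) (auto simp: indicator_def)
  moreover have "(\<integral>\<^sup>+x\<in>g ` ?S. ennreal (?h x) \<partial>lborel) = (\<integral>\<^sup>+x\<in>chart_map d ` B. ennreal (vol_density d f x) \<partial>lborel)"
    unfolding gS using B(2) by (intro nn_integral_cong) (auto simp: indicator_def)
  ultimately show ?thesis
    by simp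
qed

text \<open>Countable additivity is an interchange of two sums of nonnegative terms, obtained by
  reading one of them as an integral for the counting measure.\<close>

lemma ex_countable_sum_measure:
  fixes N :: "nat \<Rightarrow> 'm measure" and M0 :: "'m measure"
  assumes N: "\<And>n. sets (N n) = sets M0"
  shows "\<exists>\<mu>. sets \<mu> = sets M0 \<and> (\<forall>B\<in>sets M0. emeasure \<mu> B = (\<Sum>n. emeasure (N n) B))"
proof -
  let ?m = "\<lambda>B. \<Sum>n. emeasure (N n) B"
  let ?\<mu> = "measure_of (space M0) (sets M0) ?m"
  have ca: "countably_additive (sets M0) ?m"
  proof (rule countably_additiveI)
    fix A :: "nat \<Rightarrow> 'm set"
    assume A: "range A \<subseteq> sets M0" "disjoint_family A" "(\<Union>i. A i) \<in> sets M0"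
    have "(\<Sum>i. ?m (A i)) = (\<integral>\<^sup>+n. (\<Sum>i. emeasure (N n) (A i)) \<partial>count_space UNIV)"
      by (subst nn_integral_suminf) (simp_all add: nn_integral_count_space_nat)
    also have "\<dots> = (\<integral>\<^sup>+n. emeasure (N n) (\<Union>i. A i) \<partial>count_space UNIV)"
      using A N by (intro nn_integral_cong suminf_emeasure) auto
    finally show "(\<Sum>i. ?m (A i)) = ?m (\<Union>i. A i)"
      by (simp add: nn_integral_count_space_nat)
  qed
  have "emeasure ?\<mu> B = ?m B" if "B \<in> sets M0" for B
    by (rule emeasure_measure_of_sigma)
      (use that ca sets.sigma_algebra_axioms[of M0] in \<open>auto simp: positive_def\<close>)
  then show ?thesis
    by (intro exI[of _ ?\<mu>]) simp
qed

text \<open>Each piece of the partition is measured in the chart assigned to it, and the results are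
  summed. Inside another chart c, \<open>volume_transition\<close> rewrites every summand with the
  density of c, and the pieces recombine.\<close>

lemma is_volume_exists:
  fixes M :: "('m::second_countable_topology, 'n::finite) chart set" and f :: "'m \<Rightarrow> 'v::euclidean_space"
  assumes M: "smooth_atlas M" and f: "C1_field M f"
  shows "\<exists>\<mu>. is_volume M f \<mu>"
proof -
  obtain cs :: "nat \<Rightarrow> ('m, 'n) chart" and A :: "nat \<Rightarrow> 'm set"
    where *: "\<forall>n. cs n \<in> M" "\<forall>n. A n \<in> sets borel" "\<forall>n. A n \<subseteq> chart_dom (cs n)"
    and disj: "disjoint_family A" and UA: "(\<Union>n. A n) = UNIV"
    by (rule countable_chart_partition[OF M])
  then have csM: "cs n \<in> M" and csc: "is_chart (cs n)"
    and A: "A n \<in> sets borel" "A n \<subseteq> chart_dom (cs n)" for n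
    using M by (auto simp: smooth_atlas_def)
  define N where "N n = chart_measure (cs n) f (chart_map (cs n) ` A n)" for n
  have fC: "Ck_on 1 (chart_img c) (\<lambda>x. f (chart_inv c x))" if "c \<in> M" for c
    using f that by (simp add: C1_field_def del: Ck_on.simps)
  have N: "emeasure (N n) B = (\<integral>\<^sup>+x\<in>chart_map (cs n) ` (B \<inter> A n). ennreal (vol_density (cs n) f x) \<partial>lborel)"
    if B: "B \<in> sets borel" for n B
  proof -
    have "chart_map (cs n) ` (B \<inter> chart_dom (cs n)) \<inter> chart_map (cs n) ` A n = chart_map (cs n) ` (B \<inter> A n)"
    proof -
      have "B \<inter> chart_dom (cs n) \<inter> A n = B \<inter> A n"
        using A(2)[of n] by blast
      then show ?thesis
        using inj_on_image_Int[OF inj_on_chart_map[OF csc[of n]], of "B \<inter> chart_dom (cs n)" "A n"] A(2)[of n] by simp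
    qed
    then show ?thesis
      unfolding N_def using A[of n] borel_chart_image[OF csc A]
      by (subst emeasure_chart_measure[OF csc fC[OF csM] _ _ B]) auto
  qed
  have "\<exists>\<mu>. sets \<mu> = sets borel \<and> (\<forall>B\<in>sets borel. emeasure \<mu> B = (\<Sum>n. emeasure (N n) B))"
    by (rule ex_countable_sum_measure) (simp add: N_def chart_measure_def)
  then obtain \<mu> where "sets \<mu> = sets borel \<and> (\<forall>B\<in>sets borel. emeasure \<mu> B = (\<Sum>n. emeasure (N n) B))" ..
  then have \<mu>: "sets \<mu> = sets borel" "\<And>B. B \<in> sets borel \<Longrightarrow> emeasure \<mu> B = (\<Sum>n. emeasure (N n) B)"
    by simp_all
  have vol: "emeasure \<mu> B = (\<integral>\<^sup>+x\<in>chart_map c ` B. ennreal (vol_density c f x) \<partial>lborel)"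
    if c: "c \<in> M" and B: "B \<in> sets borel" "B \<subseteq> chart_dom c" for c B
  proof -
    have cc: "is_chart c"
      using c M by (simp add: smooth_atlas_def)
    \<comment> \<open>The measure of the whole chart c is the common yardstick: its own countable
      additivity adds up the pieces of B.\<close>
    let ?C = "chart_measure c f (chart_img c)"
    have C: "emeasure ?C B' = (\<integral>\<^sup>+x\<in>chart_map c ` B'. ennreal (vol_density c f x) \<partial>lborel)"
      if "B' \<in> sets borel" "B' \<subseteq> B" for B'
    proof -
      have "chart_map c ` (B' \<inter> chart_dom c) \<inter> chart_img c = chart_map c ` B'"
        using that B(2) by auto
      then show ?thesis
        using open_chart_img[OF cc] that by (subst emeasure_chart_measure[OF cc fC[OF c]]) auto
    qed
    have "emeasure (N n) B = emeasure ?C (B \<inter> A n)" for n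
      unfolding N[OF B(1)] using A[of n] B
      by (subst C) (auto intro!: volume_transition[OF M csM c f])
    then have "emeasure \<mu> B = (\<Sum>n. emeasure ?C (B \<inter> A n))"
      using \<mu>(2)[OF B(1)] by simp
    also have "\<dots> = emeasure ?C (\<Union>n. B \<inter> A n)"
      using A(1) B(1) disjoint_family_subset[OF disj, of "\<lambda>n. B \<inter> A n"]
      by (intro suminf_emeasure) (auto simp: chart_measure_def)
    also have "(\<Union>n. B \<inter> A n) = B"
      using UA by auto
    finally show ?thesis
      using C[of B] B by simp
  qed
  have "is_volume M f \<mu>"
    unfolding is_volume_def by (intro conjI ballI impI \<mu>(1) vol)
  then show ?thesis ..
qed

lemma is_volume_volume_measure:
  fixes M :: "('m::second_countable_topology, 'n::finite) chart set" and f :: "'m \<Rightarrow> 'v::euclidean_space"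
  assumes M: "smooth_atlas M" and f: "C1_field M f"
  shows "is_volume M f (volume_measure M f)"
proof -
  obtain \<mu> where \<mu>: "is_volume M f \<mu>"
    using is_volume_exists[OF M f] by blast
  have "volume_measure M f = (THE \<mu>. is_volume M f \<mu>)"
    unfolding volume_measure_def is_volume_def vol_density_def ..
  moreover have "\<mu>' = \<mu>" if "is_volume M f \<mu>'" for \<mu>'
    using that \<mu> by (intro measure_eqI_charts[OF M]) (auto simp: is_volume_def)
  ultimately show ?thesis
    using theI[of "is_volume M f", OF \<mu>] by simp
qed

lemma is_volumeD:
  assumes "is_volume M f \<mu>"
  shows "sets \<mu> = sets borel" "space \<mu> = UNIV"
    "c \<in> M \<Longrightarrow> B \<in> sets borel \<Longrightarrow> B \<subseteq> chart_dom c \<Longrightarrow>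
      emeasure \<mu> B = (\<integral>\<^sup>+x\<in>chart_map c ` B. ennreal (vol_density c f x) \<partial>lborel)"
  using assms sets_eq_imp_space_eq[of \<mu> borel] by (auto simp: is_volume_def)

lemma emeasure_density_indicator:
  assumes "K \<in> sets \<mu>" "B \<in> sets \<mu>"
  shows "emeasure (density \<mu> (\<lambda>p. ennreal (indicator K p))) B = emeasure \<mu> (B \<inter> K)"
proof -
  have "emeasure (density \<mu> (\<lambda>p. ennreal (indicator K p))) B = (\<integral>\<^sup>+p. ennreal (indicator K p) * indicator B p \<partial>\<mu>)"
    using assms by (intro emeasure_density) auto
  also have "\<dots> = (\<integral>\<^sup>+p. indicator (B \<inter> K) p \<partial>\<mu>)"
    by (intro nn_integral_cong) (auto simp: indicator_def)
  finally show ?thesis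
    using assms by simp
qed

section \<open>Integrals over a coordinate box and off a closed set\<close>

text \<open>Restricted to K, the volume measure is the push-forward of the density on the box, so
  integrals over K become coordinate integrals of continuous functions.\<close>

lemma
  fixes M :: "('m::{t2_space, second_countable_topology}, 'n::finite) chart set" and f :: "'m \<Rightarrow> 'v::euclidean_space"
    and h :: "'m \<Rightarrow> real"
  assumes M: "smooth_atlas M" and f: "C1_field M f" and c: "c \<in> M"
    and box: "cbox lo hi \<subseteq> chart_img c" and h: "continuous_on (cbox lo hi) (\<lambda>x. h (chart_inv c x))"
  defines "K \<equiv> chart_inv c ` cbox lo hi"
  shows compact_chart_box: "compact K"
    and set_integrable_chart_box: "set_integrable (volume_measure M f) K h"
    and set_lebesgue_integral_chart_box: "(LINT p:K|volume_measure M f. h p) =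
      integral (cbox lo hi) (\<lambda>x. h (chart_inv c x) * vol_density c f x)"
proof -
  have cc: "is_chart c"
    using M c by (simp add: smooth_atlas_def)
  have fc: "Ck_on 1 (chart_img c) (\<lambda>x. f (chart_inv c x))"
    using f c by (simp add: C1_field_def del: Ck_on.simps)
  define \<mu> where "\<mu> = volume_measure M f"
  have vol: "is_volume M f \<mu>"
    unfolding \<mu>_def by (rule is_volume_volume_measure[OF M f])
  note sets_\<mu> = is_volumeD(1)[OF vol]
  show K: "compact K"
    unfolding K_def using continuous_on_subset[OF continuous_on_chart_inv[OF cc] box]
    by (rule compact_continuous_image) (rule compact_cbox)
  have KB: "K \<in> sets borel"
    using compact_imp_closed[OF K] by simp
  have Kdom: "K \<subseteq> chart_dom c"
    unfolding K_def using box chart_inv_mem[OF cc] by blast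
  have mapK: "chart_map c ` K = cbox lo hi"
  proof -
    have "chart_map c ` chart_inv c ` cbox lo hi = (\<lambda>x. x) ` cbox lo hi"
      unfolding image_image by (rule image_cong[OF refl]) (use box chart_map_inv[OF cc] in blast)
    then show ?thesis
      by (simp add: K_def)
  qed
  let ?v = "\<lambda>x. indicator (cbox lo hi) x *\<^sub>R vol_density c f x"
  have vm: "?v \<in> borel_measurable borel"
    using borel_vol_density[OF cc fc _ box] by simp
  have tm: "total_chart_inv c \<in> borel_measurable borel"
    by (rule total_chart_inv_measurable[OF cc])
  \<comment> \<open>Measures are compared instead of integrals: once they agree on Borel sets, both
    integrability and the value of the integral transfer to coordinates.\<close>
  have dens: "density \<mu> (\<lambda>p. ennreal (indicator K p)) = chart_measure c f (cbox lo hi)"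
  proof (rule measure_eqI)
    fix B assume "B \<in> sets (density \<mu> (\<lambda>p. ennreal (indicator K p)))"
    then have B: "B \<in> sets borel"
      using sets_\<mu> by simp
    have "emeasure (density \<mu> (\<lambda>p. ennreal (indicator K p))) B = emeasure \<mu> (B \<inter> K)"
      by (rule emeasure_density_indicator) (use B KB sets_\<mu> in simp_all)
    also have "\<dots> = (\<integral>\<^sup>+x\<in>chart_map c ` (B \<inter> K). ennreal (vol_density c f x) \<partial>lborel)"
      by (rule is_volumeD(3)[OF vol c]) (use B KB Kdom in auto)
    also have "chart_map c ` (B \<inter> K) = chart_map c ` (B \<inter> chart_dom c) \<inter> cbox lo hi"
    proof -
      have "B \<inter> chart_dom c \<inter> K = B \<inter> K"
        using Kdom by blast
      then show ?thesis
        using inj_on_image_Int[OF inj_on_chart_map[OF cc], of "B \<inter> chart_dom c" K] Kdom mapK by simp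
    qed
    also have "(\<integral>\<^sup>+x\<in>chart_map c ` (B \<inter> chart_dom c) \<inter> cbox lo hi. ennreal (vol_density c f x) \<partial>lborel) =
        emeasure (chart_measure c f (cbox lo hi)) B"
      by (rule emeasure_chart_measure[OF cc fc _ box B, symmetric]) simp
    finally show "emeasure (density \<mu> (\<lambda>p. ennreal (indicator K p))) B = emeasure (chart_measure c f (cbox lo hi)) B" .
  qed (simp add: sets_\<mu> chart_measure_def)
  let ?h = "\<lambda>p. indicator K p *\<^sub>R h p"
  have hm: "?h \<in> borel_measurable borel"
  proof (rule borel_measurable_continuous_on_indicator[OF KB])
    have "continuous_on K (\<lambda>p. h (chart_inv c (chart_map c p)))"
      by (rule continuous_on_compose2[OF h continuous_on_subset[OF continuous_on_chart_map[OF cc] Kdom]])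
        (simp add: mapK)
    then show "continuous_on K h"
      by (rule continuous_on_eq) (use Kdom chart_inv_map[OF cc] in auto)
  qed
  have hm': "?h \<in> borel_measurable \<mu>" "(indicator K :: _ \<Rightarrow> real) \<in> borel_measurable \<mu>"
    using hm KB by (simp_all add: measurable_cong_sets[OF sets_\<mu> refl])
  have idem: "indicator K p * (indicator K p * h p) = indicator K p * h p" for p
    by (simp add: indicator_def)
  have pull: "?v x *\<^sub>R ?h (total_chart_inv c x) =
      indicator (cbox lo hi) x *\<^sub>R (h (chart_inv c x) * vol_density c f x)" for x
  proof (cases "x \<in> cbox lo hi")
    case True
    then have "total_chart_inv c x = chart_inv c x" "chart_inv c x \<in> K"
      using box by (auto simp: total_chart_inv_def K_def)
    then show ?thesis
      by simp
  qed simp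
  have cont: "continuous_on (cbox lo hi) (\<lambda>x. h (chart_inv c x) * vol_density c f x)"
    by (intro continuous_on_mult h continuous_on_subset[OF continuous_on_vol_density[OF cc fc] box])
  have int: "set_integrable lborel (cbox lo hi) (\<lambda>x. h (chart_inv c x) * vol_density c f x)"
    unfolding set_integrable_def by (rule borel_integrable_compact[OF compact_cbox cont])
  have hm'': "(\<lambda>x. ?h (total_chart_inv c x)) \<in> borel_measurable borel"
    using measurable_compose[OF tm hm] .
  have nn: "AE x in lborel. 0 \<le> ?v x"
    by (simp add: vol_density_nonneg)
  have "integrable (density \<mu> (\<lambda>p. ennreal (indicator K p))) ?h"
    unfolding dens chart_measure_def using tm hm hm'' vm nn int
    by (simp only: integrable_distr_eq integrable_density measurable_lborel1 measurable_density_eq1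
        measurable_lborel2 pull set_integrable_def)
  then show "set_integrable (volume_measure M f) K h"
    unfolding set_integrable_def \<mu>_def[symmetric] using hm'
    by (subst (asm) integrable_density) (simp_all add: idem)
  have "(LINT p:K|\<mu>. h p) = integral\<^sup>L (density \<mu> (\<lambda>p. ennreal (indicator K p))) ?h"
    unfolding set_lebesgue_integral_def using hm' by (subst integral_density) (simp_all add: idem)
  also have "\<dots> = (\<integral>x. ?v x *\<^sub>R ?h (total_chart_inv c x) \<partial>lborel)"
    unfolding dens chart_measure_def using tm hm hm'' vm nn
    by (simp only: integral_distr integral_density measurable_lborel1 measurable_density_eq1 measurable_lborel2)
  also have "\<dots> = (LINT x:cbox lo hi|lborel. h (chart_inv c x) * vol_density c f x)"
    unfolding pull set_lebesgue_integral_def ..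
  also have "\<dots> = integral (cbox lo hi) (\<lambda>x. h (chart_inv c x) * vol_density c f x)"
    by (rule set_borel_integral_eq_integral(2)[OF int])
  finally show "(LINT p:K|volume_measure M f. h p) =
      integral (cbox lo hi) (\<lambda>x. h (chart_inv c x) * vol_density c f x)"
    by (simp only: \<mu>_def)
qed

text \<open>The density at a point depends only on the germ of the map there. The complement of K is
  open, so maps agreeing on it have equal derivatives, hence equal densities, throughout it.\<close>

lemma volume_measure_eq_off:
  fixes M :: "('m::{t2_space, second_countable_topology}, 'n::finite) chart set" and f f' :: "'m \<Rightarrow> 'v::euclidean_space"
  assumes M: "smooth_atlas M" and f: "C1_field M f" "C1_field M f'"
    and K: "closed K" and eq: "\<And>p. p \<notin> K \<Longrightarrow> f p = f' p"
  shows "density (volume_measure M f) (\<lambda>p. ennreal (indicator (- K) p)) =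
    density (volume_measure M f') (\<lambda>p. ennreal (indicator (- K) p))"
proof (rule measure_eqI_charts[OF M])
  note vol = is_volume_volume_measure[OF M f(1)] and vol' = is_volume_volume_measure[OF M f(2)]
  show "sets (density (volume_measure M f) (\<lambda>p. ennreal (indicator (- K) p))) = sets borel"
    "sets (density (volume_measure M f') (\<lambda>p. ennreal (indicator (- K) p))) = sets borel"
    using is_volumeD(1)[OF vol] is_volumeD(1)[OF vol'] by simp_all
  fix c B assume c: "c \<in> M" and B: "B \<in> sets borel" "B \<subseteq> chart_dom c"
  have cc: "is_chart c"
    using M c by (simp add: smooth_atlas_def)
  have emd: "emeasure (density \<mu> (\<lambda>p. ennreal (indicator (- K) p))) B = emeasure \<mu> (B - K)"
    if "sets \<mu> = sets borel" for \<mu> :: "'m measure"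
    unfolding Diff_eq by (rule emeasure_density_indicator) (use B K that in simp_all)
  have BK: "B - K \<in> sets borel" "B - K \<subseteq> chart_dom c"
    using B K by auto
  have "vol_density c f x = vol_density c f' x" if x: "x \<in> chart_map c ` (B - K)" for x
  proof -
    let ?W = "chart_map c ` (chart_dom c - K)"
    have W: "open ?W"
      using open_chart_dom[OF cc] K by (intro open_chart_image[OF cc]) auto
    have xW: "x \<in> ?W" and xc: "x \<in> chart_img c"
      using x B by auto
    have "dd v (\<lambda>x. f (chart_inv c x)) x = dd v (\<lambda>x. f' (chart_inv c x)) x" for v
    proof (rule dd_open_cong[OF W xW])
      show "f (chart_inv c y) = f' (chart_inv c y)" if "y \<in> ?W" for y
        using that eq by (auto simp: chart_inv_map[OF cc])
    qed
    then show ?thesis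
      by (simp only: vol_density_altdef[OF cc xc])
  qed
  then have "(\<integral>\<^sup>+x\<in>chart_map c ` (B - K). ennreal (vol_density c f x) \<partial>lborel) =
      (\<integral>\<^sup>+x\<in>chart_map c ` (B - K). ennreal (vol_density c f' x) \<partial>lborel)"
    by (intro nn_integral_cong) (simp add: indicator_def)
  then show "emeasure (density (volume_measure M f) (\<lambda>p. ennreal (indicator (- K) p))) B =
      emeasure (density (volume_measure M f') (\<lambda>p. ennreal (indicator (- K) p))) B"
    by (simp only: emd[OF is_volumeD(1)[OF vol]] emd[OF is_volumeD(1)[OF vol']]
        is_volumeD(3)[OF vol c BK] is_volumeD(3)[OF vol' c BK])
qed

text \<open>Here \<open>\<mu>'\<close> and h' belong to the unvaried map. Off K both measure and
  integrand coincide with theirs, so the outer part is expressed by unvaried data and takes its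
  integrability from h'.\<close>

lemma integral_split_off:
  fixes h h' :: "'m::topological_space \<Rightarrow> real"
  assumes sets: "sets \<mu> = sets borel" "sets \<mu>' = sets borel" and K: "K \<in> sets borel"
    and dens: "density \<mu> (\<lambda>p. ennreal (indicator (- K) p)) = density \<mu>' (\<lambda>p. ennreal (indicator (- K) p))"
    and eq: "\<And>p. p \<notin> K \<Longrightarrow> h p = h' p"
    and h': "integrable \<mu>' h'" and h: "set_integrable \<mu> K h"
  shows "(LINT p|\<mu>. h p) = (LINT p:K|\<mu>. h p) + (LINT p:-K|\<mu>'. h' p)"
proof -
  have h'm: "h' \<in> borel_measurable borel"
    using borel_measurable_integrable[OF h'] by (simp add: measurable_cong_sets[OF sets(2) refl])
  have m: "h' \<in> borel_measurable \<mu>" "h' \<in> borel_measurable \<mu>'"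
    "(indicator (- K) :: _ \<Rightarrow> real) \<in> borel_measurable \<mu>" "(indicator (- K) :: _ \<Rightarrow> real) \<in> borel_measurable \<mu>'"
    using h'm K by (simp_all add: measurable_cong_sets[OF sets(1) refl] measurable_cong_sets[OF sets(2) refl])
  have "integrable \<mu>' (\<lambda>p. indicator (- K) p *\<^sub>R h' p)"
    using K sets by (intro integrable_mult_indicator h') simp
  then have "integrable (density \<mu>' (\<lambda>p. ennreal (indicator (- K) p))) h'"
    using m by (subst integrable_density) simp_all
  then have i: "integrable \<mu> (\<lambda>p. indicator (- K) p *\<^sub>R h' p)"
    unfolding dens[symmetric] using m by (subst (asm) integrable_density) simp_all
  have "(LINT p|\<mu>. h p) = (LINT p|\<mu>. indicator K p *\<^sub>R h p + indicator (- K) p *\<^sub>R h' p)"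
    by (intro Bochner_Integration.integral_cong refl) (simp add: indicator_def eq)
  also have "\<dots> = (LINT p:K|\<mu>. h p) + (LINT p|\<mu>. indicator (- K) p *\<^sub>R h' p)"
    using h i unfolding set_lebesgue_integral_def set_integrable_def by (rule Bochner_Integration.integral_add)
  also have "(LINT p|\<mu>. indicator (- K) p *\<^sub>R h' p) = integral\<^sup>L (density \<mu> (\<lambda>p. ennreal (indicator (- K) p))) h'"
    using m by (subst integral_density) simp_all
  also have "\<dots> = (LINT p:-K|\<mu>'. h' p)"
    unfolding dens set_lebesgue_integral_def using m by (subst integral_density) simp_all
  finally show ?thesis .
qed

section \<open>Frames along a hypersurface\<close>

text \<open>Linear algebra at one point, with a i in the role of F_i and G of the metric.
  Codimension one and the positive Gram determinant make the a i together with \<nu> a basis of the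
  ambient space.\<close>

locale hypersurface_frame =
  fixes a :: "'n::finite \<Rightarrow> real^'k" and \<nu> :: "real^'k" and G :: "real^'n^'n"
  assumes codim: "CARD('k) = CARD('n) + 1"
    and G_def: "G = (\<chi> i j. a i \<bullet> a j)" and det_G: "det G > 0"
    and unit: "\<nu> \<bullet> \<nu> = 1" and normal: "\<nu> \<bullet> a i = 0"
begin

abbreviation "I \<equiv> matrix_inv G"

lemma I_sym: "I $ i $ j = I $ j $ i"
  by (rule matrix_inv_sym) (use det_G in \<open>auto simp: G_def inner_commute\<close>)

lemma I_G: "(\<Sum>j\<in>UNIV. I $ i $ j * (a j \<bullet> a k)) = (if i = k then 1 else 0)"
proof -
  have "(I ** G) $ i $ k = (if i = k then 1 else 0)"
    using matrix_inv_mult(2)[of G] det_G by (simp add: mat_def)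
  then show ?thesis
    by (simp add: matrix_matrix_mult_def G_def)
qed

text \<open>The frame is independent and has as many members as the dimension, so it spans: x is
  then a combination of vectors orthogonal to x. This is the device by which vector identities are
  checked in components.\<close>

lemma orthogonal_frame_imp_0:
  assumes "x \<bullet> \<nu> = 0" "\<And>i. x \<bullet> a i = 0"
  shows "x = 0"
proof -
  \<comment> \<open>The index \<open>None\<close> is the normal direction, and \<open>Some i\<close>
    is the i-th tangent vector.\<close>
  define A where "A c = (c $ None) *\<^sub>R \<nu> + (\<Sum>i\<in>UNIV. (c $ Some i) *\<^sub>R a i)" for c :: "real^'n option"
  have lin: "linear A"
    by (rule linearI) (simp_all add: A_def algebra_simps sum.distrib scaleR_sum_right)
  have "c = 0" if "A c = 0" for c
  proof -
    have "\<nu> \<bullet> A c = c $ None"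
      by (simp add: A_def inner_add_right inner_sum_right unit normal)
    then have c0: "c $ None = 0"
      using that by simp
    define y :: "real^'n" where "y = (\<chi> i. c $ Some i)"
    have "(G *v y) $ j = a j \<bullet> A c" for j
      by (simp add: A_def c0 y_def G_def matrix_vector_mult_def inner_sum_right mult.commute)
    then have "G *v y = 0"
      using that by (simp add: vec_eq_iff)
    then have "I ** G *v y = 0"
      by (simp add: matrix_vector_mul_assoc[symmetric])
    then have "y = 0"
      using matrix_inv_mult(2)[of G] det_G by simp
    then have "c $ Some i = 0" for i
      by (simp add: y_def vec_eq_iff)
    then show "c = 0"
      using c0 by (simp add: vec_eq_iff split_option_all)
  qed
  then have "inj A"
    using lin by (simp add: linear_injective_0)
  then have "dim (range A) = dim (UNIV :: (real^'n option) set)"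
    by (intro dim_image_eq[OF lin]) simp
  then have "span (range A) = UNIV"
    using codim by (subst dim_eq_full[symmetric]) (simp add: card_UNIV_option)
  then have "range A = UNIV"
    using linear_subspace_image[OF lin subspace_UNIV] span_eq_iff[of "range A"] by simp
  then obtain c where c: "x = A c"
    by blast
  have "x \<bullet> A c = 0"
    by (simp add: A_def inner_add_right inner_sum_right assms)
  then show ?thesis
    by (simp add: c)
qed

lemma frame_decomposition:
  "x = (x \<bullet> \<nu>) *\<^sub>R \<nu> + (\<Sum>k\<in>UNIV. (\<Sum>l\<in>UNIV. I $ k $ l * (x \<bullet> a l)) *\<^sub>R a k)"
proof -
  define y where "y = (\<Sum>k\<in>UNIV. (\<Sum>l\<in>UNIV. I $ k $ l * (x \<bullet> a l)) *\<^sub>R a k)"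
  have "\<nu> \<bullet> y = 0"
    by (simp add: y_def inner_sum_right normal)
  then have "y \<bullet> \<nu> = 0"
    by (simp only: inner_commute)
  moreover have "y \<bullet> a m = x \<bullet> a m" for m
  proof -
    have "y \<bullet> a m = (\<Sum>k\<in>UNIV. \<Sum>l\<in>UNIV. (x \<bullet> a l) * (I $ l $ k * (a k \<bullet> a m)))"
      unfolding y_def inner_sum_left inner_scaleR_left sum_distrib_right
      by (intro sum.cong refl) (subst I_sym, simp)
    also have "\<dots> = (\<Sum>l\<in>UNIV. (x \<bullet> a l) * (\<Sum>k\<in>UNIV. I $ l $ k * (a k \<bullet> a m)))"
      unfolding sum_distrib_left by (rule sum.swap)
    finally show ?thesis
      by (simp add: I_G if_distrib cong: if_cong)
  qed
  ultimately have "x - (x \<bullet> \<nu>) *\<^sub>R \<nu> - y = 0"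
    by (intro orthogonal_frame_imp_0) (simp_all add: inner_diff_left unit normal)
  then show ?thesis
    by (simp add: y_def algebra_simps)
qed

lemma frame_inner:
  "x \<bullet> y = (x \<bullet> \<nu>) * (y \<bullet> \<nu>) + (\<Sum>k\<in>UNIV. \<Sum>l\<in>UNIV. I $ k $ l * (x \<bullet> a l) * (y \<bullet> a k))"
proof -
  have "x \<bullet> y = ((x \<bullet> \<nu>) *\<^sub>R \<nu> + (\<Sum>k\<in>UNIV. (\<Sum>l\<in>UNIV. I $ k $ l * (x \<bullet> a l)) *\<^sub>R a k)) \<bullet> y"
    using frame_decomposition[of x] by simp
  also have "\<dots> = (x \<bullet> \<nu>) * (y \<bullet> \<nu>) + (\<Sum>k\<in>UNIV. \<Sum>l\<in>UNIV. I $ k $ l * (x \<bullet> a l) * (y \<bullet> a k))"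
    by (simp add: inner_add_left inner_sum_left sum_distrib_right inner_commute[of \<nu> y] inner_commute[of "a _" y])
  finally show ?thesis .
qed

text \<open>Dictionary: v is the velocity, w i its i-th partial derivative, b i j the second
  derivatives of F, acc the acceleration and de the differential of e. The assumption is the
  Euler-Lagrange equation divided by the density. Since the trace on its left is div S - \<sigma> H,
  solving for acc and splitting v into normal and tangential parts gives the conclusion.\<close>

lemma equation_of_motion_algebra:
  fixes w :: "'n \<Rightarrow> real^'k" and b :: "'n \<Rightarrow> 'n \<Rightarrow> real^'k" and v acc :: "real^'k" and de :: "'n \<Rightarrow> real"
  defines "\<sigma> \<equiv> v \<bullet> \<nu>" and "S \<equiv> \<lambda>i. v \<bullet> a i"
    and "H \<equiv> \<Sum>i\<in>UNIV. \<Sum>j\<in>UNIV. I $ i $ j * (b i j \<bullet> \<nu>)"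
    and "\<Gamma> \<equiv> \<lambda>k i j. \<Sum>l\<in>UNIV. I $ k $ l * (b i j \<bullet> a l)"
  defines "divS \<equiv> \<Sum>i\<in>UNIV. \<Sum>j\<in>UNIV. I $ i $ j * (w i \<bullet> a j + v \<bullet> b i j - (\<Sum>k\<in>UNIV. \<Gamma> k i j * S k))"
    and "Ssq \<equiv> \<Sum>i\<in>UNIV. \<Sum>j\<in>UNIV. I $ i $ j * S i * S j"
  assumes eq: "(\<Sum>i\<in>UNIV. \<Sum>j\<in>UNIV. I $ i $ j * (a i \<bullet> w j)) *\<^sub>R v + acc =
      (((n - v \<bullet> v) / 2) * H) *\<^sub>R \<nu> - (\<Sum>k\<in>UNIV. (\<Sum>l\<in>UNIV. I $ k $ l * de l) *\<^sub>R a k)"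
  shows "acc = (((v \<bullet> v + n) / 2 - Ssq) * H - \<sigma> * divS) *\<^sub>R \<nu> +
      (\<Sum>k\<in>UNIV. ((\<sigma> * H - divS) * (\<Sum>l\<in>UNIV. I $ k $ l * S l) - (\<Sum>l\<in>UNIV. I $ k $ l * de l)) *\<^sub>R a k)"
proof -
  have "(\<Sum>k\<in>UNIV. \<Gamma> k i j * S k) = (\<Sum>k\<in>UNIV. \<Sum>l\<in>UNIV. I $ k $ l * (b i j \<bullet> a l) * (v \<bullet> a k))" for i j
    by (simp add: \<Gamma>_def S_def sum_distrib_right)
  \<comment> \<open>The Christoffel term removes exactly the tangential part of b i j, leaving
    \<sigma> times the second fundamental form.\<close>
  then have \<Gamma>: "v \<bullet> b i j - (\<Sum>k\<in>UNIV. \<Gamma> k i j * S k) = \<sigma> * (b i j \<bullet> \<nu>)" for i j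
    using frame_inner[of "b i j" v] by (simp add: \<sigma>_def inner_commute[of v "b i j"])
  have "w i \<bullet> a j + v \<bullet> b i j - (\<Sum>k\<in>UNIV. \<Gamma> k i j * S k) = w i \<bullet> a j + \<sigma> * (b i j \<bullet> \<nu>)" for i j
    using \<Gamma>[of i j] by linarith
  then have "divS = (\<Sum>i\<in>UNIV. \<Sum>j\<in>UNIV. I $ i $ j * (w i \<bullet> a j) + \<sigma> * (I $ i $ j * (b i j \<bullet> \<nu>)))"
    unfolding divS_def by (simp only: distrib_left mult.left_commute)
  also have "\<dots> = (\<Sum>i\<in>UNIV. \<Sum>j\<in>UNIV. I $ i $ j * (w i \<bullet> a j)) + \<sigma> * H"
    by (simp add: H_def sum.distrib sum_distrib_left)
  also have "(\<Sum>i\<in>UNIV. \<Sum>j\<in>UNIV. I $ i $ j * (w i \<bullet> a j)) = (\<Sum>i\<in>UNIV. \<Sum>j\<in>UNIV. I $ i $ j * (a i \<bullet> w j))"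
    by (subst sum.swap) (simp add: I_sym inner_commute)
  finally have trace: "(\<Sum>i\<in>UNIV. \<Sum>j\<in>UNIV. I $ i $ j * (a i \<bullet> w j)) = divS - \<sigma> * H"
    by simp
  have vv: "v \<bullet> v = \<sigma> * \<sigma> + Ssq"
    using frame_inner[of v v] by (simp add: \<sigma>_def Ssq_def S_def mult_ac)
  have v: "v = \<sigma> *\<^sub>R \<nu> + (\<Sum>k\<in>UNIV. (\<Sum>l\<in>UNIV. I $ k $ l * S l) *\<^sub>R a k)"
    unfolding \<sigma>_def S_def by (rule frame_decomposition)
  have "acc = (((n - v \<bullet> v) / 2) * H) *\<^sub>R \<nu> - (\<Sum>k\<in>UNIV. (\<Sum>l\<in>UNIV. I $ k $ l * de l) *\<^sub>R a k)
      + (\<sigma> * H - divS) *\<^sub>R v"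
    using eq unfolding trace by (simp add: algebra_simps)
  also have "(\<sigma> * H - divS) *\<^sub>R v = (\<sigma> * H - divS) *\<^sub>R (\<sigma> *\<^sub>R \<nu> + (\<Sum>k\<in>UNIV. (\<Sum>l\<in>UNIV. I $ k $ l * S l) *\<^sub>R a k))"
    using v by simp
  also have "\<dots> = ((\<sigma> * H - divS) * \<sigma>) *\<^sub>R \<nu> + (\<Sum>k\<in>UNIV. ((\<sigma> * H - divS) * (\<Sum>l\<in>UNIV. I $ k $ l * S l)) *\<^sub>R a k)"
    by (simp add: scaleR_add_right scaleR_sum_right)
  finally have acc: "acc = (((n - v \<bullet> v) / 2) * H + (\<sigma> * H - divS) * \<sigma>) *\<^sub>R \<nu> +
      (\<Sum>k\<in>UNIV. ((\<sigma> * H - divS) * (\<Sum>l\<in>UNIV. I $ k $ l * S l) - (\<Sum>l\<in>UNIV. I $ k $ l * de l)) *\<^sub>R a k)"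
    by (simp add: scaleR_add_left scaleR_diff_left sum_subtractf)
  \<comment> \<open>The normal part of v adds \<sigma>^2 H, and |v|^2 = \<sigma>^2 + |S|^2 turns (n
    - |v|^2) / 2 + \<sigma>^2 into e - |S|^2.\<close>
  have "((n - v \<bullet> v) / 2) * H + (\<sigma> * H - divS) * \<sigma> = ((v \<bullet> v + n) / 2 - Ssq) * H - \<sigma> * divS"
    unfolding vv by (simp add: field_simps)
  then show ?thesis
    using acc by simp
qed

end

section \<open>The Euler-Lagrange equation in coordinates\<close>

lemma dd_inner:
  assumes "f differentiable (at x)" "g differentiable (at x)"
  shows "dd v (\<lambda>x. f x \<bullet> g x) x = f x \<bullet> dd v g x + dd v f x \<bullet> g x"
  by (rule dd_eq) (intro has_derivative_inner has_derivative_frechet assms)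

lemma dd_scaleR:
  assumes "f differentiable (at x)" "g differentiable (at x)"
  shows "dd v (\<lambda>x. f x *\<^sub>R g x) x = f x *\<^sub>R dd v g x + dd v f x *\<^sub>R g x"
  by (rule dd_eq) (intro has_derivative_scaleR has_derivative_frechet assms)

lemma dd_curve:
  assumes "f differentiable (at z)" "((\<lambda>s. f (z + s *\<^sub>R u)) has_vector_derivative d) (at 0)"
  shows "dd u f z = d"
proof -
  have "((\<lambda>s. z + s *\<^sub>R u) has_vector_derivative u) (at 0)"
    by (auto intro!: derivative_eq_intros)
  then have "((\<lambda>s. f (z + s *\<^sub>R u)) has_vector_derivative dd u f (z + 0 *\<^sub>R u)) (at 0)"
    by (rule has_vector_derivative_dd_compose) (use assms(1) in simp)
  then show ?thesis
    using vector_derivative_unique_at[OF _ assms(2)] by simp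
qed

lemma dd_slice:
  fixes f :: "real \<times> 'a::euclidean_space \<Rightarrow> 'b::real_normed_vector"
  assumes "f differentiable (at (t, x))"
  shows "dd u (\<lambda>y. f (t, y)) x = dd (0, u) f (t, x)" "(\<lambda>y. f (t, y)) differentiable (at x)"
proof -
  have "((\<lambda>y. f (t, y)) has_derivative (\<lambda>u. dd (0, u) f (t, x))) (at x)"
    by (rule has_derivative_compose[where g = f and f = "\<lambda>y. (t, y)", OF _ has_derivative_frechet[OF assms]])
      (intro has_derivative_Pair has_derivative_const has_derivative_ident)
  then show "dd u (\<lambda>y. f (t, y)) x = dd (0, u) f (t, x)" "(\<lambda>y. f (t, y)) differentiable (at x)"
    by (auto simp: dd_eq differentiable_def)
qed

abbreviation vel :: "(real \<times> (real^'n) \<Rightarrow> 'v::real_normed_vector) \<Rightarrow> real \<times> (real^'n) \<Rightarrow> 'v" where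
  "vel g \<equiv> dd (1, 0) g"

abbreviation sd :: "'n::finite \<Rightarrow> (real \<times> (real^'n) \<Rightarrow> 'v::real_normed_vector) \<Rightarrow> real \<times> (real^'n) \<Rightarrow> 'v" where
  "sd i g \<equiv> dd (0, axis i 1) g"

definition gram :: "(real \<times> (real^'n::finite) \<Rightarrow> 'v::euclidean_space) \<Rightarrow> real \<times> (real^'n) \<Rightarrow> real^'n^'n" where
  "gram g z = (\<chi> i j. sd i g z \<bullet> sd j g z)"

definition gvol :: "(real \<times> (real^'n::finite) \<Rightarrow> 'v::euclidean_space) \<Rightarrow> real \<times> (real^'n) \<Rightarrow> real" where
  "gvol g z = sqrt (det (gram g z))"

definition lag :: "(real \<times> (real^'n::finite) \<Rightarrow> 'v::euclidean_space) \<Rightarrow> real \<times> (real^'n) \<Rightarrow> real" where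
  "lag g z = (real CARD('n) - vel g z \<bullet> vel g z) / 2"

definition mom :: "(real \<times> (real^'n::finite) \<Rightarrow> 'v::euclidean_space) \<Rightarrow> real \<times> (real^'n) \<Rightarrow> 'v" where
  "mom g z = gvol g z *\<^sub>R vel g z"

text \<open>The derivative of the volume density with respect to F_j. Likewise \<open>mom\<close> is
  minus the derivative of the Lagrangian density \<open>lag g z * gvol g z\<close> with respect to
  the velocity.\<close>

definition flux :: "(real \<times> (real^'n::finite) \<Rightarrow> 'v::euclidean_space) \<Rightarrow> 'n \<Rightarrow> real \<times> (real^'n) \<Rightarrow> 'v" where
  "flux g j z = (\<Sum>i\<in>UNIV. (gvol g z * matrix_inv (gram g z) $ i $ j) *\<^sub>R sd i g z)"

definition euler_lagrange :: "(real \<times> (real^'n::finite) \<Rightarrow> 'v::euclidean_space) \<Rightarrow> real \<times> (real^'n) \<Rightarrow> bool" where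
  "euler_lagrange g z \<longleftrightarrow> vel (mom g) z = (\<Sum>j\<in>UNIV. sd j (\<lambda>z. lag g z *\<^sub>R flux g j z) z)"

context
  fixes g :: "real \<times> (real^'n::finite) \<Rightarrow> 'v::euclidean_space" and W k
  assumes W: "open W" and g: "Ck_on (Suc k) W g" and pos: "\<forall>z\<in>W. det (gram g z) > 0"
begin

lemma Ck_on_gram: "Ck_on k W (\<lambda>z. gram g z $ i $ j)"
  unfolding gram_def vec_lambda_beta by (intro Ck_on_inner W Ck_on_dd g)

lemma Ck_on_gvol: "Ck_on k W (gvol g)"
  unfolding gvol_def[abs_def] using pos
  by (intro Ck_on_compose[OF W Ck_on_det[OF W Ck_on_gram] Ck_on_sqrt]) auto

lemma Ck_on_inv_gram: "Ck_on k W (\<lambda>z. matrix_inv (gram g z) $ i $ j)"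
  by (intro Ck_on_matrix_inv W Ck_on_gram) (use pos in force)

lemma Ck_on_lag: "Ck_on k W (lag g)"
  unfolding lag_def[abs_def] divide_inverse by (intro Ck_on_mult Ck_on_diff Ck_on_inner Ck_on_const Ck_on_dd g W)

lemma Ck_on_mom: "Ck_on k W (mom g)"
  unfolding mom_def[abs_def] by (intro Ck_on_scaleR Ck_on_gvol Ck_on_dd g W)

lemma Ck_on_flux: "Ck_on k W (flux g j)"
  unfolding flux_def[abs_def] by (intro Ck_on_sum Ck_on_scaleR Ck_on_mult Ck_on_gvol Ck_on_inv_gram Ck_on_dd g W)

end

lemma gram_sym: "gram g z $ i $ j = gram g z $ j $ i"
  by (simp add: gram_def inner_commute)

lemma inv_gram_sym:
  assumes "det (gram g z) > 0"
  shows "matrix_inv (gram g z) $ i $ j = matrix_inv (gram g z) $ j $ i"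
  by (rule matrix_inv_sym[OF _ gram_sym]) (use assms in simp)

text \<open>Jacobi's formula along the line z + s u. Differentiating the Gram matrix yields two
  mirror terms with equal contributions, and this factor 2 cancels the 1/2 from the square
  root.\<close>

lemma dd_gvol:
  fixes g :: "real \<times> (real^'n::finite) \<Rightarrow> 'v::euclidean_space"
  assumes W: "open W" "z \<in> W" and g: "Ck_on (Suc (Suc 0)) W g" and pos: "\<forall>z\<in>W. det (gram g z) > 0"
  shows "dd u (gvol g) z = gvol g z *
    (\<Sum>i\<in>UNIV. \<Sum>j\<in>UNIV. matrix_inv (gram g z) $ i $ j * (sd i g z \<bullet> dd u (sd j g) z))"
proof (rule dd_curve)
  let ?I = "matrix_inv (gram g z)"
  show "gvol g differentiable (at z)"
    by (rule Ck_on_differentiable[OF Ck_on_gvol[OF W(1) g pos] W(2)])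
  have diff: "sd i g differentiable (at z)" for i
    by (rule Ck_on_differentiable[OF Ck_on_dd[OF g] W(2)])
  define A' where "A' = (\<chi> i j. sd i g z \<bullet> dd u (sd j g) z + dd u (sd i g) z \<bullet> sd j g z)"
  have "((\<lambda>s. gram g (z + s *\<^sub>R u) $ i $ j) has_real_derivative A' $ i $ j) (at 0)" for i j
  proof -
    have "((\<lambda>s. z + s *\<^sub>R u) has_vector_derivative u) (at 0)"
      by (auto intro!: derivative_eq_intros)
    then have "((\<lambda>s. sd i g (z + s *\<^sub>R u)) has_vector_derivative dd u (sd i g) (z + 0 *\<^sub>R u)) (at 0)" for i
      by (rule has_vector_derivative_dd_compose) (use diff in simp)
    then have d: "((\<lambda>s. sd i g (z + s *\<^sub>R u)) has_vector_derivative dd u (sd i g) z) (at 0)" for i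
      by simp
    have "((\<lambda>s. sd i g (z + s *\<^sub>R u) \<bullet> sd j g (z + s *\<^sub>R u)) has_vector_derivative
        sd i g (z + 0 *\<^sub>R u) \<bullet> dd u (sd j g) z + dd u (sd i g) z \<bullet> sd j g (z + 0 *\<^sub>R u)) (at 0)"
      by (rule bounded_bilinear.has_vector_derivative[OF bounded_bilinear_inner d d])
    then show ?thesis
      by (simp add: gram_def A'_def has_real_derivative_iff_has_vector_derivative)
  qed
  then have "((\<lambda>s. det (gram g (z + s *\<^sub>R u))) has_real_derivative
      det (gram g (z + 0 *\<^sub>R u)) * (\<Sum>i\<in>UNIV. \<Sum>j\<in>UNIV. matrix_inv (gram g (z + 0 *\<^sub>R u)) $ i $ j * A' $ j $ i)) (at 0)"
    by (rule has_real_derivative_det) (use bspec[OF pos W(2)] in simp)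
  then have "((\<lambda>s. det (gram g (z + s *\<^sub>R u))) has_real_derivative
      det (gram g z) * (\<Sum>i\<in>UNIV. \<Sum>j\<in>UNIV. ?I $ i $ j * A' $ j $ i)) (at 0)"
    by simp
  also have "(\<Sum>i\<in>UNIV. \<Sum>j\<in>UNIV. ?I $ i $ j * A' $ j $ i) = 2 * (\<Sum>i\<in>UNIV. \<Sum>j\<in>UNIV. ?I $ i $ j * (sd i g z \<bullet> dd u (sd j g) z))"
  proof -
    have "(\<Sum>i\<in>UNIV. \<Sum>j\<in>UNIV. ?I $ i $ j * (sd j g z \<bullet> dd u (sd i g) z)) =
        (\<Sum>i\<in>UNIV. \<Sum>j\<in>UNIV. ?I $ i $ j * (sd i g z \<bullet> dd u (sd j g) z))"
    proof (subst sum.swap, intro sum.cong refl)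
      fix i j
      show "?I $ j $ i * (sd i g z \<bullet> dd u (sd j g) z) = ?I $ i $ j * (sd i g z \<bullet> dd u (sd j g) z)"
        using inv_gram_sym[OF bspec[OF pos W(2)], of j i] by simp
    qed
    then show ?thesis
      by (simp add: A'_def distrib_left sum.distrib inner_commute)
  qed
  finally have D: "((\<lambda>s. det (gram g (z + s *\<^sub>R u))) has_real_derivative
      det (gram g z) * (2 * (\<Sum>i\<in>UNIV. \<Sum>j\<in>UNIV. ?I $ i $ j * (sd i g z \<bullet> dd u (sd j g) z)))) (at 0)" .
  have "((\<lambda>s. gvol g (z + s *\<^sub>R u)) has_real_derivative
      gvol g z * (\<Sum>i\<in>UNIV. \<Sum>j\<in>UNIV. ?I $ i $ j * (sd i g z \<bullet> dd u (sd j g) z))) (at 0)"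
  proof -
    have "((\<lambda>s. sqrt (det (gram g (z + s *\<^sub>R u)))) has_real_derivative
        (inverse (sqrt (det (gram g (z + 0 *\<^sub>R u)))) / 2) *
        (det (gram g z) * (2 * (\<Sum>i\<in>UNIV. \<Sum>j\<in>UNIV. ?I $ i $ j * (sd i g z \<bullet> dd u (sd j g) z))))) (at 0)"
      by (rule DERIV_chain2[OF DERIV_real_sqrt D]) (use bspec[OF pos W(2)] in simp)
    moreover have "inverse (sqrt (det (gram g z))) * det (gram g z) = sqrt (det (gram g z))"
      using bspec[OF pos W(2)] by (simp add: field_simps)
    ultimately show ?thesis
      unfolding gvol_def by (simp add: mult.assoc[symmetric])
  qed
  then show "((\<lambda>s. gvol g (z + s *\<^sub>R u)) has_vector_derivative
      gvol g z * (\<Sum>i\<in>UNIV. \<Sum>j\<in>UNIV. ?I $ i $ j * (sd i g z \<bullet> dd u (sd j g) z))) (at 0)"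
    by (simp only: has_real_derivative_iff_has_vector_derivative)
qed

text \<open>The third conclusion is the Euler-Lagrange equation with both sides expanded and the
  positive density cancelled. The normal N is a function of space alone, at the fixed time
  t.\<close>

lemma euler_lagrange_imp_equation:
  fixes g :: "real \<times> (real^'n::finite) \<Rightarrow> real^'k" and N :: "real^'n \<Rightarrow> real^'k"
  assumes codim: "CARD('k) = CARD('n) + 1"
    and W: "open W" "(t, x) \<in> W" and g: "Ck_on (Suc (Suc 0)) W g"
    and pos: "\<forall>z\<in>W. det (gram g z) > 0"
    and N: "N differentiable (at x)" "N x \<bullet> N x = 1"
    and N_normal: "\<And>y i. (t, y) \<in> W \<Longrightarrow> N y \<bullet> sd i g (t, y) = 0"
    and EL: "euler_lagrange g (t, x)"
  defines "\<nu> \<equiv> N x" and "z \<equiv> (t, x)" and "I \<equiv> matrix_inv (gram g (t, x))"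
  defines "H \<equiv> \<Sum>i\<in>UNIV. \<Sum>j\<in>UNIV. I $ i $ j * (sd i (sd j g) z \<bullet> \<nu>)"
  shows "hypersurface_frame (\<lambda>i. sd i g z) \<nu> (gram g z)"
    and "sd i (sd j g) z \<bullet> \<nu> = - (sd j g z \<bullet> dd (axis i 1) N x)"
    and "(\<Sum>i\<in>UNIV. \<Sum>j\<in>UNIV. I $ i $ j * (sd i g z \<bullet> sd j (vel g) z)) *\<^sub>R vel g z + vel (vel g) z =
      (((real CARD('n) - vel g z \<bullet> vel g z) / 2) * H) *\<^sub>R \<nu>
      - (\<Sum>k\<in>UNIV. (\<Sum>l\<in>UNIV. I $ k $ l * (vel g z \<bullet> sd l (vel g) z)) *\<^sub>R sd k g z)"
proof -
  have zW: "z \<in> W"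
    using W by (simp add: z_def)
  have sym: "dd u (dd v g) z = dd v (dd u g) z" for u v
    by (rule dd_symmetric[OF W(1) zW]) (use g in \<open>simp only: numeral_2_eq_2\<close>)
  show frame: "hypersurface_frame (\<lambda>i. sd i g z) \<nu> (gram g z)"
  proof
    show "\<nu> \<bullet> sd i g z = 0" for i
      unfolding \<nu>_def z_def by (rule N_normal[OF W(2)])
  qed (use codim pos zW N(2) in \<open>simp_all add: gram_def \<nu>_def\<close>)
  interpret hypersurface_frame "\<lambda>i. sd i g z" \<nu> "gram g z"
    by (rule frame)
  have I_eq: "I = matrix_inv (gram g z)"
    by (simp add: I_def z_def)
  have vol: "gvol g z > 0"
    using bspec[OF pos zW] by (simp add: gvol_def)
  have diff: "gvol g differentiable (at z)" "lag g differentiable (at z)" "flux g j differentiable (at z)"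
    "dd u g differentiable (at z)" for j u
    using Ck_on_differentiable[OF Ck_on_gvol[OF W(1) g pos] zW] Ck_on_differentiable[OF Ck_on_lag[OF W(1) g pos] zW]
      Ck_on_differentiable[OF Ck_on_flux[OF W(1) g pos] zW] Ck_on_differentiable[OF Ck_on_dd[OF g] zW]
    by blast+
  \<comment> \<open>The slice of W at time t: orthogonality to N is available only there, and only
    spatial derivatives of it are taken.\<close>
  obtain X where X: "open X" "x \<in> X" "\<And>y. y \<in> X \<Longrightarrow> (t, y) \<in> W"
  proof
    show "open ((\<lambda>y. (t, y)) -` W)"
      using W(1) by (intro open_vimage continuous_intros)
  qed (use W in auto)
  have const: "dd u f z' = 0" if "open Y" "z' \<in> Y" "\<And>y. y \<in> Y \<Longrightarrow> f y = 0" for u and f :: "real^'n \<Rightarrow> real" and Y z'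
  proof -
    have "dd u f z' = dd u (\<lambda>y. 0) z'"
      by (rule dd_open_cong[OF that(1,2)]) (rule that(3))
    then show ?thesis
      by (simp add: frechet_derivative_const)
  qed
  have Nd: "\<nu> \<bullet> dd (0, u) f z + dd u N x \<bullet> f z = 0"
    if "f differentiable (at z)" "\<And>y. y \<in> X \<Longrightarrow> N y \<bullet> f (t, y) = 0" for f u
  proof -
    note s = dd_slice[of f t x, OF that(1)[unfolded z_def]]
    have "dd u (\<lambda>y. N y \<bullet> f (t, y)) x = 0"
      using that(2) by (rule const[OF X(1,2)])
    then show ?thesis
      unfolding dd_inner[OF N(1) s(2)] s(1) \<nu>_def z_def .
  qed
  have b\<nu>: "sd i (sd j g) z \<bullet> \<nu> = - (sd j g z \<bullet> dd (axis i 1) N x)" for i j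
    using Nd[of "sd j g" "axis i 1"] diff(4) N_normal X(3) by (simp add: inner_commute)
  show "sd i (sd j g) z \<bullet> \<nu> = - (sd j g z \<bullet> dd (axis i 1) N x)"
    by (rule b\<nu>)
  \<comment> \<open>Rather than expanding the derivatives of density and inverse metric, D is found
    from its components: normal first, then along each F_l.\<close>
  define D where "D = (\<Sum>j\<in>UNIV. sd j (flux g j) z)"
  have D: "D = (gvol g z * H) *\<^sub>R \<nu>"
  proof -
    have "\<nu> \<bullet> D = gvol g z * H"
    proof -
      have "N y \<bullet> flux g j (t, y) = 0" if "y \<in> X" for y j
        unfolding flux_def by (simp add: inner_sum_right N_normal X(3) that)
      then have "\<nu> \<bullet> sd j (flux g j) z = - (dd (axis j 1) N x \<bullet> flux g j z)" for j
        using Nd[of "flux g j" "axis j 1"] diff(3) by (simp add: add_eq_0_iff)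
      also have "- (dd (axis j 1) N x \<bullet> flux g j z) = (\<Sum>i\<in>UNIV. gvol g z * (I $ i $ j * (sd i (sd j g) z \<bullet> \<nu>)))" for j
      proof -
        have h: "sd i (sd j g) z \<bullet> \<nu> = - (dd (axis j 1) N x \<bullet> sd i g z)" for i
          using b\<nu>[where i = j and j = i] sym[of "(0, axis j 1)" "(0, axis i 1)"] by (simp add: inner_commute)
        show ?thesis
          unfolding flux_def I_eq inner_sum_right inner_scaleR_right sum_negf[symmetric] h
          by (intro sum.cong refl) simp
      qed
      finally have "\<nu> \<bullet> D = (\<Sum>j\<in>UNIV. \<Sum>i\<in>UNIV. gvol g z * (I $ i $ j * (sd i (sd j g) z \<bullet> \<nu>)))"
        by (simp add: D_def inner_sum_right)
      also have "\<dots> = gvol g z * H"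
        unfolding H_def sum_distrib_left by (rule sum.swap)
      finally show ?thesis .
    qed
    moreover have "D \<bullet> sd l g z = 0" for l
    proof -
      \<comment> \<open>The flux is w times the dual frame. Differentiating this relation gives
        \<partial>_l w minus \<open>flux g j \<bullet> sd j (sd l g)\<close> summed over j, and the
        two cancel by \<open>dd_gvol\<close>.\<close>
      have "flux g j z' \<bullet> sd l g z' = (if j = l then gvol g z' else 0)" if "z' \<in> W" for z' j
      proof -
        have "flux g j z' \<bullet> sd l g z' = gvol g z' * (\<Sum>i\<in>UNIV. matrix_inv (gram g z') $ j $ i * gram g z' $ i $ l)"
        proof -
          have "gvol g z' * matrix_inv (gram g z') $ i $ j * (sd i g z' \<bullet> sd l g z') =
              gvol g z' * (matrix_inv (gram g z') $ j $ i * gram g z' $ i $ l)" for i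
            using inv_gram_sym[OF bspec[OF pos that], of j i] by (simp add: gram_def)
          then show ?thesis
            unfolding flux_def inner_sum_left inner_scaleR_left sum_distrib_left by (simp only:)
        qed
        also have "(\<Sum>i\<in>UNIV. matrix_inv (gram g z') $ j $ i * gram g z' $ i $ l) = (matrix_inv (gram g z') ** gram g z') $ j $ l"
          by (simp add: matrix_matrix_mult_def)
        also have "\<dots> = (if j = l then 1 else 0)"
          using matrix_inv_mult(2)[of "gram g z'"] bspec[OF pos that] by (simp add: mat_def)
        finally show ?thesis by simp
      qed
      then have eq: "sd j (\<lambda>z. flux g j z \<bullet> sd l g z) z = sd j (\<lambda>z. if j = l then gvol g z else 0) z" for j
        by (intro dd_open_cong[OF W(1) zW])
      have "sd j (flux g j) z \<bullet> sd l g z = (if j = l then sd l (gvol g) z else 0) - flux g j z \<bullet> sd j (sd l g) z" for j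
      proof -
        have "flux g j z \<bullet> sd j (sd l g) z + sd j (flux g j) z \<bullet> sd l g z = sd j (\<lambda>z. flux g j z \<bullet> sd l g z) z"
          by (rule dd_inner[OF diff(3,4), symmetric])
        also have "\<dots> = (if j = l then sd l (gvol g) z else 0)"
          unfolding eq by (simp add: frechet_derivative_const)
        finally show ?thesis
          by linarith
      qed
      then have "D \<bullet> sd l g z = sd l (gvol g) z - (\<Sum>j\<in>UNIV. flux g j z \<bullet> sd j (sd l g) z)"
        by (simp add: D_def inner_sum_left sum_subtractf)
      also have "(\<Sum>j\<in>UNIV. flux g j z \<bullet> sd j (sd l g) z) =
          (\<Sum>j\<in>UNIV. \<Sum>i\<in>UNIV. gvol g z * (I $ i $ j * (sd i g z \<bullet> sd l (sd j g) z)))"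
        unfolding flux_def I_eq inner_sum_left inner_scaleR_left
        using sym by (simp add: mult.assoc)
      also have "\<dots> = gvol g z * (\<Sum>i\<in>UNIV. \<Sum>j\<in>UNIV. I $ i $ j * (sd i g z \<bullet> sd l (sd j g) z))"
        unfolding sum_distrib_left by (rule sum.swap)
      also have "\<dots> = sd l (gvol g) z"
        unfolding I_eq by (rule dd_gvol[OF W(1) zW g pos, symmetric])
      finally show ?thesis
        by simp
    qed
    \<comment> \<open>The difference is orthogonal to \<nu> and to every tangent vector, hence
      zero.\<close>
    ultimately have "D - (gvol g z * H) *\<^sub>R \<nu> = 0"
      using normal by (intro orthogonal_frame_imp_0) (simp_all add: inner_diff_left inner_diff_right inner_commute[of D \<nu>] unit)
    then show ?thesis
      by simp
  qed
  have e1: "vel (mom g) z = gvol g z *\<^sub>R ((\<Sum>i\<in>UNIV. \<Sum>j\<in>UNIV. I $ i $ j * (sd i g z \<bullet> sd j (vel g) z)) *\<^sub>R vel g z + vel (vel g) z)"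
  proof -
    have "vel (mom g) z = gvol g z *\<^sub>R vel (vel g) z + vel (gvol g) z *\<^sub>R vel g z"
      unfolding mom_def[abs_def] by (rule dd_scaleR[OF diff(1,4)])
    also have "vel (gvol g) z = gvol g z * (\<Sum>i\<in>UNIV. \<Sum>j\<in>UNIV. I $ i $ j * (sd i g z \<bullet> sd j (vel g) z))"
      unfolding I_eq dd_gvol[OF W(1) zW g pos] by (simp only: sym[of "(1, 0)"])
    finally show ?thesis
      by (simp add: algebra_simps)
  qed
  have "sd j (lag g) z = - (vel g z \<bullet> sd j (vel g) z)" for j
  proof -
    note dv = has_derivative_frechet[OF diff(4)]
    have "(lag g has_derivative (\<lambda>u. (0 - (vel g z \<bullet> dd u (vel g) z + dd u (vel g) z \<bullet> vel g z)) / 2)) (at z)"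
      unfolding lag_def[abs_def]
      by (rule bounded_linear.has_derivative[OF bounded_linear_divide
            has_derivative_diff[OF has_derivative_const has_derivative_inner[OF dv dv]]])
    from dd_eq[OF this] show ?thesis
      by (simp add: inner_commute)
  qed
  then have "sd j (\<lambda>z. lag g z *\<^sub>R flux g j z) z = lag g z *\<^sub>R sd j (flux g j) z - (vel g z \<bullet> sd j (vel g) z) *\<^sub>R flux g j z" for j
    using dd_scaleR[OF diff(2,3), where v = "(0, axis j 1)"] by simp
  then have "(\<Sum>j\<in>UNIV. sd j (\<lambda>z. lag g z *\<^sub>R flux g j z) z) =
      lag g z *\<^sub>R D - (\<Sum>j\<in>UNIV. (vel g z \<bullet> sd j (vel g) z) *\<^sub>R flux g j z)"
    by (simp add: D_def sum_subtractf scaleR_sum_right)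
  also have "(\<Sum>j\<in>UNIV. (vel g z \<bullet> sd j (vel g) z) *\<^sub>R flux g j z) =
      gvol g z *\<^sub>R (\<Sum>k\<in>UNIV. (\<Sum>l\<in>UNIV. I $ k $ l * (vel g z \<bullet> sd l (vel g) z)) *\<^sub>R sd k g z)"
    unfolding flux_def I_eq scaleR_sum_right scaleR_sum_left sum_distrib_left
    by (subst sum.swap) (simp add: mult_ac)
  finally have e2: "(\<Sum>j\<in>UNIV. sd j (\<lambda>z. lag g z *\<^sub>R flux g j z) z) = gvol g z *\<^sub>R ((lag g z * H) *\<^sub>R \<nu>
      - (\<Sum>k\<in>UNIV. (\<Sum>l\<in>UNIV. I $ k $ l * (vel g z \<bullet> sd l (vel g) z)) *\<^sub>R sd k g z))"
    unfolding D by (simp add: scaleR_diff_right mult_ac)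
  show "(\<Sum>i\<in>UNIV. \<Sum>j\<in>UNIV. I $ i $ j * (sd i g z \<bullet> sd j (vel g) z)) *\<^sub>R vel g z + vel (vel g) z =
      (((real CARD('n) - vel g z \<bullet> vel g z) / 2) * H) *\<^sub>R \<nu>
      - (\<Sum>k\<in>UNIV. (\<Sum>l\<in>UNIV. I $ k $ l * (vel g z \<bullet> sd l (vel g) z)) *\<^sub>R sd k g z)"
  proof -
    note EL' = EL[unfolded euler_lagrange_def z_def[symmetric] e1 e2]
    show ?thesis
      using vol iffD1[OF scaleR_cancel_left EL'] by (simp add: lag_def)
  qed
qed

section \<open>Variations of integrals over a box\<close>

lemma integral_cbox_eq_lborel:
  fixes w :: "'a::euclidean_space \<Rightarrow> real"
  assumes "continuous_on UNIV w" "\<And>z. z \<notin> cbox a b \<Longrightarrow> w z = 0"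
  shows "integral (cbox a b) w = (\<integral>z. w z \<partial>lborel)"
proof -
  have "set_integrable lborel (cbox a b) w"
    unfolding set_integrable_def
    by (rule borel_integrable_compact[OF compact_cbox]) (rule continuous_on_subset[OF assms(1)], simp)
  then have "(LINT z:cbox a b|lborel. w z) = integral (cbox a b) w"
    by (rule set_borel_integral_eq_integral(2))
  moreover have "(LINT z:cbox a b|lborel. w z) = (\<integral>z. w z \<partial>lborel)"
    unfolding set_lebesgue_integral_def
    using assms(2) by (intro Bochner_Integration.integral_cong refl) (auto simp: indicator_def)
  ultimately show ?thesis
    by simp
qed

text \<open>The integral of \<open>w (z + h *\<^sub>R v)\<close> does not depend on \<open>h\<close>, by translation invariance.\<close>

lemma integral_dd_compact_support:
  fixes w :: "'a::euclidean_space \<Rightarrow> real"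
  assumes w: "Ck_on 1 UNIV w" and r: "r > 0" and box: "cball z0 (2 * r) \<subseteq> cbox a b"
    and supp: "\<And>z. z \<notin> cball z0 r \<Longrightarrow> w z = 0"
  shows "integral (cbox a b) (dd v w) = 0"
proof -
  have w1: "Ck_on (Suc 0) UNIV w"
    using w by simp
  have cont: "continuous_on UNIV w" "continuous_on UNIV (dd v w)"
    using Ck_on_continuous[OF w1] w1 by auto
  have diff: "w differentiable (at z)" for z
    by (rule Ck_on_differentiable[OF w1]) simp
  \<comment> \<open>For |h| up to this bound the shift h v has length at most r, so the translated
    support stays in \<open>cball z0 (2 * r)\<close> and thus in the box.\<close>
  define \<delta> where "\<delta> = r / (norm v + 1)"
  have nv: "norm v + 1 > 0"
    using norm_ge_zero[of v] by linarith
  then have "\<delta> > 0"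
    using r by (simp add: \<delta>_def)
  have small: "norm (h *\<^sub>R v) \<le> r" if "\<bar>h\<bar> \<le> \<delta>" for h
  proof -
    have "\<bar>h\<bar> * norm v \<le> \<delta> * (norm v + 1)"
      using that \<open>\<delta> > 0\<close> by (intro mult_mono) auto
    also have "\<dots> = r"
      using nv by (simp add: \<delta>_def)
    finally show ?thesis
      by simp
  qed
  have const: "integral (cbox a b) (\<lambda>z. w (z + h *\<^sub>R v)) = integral (cbox a b) w" if h: "\<bar>h\<bar> \<le> \<delta>" for h
  proof -
    have "w (z + h *\<^sub>R v) = 0" if z: "z \<notin> cbox a b" for z
    proof (rule supp)
      have "z \<notin> cball z0 (2 * r)"
        using z box by blast
      then have "2 * r < dist z0 z"
        by simp
      also have "\<dots> \<le> dist z0 (z + h *\<^sub>R v) + norm (h *\<^sub>R v)"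
        using dist_triangle[of z0 z "z + h *\<^sub>R v"] by (simp add: dist_norm)
      finally show "z + h *\<^sub>R v \<notin> cball z0 r"
        using small[OF h] by simp
    qed
    moreover have "continuous_on UNIV (\<lambda>z. w (z + h *\<^sub>R v))"
      by (rule continuous_on_compose2[OF cont(1)]) (auto intro!: continuous_intros)
    ultimately have "integral (cbox a b) (\<lambda>z. w (z + h *\<^sub>R v)) = (\<integral>z. w (h *\<^sub>R v + z) \<partial>lborel)"
      by (subst integral_cbox_eq_lborel) (simp_all add: add.commute)
    also have "\<dots> = (\<integral>z. w z \<partial>distr lborel borel ((+) (h *\<^sub>R v)))"
      by (rule integral_distr[symmetric]) (auto intro!: borel_measurable_continuous_onI cont)
    also have "\<dots> = (\<integral>z. w z \<partial>lborel)"
      by (simp only: lborel_distr_plus)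
    also have "\<dots> = integral (cbox a b) w"
    proof (rule integral_cbox_eq_lborel[OF cont(1), symmetric])
      fix z assume "z \<notin> cbox a b"
      then have "z \<notin> cball z0 (2 * r)"
        using box by blast
      then show "w z = 0"
        using r by (intro supp) auto
    qed
    finally show ?thesis .
  qed
  let ?\<psi> = "\<lambda>h. integral (cbox a b) (\<lambda>z. w (z + h *\<^sub>R v))"
  have "(?\<psi> has_real_derivative integral (cbox a b) (\<lambda>z. dd v w (z + 0 *\<^sub>R v))) (at 0 within UNIV)"
  proof (rule leibniz_rule_field_derivative)
    show "((\<lambda>h. w (z + h *\<^sub>R v)) has_real_derivative dd v w (z + h *\<^sub>R v)) (at h within UNIV)" for h z
    proof -
      have "((\<lambda>h. z + h *\<^sub>R v) has_vector_derivative v) (at h)"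
        by (auto intro!: derivative_eq_intros)
      then show ?thesis
        unfolding has_real_derivative_iff_has_vector_derivative
        by (rule has_vector_derivative_dd_compose) (rule diff)
    qed
    show "(\<lambda>z. w (z + h *\<^sub>R v)) integrable_on cbox a b" for h
      by (rule integrable_continuous)
        (rule continuous_on_compose2[OF cont(1)], auto intro!: continuous_intros)
    show "continuous_on (UNIV \<times> cbox a b) (\<lambda>(h, z). dd v w (z + h *\<^sub>R v))"
      unfolding split_beta
      by (rule continuous_on_compose2[OF cont(2)]) (auto intro!: continuous_intros)
  qed auto
  moreover have "(?\<psi> has_real_derivative 0) (at 0)"
  proof -
    have "((\<lambda>h. integral (cbox a b) w) has_real_derivative 0) (at 0)"
      by simp
    then show ?thesis
      by (rule has_field_derivative_transform_within[where d = \<delta>])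
        (use \<open>\<delta> > 0\<close> const in \<open>auto simp: dist_real_def\<close>)
  qed
  ultimately have "integral (cbox a b) (\<lambda>z. dd v w (z + 0 *\<^sub>R v)) = 0"
    by (rule DERIV_unique)
  then show ?thesis
    by simp
qed

text \<open>P is regular only on Q, but its product with \<phi> is C^1 everywhere: on Q as a
  product, and off the ball because it vanishes there. The integral of the derivative of this
  product is zero.\<close>

lemma integral_by_parts_bump:
  fixes \<phi> P :: "'a::euclidean_space \<Rightarrow> real"
  assumes \<phi>: "Ck_on 1 UNIV \<phi>" and P: "Ck_on 1 Q P" and Q: "open Q" "cbox a b \<subseteq> Q"
    and r: "r > 0" and box: "cball z0 (2 * r) \<subseteq> cbox a b"
    and supp: "\<And>z. z \<notin> cball z0 r \<Longrightarrow> \<phi> z = 0"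
  shows "integral (cbox a b) (\<lambda>z. dd v \<phi> z * P z) = - integral (cbox a b) (\<lambda>z. \<phi> z * dd v P z)"
proof -
  have \<phi>1: "Ck_on (Suc 0) UNIV \<phi>" and P1: "Ck_on (Suc 0) Q P"
    using \<phi> P by simp_all
  let ?w = "\<lambda>z. \<phi> z * P z"
  have far: "open (- cball z0 r)"
    by (rule open_Compl[OF closed_cball])
  have sub: "cball z0 r \<subseteq> Q"
  proof -
    have "cball z0 r \<subseteq> cball z0 (2 * r)"
      using r by (intro subset_cball) simp
    then show ?thesis
      using box Q(2) by blast
  qed
  have "Ck_on 1 UNIV ?w"
  proof (rule Ck_on_local)
    fix z
    show "\<exists>W. open W \<and> z \<in> W \<and> Ck_on 1 W ?w"
    proof (cases "z \<in> Q")
      case True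
      have "Ck_on 1 Q ?w"
        by (intro Ck_on_mult Q P Ck_on_subset[OF \<phi>]) simp
      then show ?thesis
        using True Q by (intro exI[of _ Q] conjI)
    next
      case False
      have "Ck_on 1 (- cball z0 r) ?w"
        by (rule Ck_on_cong[OF far _ Ck_on_const[of _ _ 0]]) (simp add: supp)
      moreover have "z \<in> - cball z0 r"
        using False sub by blast
      ultimately show ?thesis
        using far by (intro exI[of _ "- cball z0 r"] conjI)
    qed
  qed
  then have "integral (cbox a b) (dd v ?w) = 0"
    by (rule integral_dd_compact_support[OF _ r box]) (simp add: supp)
  moreover have "dd v ?w z = \<phi> z * dd v P z + dd v \<phi> z * P z" if "z \<in> cbox a b" for z
  proof (rule dd_eq)
    have "z \<in> Q"
      using that Q by blast
    then show "(?w has_derivative (\<lambda>v. \<phi> z * dd v P z + dd v \<phi> z * P z)) (at z)"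
      by (intro has_derivative_mult has_derivative_frechet Ck_on_differentiable[OF \<phi>1] Ck_on_differentiable[OF P1]) auto
  qed
  ultimately have "integral (cbox a b) (\<lambda>z. \<phi> z * dd v P z + dd v \<phi> z * P z) = 0"
    using integral_cong[of "cbox a b" "dd v ?w" "\<lambda>z. \<phi> z * dd v P z + dd v \<phi> z * P z"] by simp
  moreover have "(\<lambda>z. \<phi> z * dd v P z) integrable_on cbox a b" "(\<lambda>z. dd v \<phi> z * P z) integrable_on cbox a b"
    by (intro integrable_continuous continuous_on_mult continuous_on_subset[OF Ck_on_continuous[OF \<phi>1]]
        continuous_on_subset[OF Ck_on_continuous[OF Ck_on_dd[OF \<phi>1]]]
        continuous_on_subset[OF Ck_on_continuous[OF P1] Q(2)] continuous_on_subset[OF Ck_on_continuous[OF Ck_on_dd[OF P1]] Q(2)] subset_UNIV)+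
  ultimately show ?thesis
    by (simp add: integral_add)
qed

text \<open>The fundamental lemma of the calculus of variations. If the divergence were nonzero at
  z0, it would keep its sign on a small box; integration by parts against a bump there gives a
  continuous integrand of one sign with vanishing integral, nonzero at z0.\<close>

lemma weak_divergence_imp_strong:
  fixes P :: "'i \<Rightarrow> 'a::euclidean_space \<Rightarrow> real" and d :: "'i \<Rightarrow> 'a"
  assumes I: "finite I" and Q: "open Q" "z0 \<in> Q" and P: "\<And>i. i \<in> I \<Longrightarrow> Ck_on 1 Q (P i)"
    and weak: "\<And>\<phi> r a b. (\<And>k. Ck_on k UNIV \<phi>) \<Longrightarrow> r > 0 \<Longrightarrow> cball z0 (2 * r) \<subseteq> cbox a b \<Longrightarrow> cbox a b \<subseteq> Q \<Longrightarrow>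
      (\<And>z. z \<notin> cball z0 r \<Longrightarrow> \<phi> z = 0) \<Longrightarrow> integral (cbox a b) (\<lambda>z. \<Sum>i\<in>I. dd (d i) \<phi> z * P i z) = 0"
  shows "(\<Sum>i\<in>I. dd (d i) (P i) z0) = 0"
proof (rule ccontr)
  let ?E = "\<lambda>z. \<Sum>i\<in>I. dd (d i) (P i) z"
  assume "?E z0 \<noteq> 0"
  have P1: "Ck_on (Suc 0) Q (P i)" if "i \<in> I" for i
    using P[OF that] by simp
  have contE: "continuous_on Q ?E"
    by (intro continuous_on_sum Ck_on_continuous[OF Ck_on_dd[OF P1]])
  \<comment> \<open>Multiplying by the sign treats both signs of the divergence at once.\<close>
  define s where "s = sgn (?E z0)"
  have cont: "continuous_on Q (\<lambda>z. s * ?E z)"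
    by (intro continuous_on_mult continuous_on_const contE)
  have op: "open (Q \<inter> (\<lambda>z. s * ?E z) -` {0<..})"
    by (rule continuous_open_preimage[OF cont Q(1)]) simp
  have spos: "s * ?E z0 > 0"
    using \<open>?E z0 \<noteq> 0\<close> by (simp add: s_def sgn_real_def)
  then have "z0 \<in> Q \<inter> (\<lambda>z. s * ?E z) -` {0<..}"
    using Q(2) by simp
  from open_contains_cbox[OF op this] obtain a b
    where ab: "cbox a b \<subseteq> Q \<inter> (\<lambda>z. s * ?E z) -` {0<..}" "z0 \<in> box a b" .
  obtain R where R: "R > 0" "cball z0 R \<subseteq> box a b"
    using open_contains_cball[of "box a b"] ab(2) open_box by blast
  define r where "r = R / 2"
  have r: "r > 0" "cball z0 (2 * r) \<subseteq> cbox a b"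
    using R box_subset_cbox[of a b] by (auto simp: r_def)
  obtain \<phi> :: "'a \<Rightarrow> real" where \<phi>: "\<And>k. Ck_on k UNIV \<phi>" "\<And>z. \<phi> z \<ge> 0" "\<phi> z0 > 0"
    "\<And>z. z \<notin> cball z0 r \<Longrightarrow> \<phi> z = 0"
    using smooth_bump_exists[OF r(1), of z0] by blast
  have abQ: "cbox a b \<subseteq> Q"
    using ab by blast
  have \<phi>1: "Ck_on (Suc 0) UNIV \<phi>"
    by (rule \<phi>(1))
  have int: "(\<lambda>z. dd (d i) \<phi> z * P i z) integrable_on cbox a b" "(\<lambda>z. \<phi> z * dd (d i) (P i) z) integrable_on cbox a b"
    if "i \<in> I" for i
    by (intro integrable_continuous continuous_on_mult continuous_on_subset[OF Ck_on_continuous[OF \<phi>(1)]]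
        continuous_on_subset[OF Ck_on_continuous[OF Ck_on_dd[OF \<phi>1]]]
        continuous_on_subset[OF Ck_on_continuous[OF P1[OF that]] abQ]
        continuous_on_subset[OF Ck_on_continuous[OF Ck_on_dd[OF P1[OF that]]] abQ] subset_UNIV)+
  have "0 = integral (cbox a b) (\<lambda>z. \<Sum>i\<in>I. dd (d i) \<phi> z * P i z)"
    by (rule weak[OF \<phi>(1) r abQ \<phi>(4), symmetric])
  also have "\<dots> = (\<Sum>i\<in>I. integral (cbox a b) (\<lambda>z. dd (d i) \<phi> z * P i z))"
    using I int(1) by (rule integral_sum)
  also have "\<dots> = (\<Sum>i\<in>I. - integral (cbox a b) (\<lambda>z. \<phi> z * dd (d i) (P i) z))"
    by (intro sum.cong refl integral_by_parts_bump[OF \<phi>(1) P Q(1) abQ r \<phi>(4)])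
  also have "\<dots> = - integral (cbox a b) (\<lambda>z. \<Sum>i\<in>I. \<phi> z * dd (d i) (P i) z)"
    unfolding sum_negf using I int(2) by (subst integral_sum) auto
  also have "(\<lambda>z. \<Sum>i\<in>I. \<phi> z * dd (d i) (P i) z) = (\<lambda>z. \<phi> z * ?E z)"
    by (simp add: sum_distrib_left)
  finally have "integral (cbox a b) (\<lambda>z. \<phi> z * ?E z) = 0"
    by simp
  then have "integral (cbox a b) (\<lambda>z. s * (\<phi> z * ?E z)) = 0"
    by simp
  moreover have "continuous_on (cbox a b) (\<lambda>z. s * (\<phi> z * ?E z))"
    by (intro continuous_on_mult continuous_on_const continuous_on_subset[OF contE abQ]
        continuous_on_subset[OF Ck_on_continuous[OF \<phi>(1)]] subset_UNIV)
  moreover have "s * (\<phi> z * ?E z) \<ge> 0" if "z \<in> cbox a b" for z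
  proof -
    have "s * ?E z > 0"
      using that ab(1) by auto
    from mult_nonneg_nonneg[OF \<phi>(2) less_imp_le[OF this]] show ?thesis
      by (simp only: mult.left_commute)
  qed
  ultimately have "\<forall>z\<in>cbox a b. s * (\<phi> z * ?E z) = 0"
    using integral_cbox_eq_0_iff[of a b "\<lambda>z. s * (\<phi> z * ?E z)"] ab(2) by blast
  moreover have "z0 \<in> cbox a b"
    using ab(2) box_subset_cbox by blast
  ultimately have "s * (\<phi> z0 * ?E z0) = 0"
    by blast
  then show False
    using spos \<phi>(3) by auto
qed

lemma continuous_on_det:
  fixes A :: "'a::topological_space \<Rightarrow> real^'n::finite^'n"
  assumes "\<And>i j. continuous_on S (\<lambda>x. A x $ i $ j)"
  shows "continuous_on S (\<lambda>x. det (A x))"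
  unfolding det_def by (intro continuous_intros assms)

text \<open>Counterpart of \<open>Ck_on_matrix_inv\<close> for domains that are not open, such as a
  closed interval of s times a closed box.\<close>

lemma continuous_on_matrix_inv:
  fixes A :: "'a::topological_space \<Rightarrow> real^'n::finite^'n"
  assumes "\<And>i j. continuous_on S (\<lambda>x. A x $ i $ j)" "\<And>x. x \<in> S \<Longrightarrow> det (A x) \<noteq> 0"
  shows "continuous_on S (\<lambda>x. matrix_inv (A x) $ i $ j)"
proof (rule continuous_on_eq)
  show "det (\<chi> a b. if b = i then (if a = j then 1 else 0) else A x $ a $ b) / det (A x) =
      matrix_inv (A x) $ i $ j" if "x \<in> S" for x
    by (rule matrix_inv_cramer[OF assms(2)[OF that], symmetric])
  have "continuous_on S (\<lambda>x. (\<chi> a b. if b = i then (if a = j then 1 else 0) else A x $ a $ b) $ c $ d)" for c d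
    by (cases "d = i"; cases "c = j") (simp_all add: assms(1))
  then show "continuous_on S (\<lambda>x. det (\<chi> a b. if b = i then (if a = j then 1 else 0) else A x $ a $ b) / det (A x))"
    by (intro continuous_on_divide continuous_on_det assms ballI)
qed

text \<open>With a i and V the derivatives of F in a chart, a variation \<phi> e changes them by s p
  i e and s q e, where p i and q are the derivatives of \<phi>. The integral is differentiated under
  the sign; Jacobi's formula supplies the change of the density, whose two mirror terms cancel the
  1/2 from the square root.\<close>

lemma first_variation_integral:
  fixes a :: "'n::finite \<Rightarrow> 'a::euclidean_space \<Rightarrow> 'v::euclidean_space" and V :: "'a \<Rightarrow> 'v" and e :: 'v
    and p :: "'n \<Rightarrow> 'a \<Rightarrow> real" and q :: "'a \<Rightarrow> real"
    and c :: real
  defines "A \<equiv> \<lambda>s z i. a i z + (s * p i z) *\<^sub>R e"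
  defines "G \<equiv> \<lambda>s z. \<chi> i j. A s z i \<bullet> A s z j"
    and "L \<equiv> \<lambda>s z. (c - (V z + (s * q z) *\<^sub>R e) \<bullet> (V z + (s * q z) *\<^sub>R e)) / 2"
  assumes cont: "\<And>i. continuous_on (cbox lo hi) (a i)" "continuous_on (cbox lo hi) V"
      "\<And>i. continuous_on (cbox lo hi) (p i)" "continuous_on (cbox lo hi) q"
    and pos: "\<And>z. z \<in> cbox lo hi \<Longrightarrow> det (G 0 z) > 0"
  shows "((\<lambda>s. integral (cbox lo hi) (\<lambda>z. L s z * sqrt (det (G s z)))) has_real_derivative
    integral (cbox lo hi) (\<lambda>z. - (V z \<bullet> e) * q z * sqrt (det (G 0 z)) +
      L 0 z * sqrt (det (G 0 z)) * (\<Sum>i\<in>UNIV. \<Sum>j\<in>UNIV. matrix_inv (G 0 z) $ i $ j * (a i z \<bullet> e) * p j z))) (at 0)"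
proof -
  let ?D = "cbox lo hi"
  have cA: "continuous_on (X \<times> ?D) (\<lambda>y. A (fst y) (snd y) i)" for i and X :: "real set"
    unfolding A_def
    by (intro continuous_intros continuous_on_compose2[OF cont(1) continuous_on_snd]
        continuous_on_compose2[OF cont(3) continuous_on_snd]) auto
  have cG: "continuous_on (X \<times> ?D) (\<lambda>y. G (fst y) (snd y) $ i $ j)" for i j and X :: "real set"
    unfolding G_def vec_lambda_beta by (intro continuous_on_inner cA)
  have cV: "continuous_on (X \<times> ?D) (\<lambda>y. V (snd y))" and cq: "continuous_on (X \<times> ?D) (\<lambda>y. q (snd y))"
    and cp: "continuous_on (X \<times> ?D) (\<lambda>y. p i (snd y))" for X :: "real set" and i
    by (intro continuous_on_compose2[OF cont(2) continuous_on_snd] continuous_on_compose2[OF cont(4) continuous_on_snd]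
        continuous_on_compose2[OF cont(3) continuous_on_snd] continuous_on_id; force)+
  \<comment> \<open>The pairs (s, z) with |s| at most 1 and nonpositive Gram determinant form a
    compact set. Its projection to s is closed and misses 0, which yields a bound uniform in
    z.\<close>
  obtain \<delta> where \<delta>: "\<delta> > 0" "\<And>s z. \<bar>s\<bar> \<le> \<delta> \<Longrightarrow> z \<in> ?D \<Longrightarrow> det (G s z) > 0"
  proof -
    let ?X = "({-1..1} \<times> ?D) \<inter> (\<lambda>y. det (G (fst y) (snd y))) -` {..0}"
    have "closedin (top_of_set ({-1..1} \<times> ?D)) (({-1..1} \<times> ?D) \<inter> (\<lambda>y. det (G (fst y) (snd y))) -` {..0})"
      by (intro continuous_closedin_preimage continuous_on_det cG) simp
    then have "compact ?X"
      by (rule closedin_compact[rotated]) (intro compact_Times compact_Icc compact_cbox)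
    then have "compact (fst ` ?X)"
      by (intro compact_continuous_image continuous_on_fst continuous_on_id)
    then have "closed (fst ` ?X)"
      by (rule compact_imp_closed)
    then have "open (- fst ` ?X)"
      by (rule open_Compl)
    moreover have "0 \<in> - fst ` ?X"
    proof
      assume "0 \<in> fst ` ?X"
      then obtain z where "z \<in> ?D" "det (G 0 z) \<le> 0"
        by auto
      then show False
        using pos[of z] by simp
    qed
    ultimately obtain \<delta> where d: "\<delta> > 0" "ball 0 \<delta> \<subseteq> - fst ` ?X"
      by (rule openE)
    show thesis
    proof (rule that[of "min (\<delta> / 2) 1"])
      fix s :: real and z assume s: "\<bar>s\<bar> \<le> min (\<delta> / 2) 1" and z: "z \<in> ?D"
      then have "s \<in> ball 0 \<delta>"
        using d(1) by simp
      then have "s \<notin> fst ` ?X"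
        using d(2) by blast
      moreover have "s \<in> fst ` ?X" if "(s, z) \<in> ?X"
        using imageI[OF that, of fst] by simp
      ultimately have "(s, z) \<notin> ?X"
        by blast
      then show "det (G s z) > 0"
        using s z by auto
    qed (use d(1) in simp)
  qed
  define G' where "G' s z = (\<chi> i j. A s z i \<bullet> (p j z *\<^sub>R e) + (p i z *\<^sub>R e) \<bullet> A s z j)" for s z
  define fx where "fx s z = (- ((V z + (s * q z) *\<^sub>R e) \<bullet> (q z *\<^sub>R e))) * sqrt (det (G s z)) +
      (sqrt (det (G s z)) / 2 * (\<Sum>i\<in>UNIV. \<Sum>j\<in>UNIV. matrix_inv (G s z) $ i $ j * G' s z $ j $ i)) * L s z" for s z
  let ?U = "{- \<delta>..\<delta>}"
  have dsqrt: "((\<lambda>s. sqrt (det (G s z))) has_real_derivative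
      sqrt (det (G s z)) / 2 * (\<Sum>i\<in>UNIV. \<Sum>j\<in>UNIV. matrix_inv (G s z) $ i $ j * G' s z $ j $ i)) (at s)"
    if s: "s \<in> ?U" and z: "z \<in> ?D" for s z
  proof -
    have dpos: "det (G s z) > 0"
      using \<delta>(2)[of s z] s z by auto
    have "((\<lambda>s. A s z i) has_vector_derivative p i z *\<^sub>R e) (at s)" for i
      unfolding A_def by (auto intro!: derivative_eq_intros)
    then have "((\<lambda>s. A s z i \<bullet> A s z j) has_vector_derivative A s z i \<bullet> (p j z *\<^sub>R e) + (p i z *\<^sub>R e) \<bullet> A s z j) (at s)" for i j
      by (intro bounded_bilinear.has_vector_derivative[OF bounded_bilinear_inner])
    then have "((\<lambda>s. G s z $ i $ j) has_real_derivative G' s z $ i $ j) (at s)" for i j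
      by (simp add: G_def G'_def has_real_derivative_iff_has_vector_derivative)
    then have "((\<lambda>s. det (G s z)) has_real_derivative
        det (G s z) * (\<Sum>i\<in>UNIV. \<Sum>j\<in>UNIV. matrix_inv (G s z) $ i $ j * G' s z $ j $ i)) (at s)"
      by (rule has_real_derivative_det) (use dpos in simp)
    from DERIV_chain2[OF DERIV_real_sqrt[OF dpos] this]
    have "((\<lambda>s. sqrt (det (G s z))) has_real_derivative inverse (sqrt (det (G s z))) / 2 *
        (det (G s z) * (\<Sum>i\<in>UNIV. \<Sum>j\<in>UNIV. matrix_inv (G s z) $ i $ j * G' s z $ j $ i))) (at s)" .
    moreover have "inverse (sqrt (det (G s z))) / 2 * (det (G s z) * x) = sqrt (det (G s z)) / 2 * x" for x
    proof -
      have "inverse (sqrt (det (G s z))) * det (G s z) = sqrt (det (G s z))"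
        using dpos by (simp add: field_simps)
      then show ?thesis
        by (simp add: mult.assoc[symmetric])
    qed
    ultimately show ?thesis
      by (simp only:)
  qed
  have "((\<lambda>s. integral ?D (\<lambda>z. L s z * sqrt (det (G s z)))) has_real_derivative integral ?D (fx 0)) (at 0 within ?U)"
  proof (rule leibniz_rule_field_derivative)
    fix s z assume s: "s \<in> ?U" and z: "z \<in> ?D"
    have "((\<lambda>s. V z + (s * q z) *\<^sub>R e) has_vector_derivative q z *\<^sub>R e) (at s)"
      by (auto intro!: derivative_eq_intros)
    note b = bounded_bilinear.has_vector_derivative[OF bounded_bilinear_inner this this]
    have "((\<lambda>s. L s z) has_real_derivative - ((V z + (s * q z) *\<^sub>R e) \<bullet> (q z *\<^sub>R e))) (at s)"
    proof -
      have "((\<lambda>s. (c - (V z + (s * q z) *\<^sub>R e) \<bullet> (V z + (s * q z) *\<^sub>R e)) / 2) has_real_derivative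
          (0 - ((V z + (s * q z) *\<^sub>R e) \<bullet> (q z *\<^sub>R e) + (q z *\<^sub>R e) \<bullet> (V z + (s * q z) *\<^sub>R e))) / 2) (at s)"
        using b unfolding has_real_derivative_iff_has_vector_derivative[symmetric]
        by (intro DERIV_cdivide DERIV_diff DERIV_const)
      then show ?thesis
        by (simp add: L_def inner_commute)
    qed
    from DERIV_mult[OF this dsqrt[OF s z]]
    show "((\<lambda>s. L s z * sqrt (det (G s z))) has_real_derivative fx s z) (at s within ?U)"
      unfolding fx_def by (rule has_field_derivative_at_within)
  next
    fix s assume s: "s \<in> ?U"
    have "continuous_on ?D (\<lambda>z. L s z * sqrt (det (G s z)))"
    proof (intro continuous_on_mult continuous_on_real_sqrt continuous_on_det)
      show "continuous_on ?D (\<lambda>z. G s z $ i $ j)" for i j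
        unfolding G_def A_def vec_lambda_beta by (intro continuous_intros cont)
      show "continuous_on ?D (L s)"
        unfolding L_def by (intro continuous_intros cont) simp_all
    qed
    then show "(\<lambda>z. L s z * sqrt (det (G s z))) integrable_on ?D"
      by (rule integrable_continuous)
  next
    have cdet: "continuous_on (?U \<times> ?D) (\<lambda>y. det (G (fst y) (snd y)))"
      by (intro continuous_on_det cG)
    have cinv: "continuous_on (?U \<times> ?D) (\<lambda>y. matrix_inv (G (fst y) (snd y)) $ i $ j)" for i j
    proof (intro continuous_on_matrix_inv cG)
      fix y assume "y \<in> ?U \<times> ?D"
      then have "det (G (fst y) (snd y)) > 0"
        by (intro \<delta>(2)) auto
      then show "det (G (fst y) (snd y)) \<noteq> 0"
        by simp
    qed
    have cG': "continuous_on (?U \<times> ?D) (\<lambda>y. G' (fst y) (snd y) $ i $ j)" for i j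
      unfolding G'_def vec_lambda_beta by (intro continuous_intros cA cp)
    show "continuous_on (?U \<times> ?D) (\<lambda>(s, z). fx s z)"
      unfolding split_beta fx_def L_def
      by (intro continuous_intros cdet cinv cG' cV cq) simp_all
  qed (use \<delta>(1) in auto)
  \<comment> \<open>The Leibniz rule was applied on an interval where the Gram matrix stays
    invertible; 0 is interior to it.\<close>
  moreover have "at 0 within ?U = at 0"
    using \<delta>(1) by (intro at_within_interior) simp
  moreover have "fx 0 z = - (V z \<bullet> e) * q z * sqrt (det (G 0 z)) +
      L 0 z * sqrt (det (G 0 z)) * (\<Sum>i\<in>UNIV. \<Sum>j\<in>UNIV. matrix_inv (G 0 z) $ i $ j * (a i z \<bullet> e) * p j z)"
    if z: "z \<in> ?D" for z
  proof -
    let ?I = "matrix_inv (G 0 z)"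
    have sym: "?I $ i $ j = ?I $ j $ i" for i j
      using pos[OF z] by (intro matrix_inv_sym) (simp_all add: G_def inner_commute)
    have "(\<Sum>i\<in>UNIV. \<Sum>j\<in>UNIV. ?I $ i $ j * G' 0 z $ j $ i) =
        (\<Sum>i\<in>UNIV. \<Sum>j\<in>UNIV. ?I $ i $ j * (a j z \<bullet> e) * p i z) + (\<Sum>i\<in>UNIV. \<Sum>j\<in>UNIV. ?I $ i $ j * (a i z \<bullet> e) * p j z)"
      unfolding sum.distrib[symmetric]
      by (intro sum.cong refl) (simp add: G'_def A_def inner_commute algebra_simps)
    also have "(\<Sum>i\<in>UNIV. \<Sum>j\<in>UNIV. ?I $ i $ j * (a j z \<bullet> e) * p i z) = (\<Sum>i\<in>UNIV. \<Sum>j\<in>UNIV. ?I $ i $ j * (a i z \<bullet> e) * p j z)"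
      by (subst sum.swap) (simp only: sym)
    finally show ?thesis
      by (simp add: fx_def mult_ac)
  qed
  ultimately show ?thesis
    using integral_cong[of ?D "fx 0" "\<lambda>z. - (V z \<bullet> e) * q z * sqrt (det (G 0 z)) +
      L 0 z * sqrt (det (G 0 z)) * (\<Sum>i\<in>UNIV. \<Sum>j\<in>UNIV. matrix_inv (G 0 z) $ i $ j * (a i z \<bullet> e) * p j z)"]
    by simp
qed

section \<open>Smooth families and variations in a chart\<close>

lemma smooth_atlas_is_chart: "smooth_atlas M \<Longrightarrow> c \<in> M \<Longrightarrow> is_chart c"
  by (simp add: smooth_atlas_def)

lemma Ck_on_Pair:
  assumes "open W" "Ck_on k W f" "Ck_on k W g"
  shows "Ck_on k W (\<lambda>x. (f x, g x))"
proof -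
  have "Ck_on k W (\<lambda>x. (f x, 0) + (0, g x))"
    by (intro Ck_on_add assms(1) Ck_on_bounded_linear_comp[OF _ assms(1,2)] Ck_on_bounded_linear_comp[OF _ assms(1,3)]
        bounded_linear_Pair bounded_linear_ident bounded_linear_zero)
  then show ?thesis
    by simp
qed

lemmas Ck_on_fst = Ck_on_bounded_linear_comp[OF bounded_linear_fst]
  and Ck_on_snd = Ck_on_bounded_linear_comp[OF bounded_linear_snd]

lemma continuous_on_local_eq:
  fixes f :: "'a::t2_space \<Rightarrow> 'b::topological_space"
  assumes "\<And>z. z \<in> S \<Longrightarrow> \<exists>W g. open W \<and> z \<in> W \<and> continuous_on W g \<and> (\<forall>y\<in>S \<inter> W. f y = g y)"
  shows "continuous_on S f"
  unfolding continuous_on_eq_continuous_within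
proof
  fix z assume z: "z \<in> S"
  obtain W g where W: "open W" "z \<in> W" "continuous_on W g" "\<forall>y\<in>S \<inter> W. f y = g y"
    using assms[OF z] by auto
  have "isCont g z"
    using W continuous_on_eq_continuous_at by blast
  then have "(g \<longlongrightarrow> g z) (at z within S)"
    using continuous_at_imp_continuous_at_within[of z g S] by (simp add: continuous_within)
  moreover have "\<forall>\<^sub>F y in at z within S. g y = f y"
    using W by (auto simp: eventually_at_topological)
  ultimately have "(f \<longlongrightarrow> g z) (at z within S)"
    by (rule Lim_transform_eventually)
  then show "continuous (at z within S) f"
    using W z by (simp add: continuous_within)
qed

text \<open>W is open in space-time and may reach beyond the time interval, where g is
  unconstrained; agreement with F is demanded only at times in [0, T]. Full derivatives of g thus
  stand in for one-sided ones of F.\<close>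

definition local_ext ::
  "('m, 'n::finite) chart \<Rightarrow> real \<Rightarrow> (real \<times> (real^'n)) set \<Rightarrow> (real \<times> (real^'n) \<Rightarrow> 'v) \<Rightarrow>
    (real \<Rightarrow> 'm \<Rightarrow> 'v::real_normed_vector) \<Rightarrow> bool" where
  "local_ext c T W g F \<longleftrightarrow> open W \<and> (\<forall>k. Ck_on k W g) \<and> snd ` W \<subseteq> chart_img c \<and>
     (\<forall>t x. (t, x) \<in> W \<longrightarrow> t \<in> {0..T} \<longrightarrow> F t (chart_inv c x) = g (t, x))"

lemma local_ext_exists:
  fixes M :: "('m::topological_space, 'n::finite) chart set" and F :: "real \<Rightarrow> 'm \<Rightarrow> 'v::real_normed_vector"
  assumes M: "smooth_atlas M" and F: "smooth_family M {0..T} F" and c: "c \<in> M"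
    and t: "t \<in> {0..T}" and x: "x \<in> chart_img c"
  obtains W g where "(t, x) \<in> W" "local_ext c T W g F"
proof -
  have cc: "is_chart c"
    using M c by (simp add: smooth_atlas_def)
  have "smooth_on ({0..T} \<times> chart_img c) (\<lambda>(t, x). F t (chart_inv c x))"
    using F c by (simp add: smooth_family_def)
  moreover have "(t, x) \<in> {0..T} \<times> chart_img c"
    using t x by simp
  ultimately have "\<exists>W g. open W \<and> (t, x) \<in> W \<and> (\<forall>k. Ck_on k W g) \<and>
      (\<forall>y\<in>{0..T} \<times> chart_img c \<inter> W. g y = (case y of (t, x) \<Rightarrow> F t (chart_inv c x)))"
    unfolding smooth_on_def by (rule bspec)
  then obtain W g where W: "open W" "(t, x) \<in> W" "\<forall>k. Ck_on k W g"
    "\<forall>y\<in>{0..T} \<times> chart_img c \<inter> W. g y = (case y of (t, x) \<Rightarrow> F t (chart_inv c x))"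
    by (elim exE conjE)
  let ?W = "W \<inter> UNIV \<times> chart_img c"
  have "local_ext c T ?W g F"
    unfolding local_ext_def
  proof (intro conjI allI impI)
    show "open ?W"
      using W(1) open_chart_img[OF cc] by (intro open_Int open_Times) auto
    show "Ck_on k ?W g" for k
      by (rule Ck_on_subset[OF spec[OF W(3)]]) (rule Int_lower1)
    show "snd ` ?W \<subseteq> chart_img c"
      by (rule image_subsetI) (simp only: Int_iff mem_Times_iff)
    show "F t (chart_inv c x) = g (t, x)" if "(t, x) \<in> ?W" "t \<in> {0..T}" for t x
    proof -
      have "(t, x) \<in> {0..T} \<times> chart_img c \<inter> W"
        using that by blast
      from bspec[OF W(4) this] show ?thesis
        by simp
    qed
  qed
  then show thesis
    by (rule that[rotated]) (use W(2) x in blast)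
qed

context
  fixes c :: "('m::topological_space, 'n::finite) chart" and T W g
    and F :: "real \<Rightarrow> 'm \<Rightarrow> 'v::real_normed_vector"
  assumes T: "T > 0" and ext: "local_ext c T W g F"
begin

lemma local_ext_open: "open W" and local_ext_Ck: "Ck_on k W g"
  and local_ext_img: "(t, x) \<in> W \<Longrightarrow> x \<in> chart_img c"
  and local_ext_eq: "(t, x) \<in> W \<Longrightarrow> t \<in> {0..T} \<Longrightarrow> F t (chart_inv c x) = g (t, x)"
  using ext by (auto simp: local_ext_def)

lemma local_ext_differentiable: "z \<in> W \<Longrightarrow> g differentiable (at z)"
  by (rule Ck_on_differentiable[OF local_ext_Ck])

lemma local_ext_has_velocity:
  assumes "(t, x) \<in> W" "t \<in> {0..T}"
  shows "((\<lambda>r. F r (chart_inv c x)) has_vector_derivative dd (1, 0) g (t, x)) (at t within {0..T})"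
proof -
  have "((\<lambda>r. (r, x)) has_vector_derivative (1, 0)) (at t)"
    by (auto intro!: derivative_eq_intros has_vector_derivative_Pair)
  then have "((\<lambda>r. g (r, x)) has_vector_derivative dd (1, 0) g (t, x)) (at t)"
    by (rule has_vector_derivative_dd_compose) (rule local_ext_differentiable[OF assms(1)])
  then have *: "((\<lambda>r. g (r, x)) has_vector_derivative dd (1, 0) g (t, x)) (at t within {0..T})"
    by (rule has_vector_derivative_at_within)
  have "open ((\<lambda>r. (r, x)) -` W)"
    using local_ext_open by (intro open_vimage continuous_intros)
  then obtain d where d: "d > 0" "ball t d \<subseteq> (\<lambda>r. (r, x)) -` W"
    using assms(1) by (auto elim: openE)
  show ?thesis
  proof (rule has_vector_derivative_transform_within[OF * d(1) assms(2)])
    fix r assume r: "r \<in> {0..T}" "dist r t < d"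
    then have "r \<in> ball t d"
      by (simp add: dist_commute)
    then have "(r, x) \<in> W"
      using d(2) by blast
    then show "g (r, x) = F r (chart_inv c x)"
      using local_ext_eq[of r x] r by simp
  qed
qed

text \<open>The velocity inherits an extension on the same W, so the lemmas of this context apply to
  it again; two applications reach the acceleration. As T > 0, one-sided derivatives at the end
  points are unique.\<close>

lemma local_ext_velocity: "local_ext c T W (dd (1, 0) g) (velocity T F)"
  unfolding local_ext_def
proof (intro conjI allI impI)
  show "Ck_on k W (dd (1, 0) g)" for k
    by (rule Ck_on_dd[OF local_ext_Ck])
  show "velocity T F t (chart_inv c x) = dd (1, 0) g (t, x)" if "(t, x) \<in> W" "t \<in> {0..T}" for t x
    unfolding velocity_def
    by (rule vector_derivative_within_cbox[OF T, unfolded box_real, OF that(2) local_ext_has_velocity[OF that]])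
qed (use local_ext_open local_ext_img in auto)

lemma local_ext_slice:
  assumes "(t, x) \<in> W" "t \<in> {0..T}"
  shows "dd u (\<lambda>x. F t (chart_inv c x)) x = dd (0, u) g (t, x)"
    and "(\<lambda>x. F t (chart_inv c x)) differentiable (at x)"
proof -
  let ?X = "(\<lambda>y. (t, y)) -` W"
  have X: "open ?X" "x \<in> ?X"
    using local_ext_open assms(1) by (auto intro!: open_vimage continuous_intros)
  have eq: "F t (chart_inv c y) = g (t, y)" if "y \<in> ?X" for y
    using local_ext_eq[of t y] that assms(2) by simp
  note s = dd_slice[OF local_ext_differentiable[OF assms(1)]]
  show "dd u (\<lambda>x. F t (chart_inv c x)) x = dd (0, u) g (t, x)"
    using dd_open_cong[OF X eq] s(1) by simp
  show "(\<lambda>x. F t (chart_inv c x)) differentiable (at x)"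
    by (rule differentiable_open_cong[OF X _ s(2)]) (simp add: eq)
qed

lemma local_ext_partial:
  assumes "is_chart c" "(t, x) \<in> W" "t \<in> {0..T}"
  shows "partial c i (F t) (chart_inv c x) = sd i g (t, x)"
  by (rule trans[OF partial_chart_inv[OF assms(1) local_ext_img[OF assms(2)]] local_ext_slice(1)[OF assms(2,3)]])

end

lemma smooth_family_slice:
  fixes M :: "('m::topological_space, 'n::finite) chart set" and F :: "real \<Rightarrow> 'm \<Rightarrow> 'v::real_normed_vector"
  assumes M: "smooth_atlas M" and F: "smooth_family M {0..T} F" and c: "c \<in> M" and t: "t \<in> {0..T}" and T: "T > 0"
  shows "Ck_on k (chart_img c) (\<lambda>x. F t (chart_inv c x))"
proof (rule Ck_on_local)
  fix x assume "x \<in> chart_img c"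
  from local_ext_exists[OF M F c t this] obtain W g where W: "(t, x) \<in> W" and ext: "local_ext c T W g F" .
  let ?X = "(\<lambda>y. (t, y)) -` W"
  have X: "open ?X" "x \<in> ?X"
    using local_ext_open[OF T ext] W by (auto intro!: open_vimage continuous_intros)
  have "Ck_on k ?X (\<lambda>y. g (t, y))"
    by (rule Ck_on_compose[OF X(1) Ck_on_Pair[OF X(1) Ck_on_const Ck_on_ident] local_ext_Ck[OF T ext]]) auto
  then have "Ck_on k ?X (\<lambda>x. F t (chart_inv c x))"
    by (rule Ck_on_cong[OF X(1), rotated]) (use local_ext_eq[OF T ext] t in simp)
  then show "\<exists>W. open W \<and> x \<in> W \<and> Ck_on k W (\<lambda>x. F t (chart_inv c x))"
    using X by (intro exI[of _ ?X]) simp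
qed

lemma smooth_family_continuous:
  fixes M :: "('m::topological_space, 'n::finite) chart set" and F :: "real \<Rightarrow> 'm \<Rightarrow> 'v::real_normed_vector"
  assumes M: "smooth_atlas M" and F: "smooth_family M {0..T} F" and c: "c \<in> M" and T: "T > 0"
  shows "continuous_on ({0..T} \<times> chart_img c) (\<lambda>z. velocity T F (fst z) (chart_inv c (snd z)))"
    and "continuous_on ({0..T} \<times> chart_img c) (\<lambda>z. dd u (\<lambda>x. F (fst z) (chart_inv c x)) (snd z))"
proof -
  show "continuous_on ({0..T} \<times> chart_img c) (\<lambda>z. velocity T F (fst z) (chart_inv c (snd z)))"
  proof (rule continuous_on_local_eq)
    fix z assume z: "z \<in> {0..T} \<times> chart_img c"
    then have "fst z \<in> {0..T}" "snd z \<in> chart_img c"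
      by auto
    from local_ext_exists[OF M F c this] obtain W g where "(fst z, snd z) \<in> W" and ext: "local_ext c T W g F" .
    then have W: "z \<in> W"
      by simp
    note ext' = local_ext_velocity[OF T ext]
    show "\<exists>W g. open W \<and> z \<in> W \<and> continuous_on W g \<and>
        (\<forall>y\<in>{0..T} \<times> chart_img c \<inter> W. velocity T F (fst y) (chart_inv c (snd y)) = g y)"
      using W local_ext_open[OF T ext'] Ck_on_continuous[OF local_ext_Ck[OF T ext', of 0]] local_ext_eq[OF T ext']
      by (intro exI[of _ W] exI[of _ "dd (1, 0) g"]) auto
  qed
  show "continuous_on ({0..T} \<times> chart_img c) (\<lambda>z. dd u (\<lambda>x. F (fst z) (chart_inv c x)) (snd z))"
  proof (rule continuous_on_local_eq)
    fix z assume z: "z \<in> {0..T} \<times> chart_img c"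
    then have "fst z \<in> {0..T}" "snd z \<in> chart_img c"
      by auto
    from local_ext_exists[OF M F c this] obtain W g where "(fst z, snd z) \<in> W" and ext: "local_ext c T W g F" .
    then have W: "z \<in> W"
      by simp
    show "\<exists>W g. open W \<and> z \<in> W \<and> continuous_on W g \<and>
        (\<forall>y\<in>{0..T} \<times> chart_img c \<inter> W. dd u (\<lambda>x. F (fst y) (chart_inv c x)) (snd y) = g y)"
      using W local_ext_open[OF T ext] Ck_on_continuous[OF Ck_on_dd[OF local_ext_Ck[OF T ext, of "Suc 0"]]]
        local_ext_slice(1)[OF T ext]
      by (intro exI[of _ W] exI[of _ "dd (0, u) g"]) auto
  qed
qed

section \<open>Test fields supported in one chart\<close>

text \<open>The coordinate field \<phi> e carried to the manifold and extended by zero. Smoothness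
  across the edge of the chart comes from a compact N over the chart image off which \<phi>
  vanishes.\<close>

definition chart_bump ::
  "('m, 'n::finite) chart \<Rightarrow> (real \<times> (real^'n) \<Rightarrow> real) \<Rightarrow> 'v \<Rightarrow> real \<Rightarrow> 'm \<Rightarrow> 'v::real_normed_vector" where
  "chart_bump c \<phi> e t p = (if p \<in> chart_dom c then \<phi> (t, chart_map c p) *\<^sub>R e else 0)"

context
  fixes M :: "('m::{t2_space, second_countable_topology}, 'n::finite) chart set"
    and c :: "('m, 'n) chart" and \<phi> :: "real \<times> (real^'n) \<Rightarrow> real" and N and e :: "'v::euclidean_space"
  assumes M: "smooth_atlas M" and c: "c \<in> M"
    and \<phi>: "\<And>k. Ck_on k UNIV \<phi>"
    and N: "compact N" "snd ` N \<subseteq> chart_img c" and \<phi>_0: "\<And>z. z \<notin> N \<Longrightarrow> \<phi> z = 0"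
begin

private lemma cc: "is_chart c"
  using M c by (simp add: smooth_atlas_def)

lemma chart_bump_chart_inv: "x \<in> chart_img c \<Longrightarrow> chart_bump c \<phi> e t (chart_inv c x) = \<phi> (t, x) *\<^sub>R e"
  by (simp add: chart_bump_def chart_inv_mem[OF cc] chart_map_inv[OF cc])

lemma chart_bump_eq_0: "p \<notin> chart_inv c ` snd ` N \<Longrightarrow> chart_bump c \<phi> e t p = 0"
proof (cases "p \<in> chart_dom c")
  case True
  assume p: "p \<notin> chart_inv c ` snd ` N"
  have "(t, chart_map c p) \<notin> N"
  proof
    assume "(t, chart_map c p) \<in> N"
    then have "chart_inv c (snd (t, chart_map c p)) \<in> chart_inv c ` snd ` N"
      by (intro imageI)
    then show False
      using p True by (simp add: chart_inv_map[OF cc])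
  qed
  then show ?thesis
    by (simp add: chart_bump_def \<phi>_0)
qed (simp add: chart_bump_def)

lemma compact_chart_bump_base: "compact (chart_inv c ` snd ` N)"
  using N continuous_on_subset[OF continuous_on_chart_inv[OF cc] N(2)]
  by (intro compact_continuous_image continuous_on_snd continuous_on_id)

text \<open>Near a point of \<open>chart_dom c\<close> the field is \<phi> composed with a
  coordinate change. Any other point avoids the base of the support, which is compact and so closed
  in the Hausdorff manifold; the field is zero nearby.\<close>

lemma chart_bump_Ck:
  assumes d: "d \<in> M"
  shows "Ck_on k (UNIV \<times> chart_img d) (\<lambda>z. chart_bump c \<phi> e (fst z) (chart_inv d (snd z)))"
proof (rule Ck_on_local)
  have dd: "is_chart d"
    using M d by (simp add: smooth_atlas_def)
  fix z :: "real \<times> (real^'n)" assume "z \<in> UNIV \<times> chart_img d"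
  then have z: "snd z \<in> chart_img d" by auto
  let ?f = "\<lambda>z. chart_bump c \<phi> e (fst z) (chart_inv d (snd z))"
  show "\<exists>W. open W \<and> z \<in> W \<and> Ck_on k W ?f"
  proof (cases "chart_inv d (snd z) \<in> chart_dom c")
    case True
    let ?V = "chart_map d ` (chart_dom d \<inter> chart_dom c)"
    have V: "open ?V"
      using open_chart_dom[OF cc] open_chart_dom[OF dd] by (intro open_chart_image[OF dd]) auto
    have W: "open ((UNIV :: real set) \<times> ?V)"
      using V by (intro open_Times) auto
    have "chart_map d (chart_inv d (snd z)) \<in> ?V"
      by (intro imageI IntI True chart_inv_mem[OF dd z])
    then have "snd z \<in> ?V"
      by (simp only: chart_map_inv[OF dd z])
    then have zW: "z \<in> UNIV \<times> ?V"
      by (simp add: mem_Times_iff)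
    have "smooth_on ?V (chart_map c \<circ> chart_inv d)"
      using M c d by (simp add: smooth_atlas_def)
    then have tr: "Ck_on k ?V (\<lambda>y. chart_map c (chart_inv d y))"
      using smooth_on_open_Ck_on[OF V] by (simp add: comp_def)
    have "Ck_on k ((UNIV :: real set) \<times> ?V) (\<lambda>z. (fst z, chart_map c (chart_inv d (snd z))))"
      by (intro Ck_on_Pair W Ck_on_fst Ck_on_ident Ck_on_compose[OF W Ck_on_snd[OF W Ck_on_ident] tr]) auto
    then have "Ck_on k ((UNIV :: real set) \<times> ?V) (\<lambda>z. \<phi> (fst z, chart_map c (chart_inv d (snd z))) *\<^sub>R e)"
      by (intro Ck_on_scaleR W Ck_on_const Ck_on_compose[OF W _ \<phi>]) auto
    then have "Ck_on k (UNIV \<times> ?V) ?f"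
      by (rule Ck_on_cong[OF W, rotated]) (auto simp: chart_bump_def chart_inv_map[OF dd])
    then show ?thesis
      using W zW by (intro exI[of _ "UNIV \<times> ?V"] conjI)
  next
    case False
    let ?K = "chart_inv c ` snd ` N"
    have "closed ?K"
      by (rule compact_imp_closed[OF compact_chart_bump_base])
    then have V: "open (chart_map d ` (chart_dom d - ?K))"
      using open_chart_dom[OF dd] by (intro open_chart_image[OF dd]) auto
    have W: "open ((UNIV :: real set) \<times> chart_map d ` (chart_dom d - ?K))"
      using V by (intro open_Times) auto
    have "?K \<subseteq> chart_dom c"
      by (rule image_subsetI) (rule chart_inv_mem[OF cc subsetD[OF N(2)]])
    then have "chart_inv d (snd z) \<in> chart_dom d - ?K"
      by (intro DiffI chart_inv_mem[OF dd z] contra_subsetD[OF _ False])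
    then have "chart_map d (chart_inv d (snd z)) \<in> chart_map d ` (chart_dom d - ?K)"
      by (rule imageI)
    then have "snd z \<in> chart_map d ` (chart_dom d - ?K)"
      by (simp only: chart_map_inv[OF dd z])
    then have zW: "z \<in> UNIV \<times> chart_map d ` (chart_dom d - ?K)"
      by (simp add: mem_Times_iff)
    have "Ck_on k (UNIV \<times> chart_map d ` (chart_dom d - ?K)) ?f"
    proof (rule Ck_on_cong[OF W _ Ck_on_const[of _ _ 0]])
      fix y :: "real \<times> (real^'n)" assume "y \<in> UNIV \<times> chart_map d ` (chart_dom d - ?K)"
      then have "snd y \<in> chart_map d ` (chart_dom d - ?K)"
        by (simp only: mem_Times_iff)
      then obtain p where p: "snd y = chart_map d p" "p \<in> chart_dom d - ?K"
        by (rule imageE)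
      have "chart_inv d (snd y) = p"
        by (simp only: p(1) chart_inv_map[OF dd DiffD1[OF p(2)]])
      then have "chart_inv d (snd y) \<notin> ?K"
        using p(2) by simp
      then show "0 = ?f y"
        by (simp add: chart_bump_eq_0)
    qed
    then show ?thesis
      using W zW by (intro exI[of _ "UNIV \<times> chart_map d ` (chart_dom d - ?K)"] conjI)
  qed
qed

lemma chart_bump_slice_Ck:
  assumes d: "d \<in> M"
  shows "Ck_on k (chart_img d) (\<lambda>x. chart_bump c \<phi> e t (chart_inv d x))"
proof -
  have d': "open (chart_img d)"
    by (rule open_chart_img[OF smooth_atlas_is_chart[OF M d]])
  have "Ck_on k (chart_img d) (\<lambda>x. (t, x))"
    by (intro Ck_on_Pair d' Ck_on_const Ck_on_ident)
  from Ck_on_compose[OF d' this chart_bump_Ck[OF d]] show ?thesis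
    by auto
qed

text \<open>The image of N is compact, hence closed, so it contains the closure taken in
  \<open>supp\<close> and not merely the set where the field is nonzero.\<close>

lemma supp_chart_bump: "supp (chart_bump c \<phi> e) \<subseteq> (\<lambda>z. (fst z, chart_inv c (snd z))) ` N"
  and compact_supp_chart_bump: "compact (supp (chart_bump c \<phi> e))"
proof -
  let ?S = "(\<lambda>z. (fst z, chart_inv c (snd z))) ` N"
  have "continuous_on N (\<lambda>z. chart_inv c (snd z))"
    using N(2) by (intro continuous_on_compose2[OF continuous_on_chart_inv[OF cc]] continuous_on_snd continuous_on_id)
  then have S: "compact ?S"
    by (intro compact_continuous_image N continuous_on_Pair continuous_on_fst continuous_on_id)
  have "{(t, p). chart_bump c \<phi> e t p \<noteq> 0} \<subseteq> ?S"
  proof clarify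
    fix t p assume ne: "chart_bump c \<phi> e t p \<noteq> 0"
    then have p: "p \<in> chart_dom c" and "\<phi> (t, chart_map c p) \<noteq> 0"
      by (auto simp: chart_bump_def split: if_splits)
    then have "(t, chart_map c p) \<in> N"
      using \<phi>_0 by blast
    then show "(t, p) \<in> ?S"
      using p by (intro image_eqI[of _ _ "(t, chart_map c p)"]) (simp_all add: chart_inv_map[OF cc])
  qed
  then show *: "supp (chart_bump c \<phi> e) \<subseteq> ?S"
    unfolding supp_def using compact_imp_closed[OF S] by (rule closure_minimal)
  show "compact (supp (chart_bump c \<phi> e))"
    using closed_Int_compact[of "supp (chart_bump c \<phi> e)" ?S] S * by (simp add: supp_def Int_absorb2)
qed

lemma test_field_chart_bump:
  assumes "fst ` N \<subseteq> {0<..<T}"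
  shows "test_field M T (chart_bump c \<phi> e)"
  unfolding test_field_def
proof (intro conjI)
  show "smooth_family M {0<..<T} (chart_bump c \<phi> e)"
    unfolding smooth_family_def
  proof
    fix d assume d: "d \<in> M"
    then have "open ({0<..<T} \<times> chart_img d)"
      by (intro open_Times open_chart_img[OF smooth_atlas_is_chart[OF M]]) simp
    moreover have "Ck_on k ({0<..<T} \<times> chart_img d) (\<lambda>(t, x). chart_bump c \<phi> e t (chart_inv d x))" for k
      unfolding split_beta by (rule Ck_on_subset[OF chart_bump_Ck[OF d]]) auto
    ultimately show "smooth_on ({0<..<T} \<times> chart_img d) (\<lambda>(t, x). chart_bump c \<phi> e t (chart_inv d x))"
      by (rule Ck_on_open_smooth_on)
  qed
  show "compact (supp (chart_bump c \<phi> e))"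
    by (rule compact_supp_chart_bump)
  show "supp (chart_bump c \<phi> e) \<subseteq> {0<..<T} \<times> UNIV"
    using supp_chart_bump assms by fastforce
qed

end

section \<open>Actions as integrals over space-time boxes\<close>

text \<open>Fubini on [0, T] times the box. The inner integrals become coordinate integrals
  depending continuously on t, which makes the outer integral exist.\<close>

lemma
  fixes M :: "('m::{t2_space, second_countable_topology}, 'n::finite) chart set"
    and f :: "real \<Rightarrow> 'm \<Rightarrow> 'v::euclidean_space" and h :: "real \<Rightarrow> 'm \<Rightarrow> real"
  assumes M: "smooth_atlas M" and c: "c \<in> M" and f: "\<forall>t\<in>{0..T}. C1_field M (f t)"
    and box: "cbox lo hi \<subseteq> chart_img c"
    and h: "continuous_on (cbox (0, lo) (T, hi)) (\<lambda>z. h (fst z) (chart_inv c (snd z)))"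
    and v: "continuous_on (cbox (0, lo) (T, hi)) (\<lambda>z. vol_density c (f (fst z)) (snd z))"
  defines "K \<equiv> chart_inv c ` cbox lo hi"
  shows action_box_inner: "t \<in> {0..T} \<Longrightarrow> set_integrable (volume_measure M (f t)) K (h t)"
    and action_box_integrable: "set_integrable lborel {0..T} (\<lambda>t. LINT p:K|volume_measure M (f t). h t p)"
    and action_box: "(LINT t:{0..T}|lborel. LINT p:K|volume_measure M (f t). h t p) =
      integral (cbox (0, lo) (T, hi)) (\<lambda>z. h (fst z) (chart_inv c (snd z)) * vol_density c (f (fst z)) (snd z))"
proof -
  let ?k = "\<lambda>z. h (fst z) (chart_inv c (snd z)) * vol_density c (f (fst z)) (snd z)"
  let ?I = "\<lambda>t. integral (cbox lo hi) (\<lambda>x. ?k (t, x))"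
  have big: "cbox (0, lo) (T, hi) = {0..T} \<times> cbox lo hi"
    by (simp add: cbox_Pair_eq)
  have k: "continuous_on (cbox (0, lo) (T, hi)) ?k"
    by (intro continuous_on_mult h v)
  have slice: "continuous_on (cbox lo hi) (\<lambda>x. h t (chart_inv c x))" if "t \<in> {0..T}" for t
  proof -
    have p: "continuous_on (cbox lo hi) (\<lambda>x. (t, x))"
      by (intro continuous_intros)
    have "(\<lambda>x. (t, x)) ` cbox lo hi \<subseteq> cbox (0, lo) (T, hi)"
      using that by (auto simp: big)
    from continuous_on_compose2[OF h p this] show ?thesis
      by simp
  qed
  have inner: "set_integrable (volume_measure M (f t)) K (h t)"
    "(LINT p:K|volume_measure M (f t). h t p) = ?I t" if t: "t \<in> {0..T}" for t
    using set_integrable_chart_box[OF M bspec[OF f t] c box slice[OF t]]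
      set_lebesgue_integral_chart_box[OF M bspec[OF f t] c box slice[OF t]]
    by (simp_all add: K_def)
  show "set_integrable (volume_measure M (f t)) K (h t)" if "t \<in> {0..T}"
    by (rule inner(1)[OF that])
  have "continuous_on {0..T} ?I"
    by (rule integral_continuous_on_param) (use k in \<open>simp add: big split_beta\<close>)
  then have int: "set_integrable lborel {0..T} ?I"
    unfolding set_integrable_def by (intro borel_integrable_compact) auto
  have "set_integrable lborel {0..T} ?I \<longleftrightarrow>
      set_integrable lborel {0..T} (\<lambda>t. LINT p:K|volume_measure M (f t). h t p)"
    by (rule set_integrable_cong) (simp_all only: inner(2))
  then show "set_integrable lborel {0..T} (\<lambda>t. LINT p:K|volume_measure M (f t). h t p)"
    using int by simp
  have "(LINT t:{0..T}|lborel. LINT p:K|volume_measure M (f t). h t p) = (LINT t:{0..T}|lborel. ?I t)"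
    by (intro set_lebesgue_integral_cong allI impI inner(2)) simp
  also have "\<dots> = integral {0..T} ?I"
    by (rule set_borel_integral_eq_integral(2)[OF int])
  also have "\<dots> = integral (cbox (0, lo) (T, hi)) ?k"
    using integral_prod_continuous[OF k] by simp
  finally show "(LINT t:{0..T}|lborel. LINT p:K|volume_measure M (f t). h t p) = integral (cbox (0, lo) (T, hi)) ?k" .
qed

text \<open>The second summand contains only F and h0. For a variation over the box it is constant
  in s, so the unrestricted action can be differentiated through its box part.\<close>

lemma action_univ:
  fixes M :: "('m::{t2_space, second_countable_topology}, 'n::finite) chart set"
    and f F :: "real \<Rightarrow> 'm \<Rightarrow> 'v::euclidean_space" and h h0 :: "real \<Rightarrow> 'm \<Rightarrow> real"
  assumes M: "smooth_atlas M" and c: "c \<in> M"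
    and f: "\<forall>t\<in>{0..T}. C1_field M (f t)" and F: "\<forall>t\<in>{0..T}. C1_field M (F t)"
    and box: "cbox lo hi \<subseteq> chart_img c"
    and h: "continuous_on (cbox (0, lo) (T, hi)) (\<lambda>z. h (fst z) (chart_inv c (snd z)))"
    and v: "continuous_on (cbox (0, lo) (T, hi)) (\<lambda>z. vol_density c (f (fst z)) (snd z))"
    and h0: "continuous_on (cbox (0, lo) (T, hi)) (\<lambda>z. h0 (fst z) (chart_inv c (snd z)))"
    and v0: "continuous_on (cbox (0, lo) (T, hi)) (\<lambda>z. vol_density c (F (fst z)) (snd z))"
    and off: "\<And>t p. p \<notin> chart_inv c ` cbox lo hi \<Longrightarrow> f t p = F t p"
      "\<And>t p. p \<notin> chart_inv c ` cbox lo hi \<Longrightarrow> h t p = h0 t p"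
    and fin: "\<forall>t\<in>{0..T}. integrable (volume_measure M (F t)) (h0 t)"
      "set_integrable lborel {0..T} (\<lambda>t. LINT p|volume_measure M (F t). h0 t p)"
  shows "(LINT t:{0..T}|lborel. LINT p|volume_measure M (f t). h t p) =
      integral (cbox (0, lo) (T, hi)) (\<lambda>z. h (fst z) (chart_inv c (snd z)) * vol_density c (f (fst z)) (snd z))
      + (LINT t:{0..T}|lborel. LINT p:- (chart_inv c ` cbox lo hi)|volume_measure M (F t). h0 t p)"
proof -
  let ?K = "chart_inv c ` cbox lo hi"
  let ?r = "\<lambda>t. LINT p:- ?K|volume_measure M (F t). h0 t p"
  have "compact ?K"
    using box smooth_atlas_is_chart[OF M c]
    by (intro compact_continuous_image continuous_on_subset[OF continuous_on_chart_inv] compact_cbox)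
  then have K: "closed ?K"
    by (rule compact_imp_closed)
  then have KB: "?K \<in> sets borel"
    by (rule borel_closed)
  have split: "(LINT p|volume_measure M (f t). h t p) = (LINT p:?K|volume_measure M (f t). h t p) + ?r t"
    if t: "t \<in> {0..T}" for t
    by (rule integral_split_off[OF is_volumeD(1)[OF is_volume_volume_measure[OF M bspec[OF f t]]]
          is_volumeD(1)[OF is_volume_volume_measure[OF M bspec[OF F t]]] KB
          volume_measure_eq_off[OF M bspec[OF f t] bspec[OF F t] K off(1)]
          off(2) bspec[OF fin(1) t] action_box_inner[OF M c f box h v t]])
  have split0: "(LINT p|volume_measure M (F t). h0 t p) = (LINT p:?K|volume_measure M (F t). h0 t p) + ?r t"
    if t: "t \<in> {0..T}" for t
    by (rule integral_split_off[OF is_volumeD(1)[OF is_volume_volume_measure[OF M bspec[OF F t]]]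
          is_volumeD(1)[OF is_volume_volume_measure[OF M bspec[OF F t]]] KB refl refl
          bspec[OF fin(1) t] action_box_inner[OF M c F box h0 v0 t]])
  \<comment> \<open>The outer term is integrable in time as the difference of the full integral and
    its box part for the unvaried data.\<close>
  have "set_integrable lborel {0..T} (\<lambda>t. (LINT p|volume_measure M (F t). h0 t p) - (LINT p:?K|volume_measure M (F t). h0 t p))"
    by (intro set_integral_diff fin(2) action_box_integrable[OF M c F box h0 v0])
  moreover have "set_integrable lborel {0..T} (\<lambda>t. (LINT p|volume_measure M (F t). h0 t p) - (LINT p:?K|volume_measure M (F t). h0 t p))
      \<longleftrightarrow> set_integrable lborel {0..T} ?r"
    by (rule set_integrable_cong) (simp_all add: split0)
  ultimately have r: "set_integrable lborel {0..T} ?r"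
    by simp
  have "(LINT t:{0..T}|lborel. LINT p|volume_measure M (f t). h t p) =
      (LINT t:{0..T}|lborel. (LINT p:?K|volume_measure M (f t). h t p) + ?r t)"
    by (rule set_lebesgue_integral_cong) (simp_all add: split)
  also have "\<dots> = (LINT t:{0..T}|lborel. LINT p:?K|volume_measure M (f t). h t p) + (LINT t:{0..T}|lborel. ?r t)"
    by (rule set_integral_add(2)[OF action_box_integrable[OF M c f box h v] r])
  finally show ?thesis
    by (simp only: action_box[OF M c f box h v])
qed

lemma immersion_gram_pos:
  fixes M :: "('m::topological_space, 'n::finite) chart set" and f :: "'m \<Rightarrow> 'v::euclidean_space"
  assumes M: "smooth_atlas M" and c: "c \<in> M" and f: "immersion M f" and x: "x \<in> chart_img c"
  shows "det (\<chi> i j. dd (axis i 1) (\<lambda>x. f (chart_inv c x)) x \<bullet> dd (axis j 1) (\<lambda>x. f (chart_inv c x)) x) > 0"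
proof (rule gram_det_pos)
  have cc: "is_chart c"
    by (rule smooth_atlas_is_chart[OF M c])
  have "(f \<circ> chart_inv c) differentiable (at (chart_map c (chart_inv c x))) \<and>
      inj (frechet_derivative (f \<circ> chart_inv c) (at (chart_map c (chart_inv c x))))"
    using f c chart_inv_mem[OF cc x] by (simp add: immersion_def)
  then have d: "(\<lambda>x. f (chart_inv c x)) differentiable (at x)"
    and inj: "inj (\<lambda>v. dd v (\<lambda>x. f (chart_inv c x)) x)"
    by (simp_all add: chart_map_inv[OF cc x] comp_def)
  note lin = linear_dd[OF d]
  fix y :: "real^'n"
  assume 0: "(\<Sum>i\<in>UNIV. y $ i *\<^sub>R dd (axis i 1) (\<lambda>x. f (chart_inv c x)) x) = 0"
  have "y = (\<Sum>i\<in>UNIV. y $ i *\<^sub>R axis i 1)"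
    by (simp add: vec_eq_iff axis_def if_distrib cong: if_cong)
  then have "dd y (\<lambda>x. f (chart_inv c x)) x = dd (\<Sum>i\<in>UNIV. y $ i *\<^sub>R axis i 1) (\<lambda>x. f (chart_inv c x)) x"
    by simp
  also have "\<dots> = (\<Sum>i\<in>UNIV. dd (y $ i *\<^sub>R axis i 1) (\<lambda>x. f (chart_inv c x)) x)"
    by (rule linear_sum[OF lin])
  also have "\<dots> = (\<Sum>i\<in>UNIV. y $ i *\<^sub>R dd (axis i 1) (\<lambda>x. f (chart_inv c x)) x)"
    by (intro sum.cong refl linear_cmul[OF lin])
  finally have "dd y (\<lambda>x. f (chart_inv c x)) x = dd 0 (\<lambda>x. f (chart_inv c x)) x"
    using 0 linear_0[OF lin] by simp
  then show "y = 0"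
    by (rule injD[OF inj])
qed

section \<open>First variation along a chart bump\<close>

context
  fixes M :: "('m::{t2_space, second_countable_topology}, 'n::finite) chart set"
    and F :: "real \<Rightarrow> 'm \<Rightarrow> 'v::euclidean_space" and T :: real and c lo hi
  assumes T: "T > 0" and M: "smooth_atlas M" and F: "smooth_family M {0..T} F"
    and imm: "\<forall>t\<in>{0..T}. immersion M (F t)" and stat: "stationary M T F"
    and c: "c \<in> M" and box: "cbox lo hi \<subseteq> chart_img c"
begin

private definition "V z = velocity T F (fst z) (chart_inv c (snd z))"
private definition "a i z = dd (axis i 1) (\<lambda>x. F (fst z) (chart_inv c x)) (snd z)"

private lemma cont_V: "continuous_on ({0..T} \<times> chart_img c) V"
  and cont_a: "continuous_on ({0..T} \<times> chart_img c) (a i)"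
  unfolding V_def[abs_def] a_def[abs_def] by (rule smooth_family_continuous[OF M F c T])+

context
  fixes \<phi> :: "real \<times> (real^'n) \<Rightarrow> real" and N and e :: 'v
  assumes \<phi>: "\<forall>k. Ck_on k UNIV \<phi>" and N: "compact N" "N \<subseteq> {0<..<T} \<times> cbox lo hi"
    and \<phi>_0: "\<forall>z. z \<notin> N \<longrightarrow> \<phi> z = 0"
begin

private definition "\<Phi> = chart_bump c \<phi> e"
private definition "f s t p = F t p + s *\<^sub>R \<Phi> t p"
text \<open>The coordinate derivatives of the varied map \<open>f s\<close>; the next definition is
  its velocity. Both are affine in s, as \<open>first_variation_integral\<close> requires.\<close>

private definition "A s z i = a i z + (s * sd i \<phi> z) *\<^sub>R e"
private definition "X s z = V z + (s * vel \<phi> z) *\<^sub>R e"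

private lemma N': "snd ` N \<subseteq> chart_img c" "fst ` N \<subseteq> {0<..<T}" "chart_inv c ` snd ` N \<subseteq> chart_inv c ` cbox lo hi"
  using N(2) box by (auto intro!: imageI)

private lemmas bump = M c spec[OF \<phi>] N(1) N'(1) mp[OF spec[OF \<phi>_0]]

private lemma c_chart: "is_chart c"
  by (rule smooth_atlas_is_chart[OF M c])

private lemma \<phi>_differentiable: "\<phi> differentiable (at z)"
  by (rule Ck_on_differentiable[OF spec[OF \<phi>]]) simp

private lemma off: "p \<notin> chart_inv c ` cbox lo hi \<Longrightarrow> \<Phi> t p = 0"
  unfolding \<Phi>_def by (rule chart_bump_eq_0[OF bump contra_subsetD[OF N'(3)]])

private lemma f_C1: "t \<in> {0..T} \<Longrightarrow> C1_field M (f s t)"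
  unfolding C1_field_def f_def \<Phi>_def
  by (intro ballI Ck_on_add Ck_on_scaleR Ck_on_const chart_bump_slice_Ck[OF bump] smooth_family_slice[OF M F]
      open_chart_img smooth_atlas_is_chart[OF M] T)

private lemma f_vol_density:
  assumes t: "t \<in> {0..T}" and x: "x \<in> chart_img c"
  shows "vol_density c (f s t) x = sqrt (det (\<chi> i j. A s (t, x) i \<bullet> A s (t, x) j))"
proof -
  have "dd (axis i 1) (\<lambda>x. f s t (chart_inv c x)) x = A s (t, x) i" for i
  proof -
    have "dd (axis i 1) (\<lambda>x. f s t (chart_inv c x)) x = dd (axis i 1) (\<lambda>x. F t (chart_inv c x) + (s * \<phi> (t, x)) *\<^sub>R e) x"
      by (rule dd_open_cong[OF open_chart_img[OF c_chart] x])
        (simp add: f_def \<Phi>_def chart_bump_chart_inv[OF bump])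
    also have "\<dots> = A s (t, x) i"
    proof -
      have dF: "((\<lambda>x. F t (chart_inv c x)) has_derivative (\<lambda>u. dd u (\<lambda>x. F t (chart_inv c x)) x)) (at x)"
        by (intro has_derivative_frechet Ck_on_differentiable[OF smooth_family_slice[OF M F c t T] x])
      have d\<phi>: "((\<lambda>x. \<phi> (t, x)) has_derivative (\<lambda>u. dd (0, u) \<phi> (t, x))) (at x)"
        using has_derivative_frechet[OF dd_slice(2)[OF \<phi>_differentiable]] dd_slice(1)[OF \<phi>_differentiable] by simp
      have "((\<lambda>x. F t (chart_inv c x) + (s * \<phi> (t, x)) *\<^sub>R e) has_derivative
          (\<lambda>u. dd u (\<lambda>x. F t (chart_inv c x)) x + (s * dd (0, u) \<phi> (t, x)) *\<^sub>R e)) (at x)"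
        by (intro has_derivative_add dF has_derivative_scaleR_left has_derivative_mult_right d\<phi>)
      from dd_eq[OF this, of "axis i 1"] show ?thesis
        by (simp add: A_def a_def)
    qed
    finally show ?thesis .
  qed
  then show ?thesis
    by (simp only: vol_density_altdef[OF c_chart x])
qed

private lemma f_velocity:
  assumes t: "t \<in> {0..T}" and x: "x \<in> chart_img c"
  shows "velocity T (f s) t (chart_inv c x) = X s (t, x)"
proof -
  obtain W g where W: "(t, x) \<in> W" and ext: "local_ext c T W g F"
    using local_ext_exists[OF M F c t x] .
  have "((\<lambda>r. F r (chart_inv c x)) has_vector_derivative V (t, x)) (at t within {0..T})"
    using local_ext_has_velocity[OF T ext W t] local_ext_eq[OF T local_ext_velocity[OF T ext] W t]
    by (simp add: V_def)
  moreover have "((\<lambda>r. (s * \<phi> (r, x)) *\<^sub>R e) has_vector_derivative (s * vel \<phi> (t, x)) *\<^sub>R e) (at t within {0..T})"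
  proof -
    have "((\<lambda>r. (r, x)) has_vector_derivative (1, 0)) (at t)"
      by (auto intro!: derivative_eq_intros has_vector_derivative_Pair)
    then have "((\<lambda>r. \<phi> (r, x)) has_vector_derivative vel \<phi> (t, x)) (at t)"
      by (rule has_vector_derivative_dd_compose) (rule \<phi>_differentiable)
    then have "((\<lambda>r. s * \<phi> (r, x)) has_real_derivative s * vel \<phi> (t, x)) (at t)"
      by (intro DERIV_cmult) (simp add: has_real_derivative_iff_has_vector_derivative)
    then have "((\<lambda>r. (s * \<phi> (r, x)) *\<^sub>R e) has_vector_derivative (s * vel \<phi> (t, x)) *\<^sub>R e) (at t)"
      using has_vector_derivative_scaleR[OF _ has_vector_derivative_const[of e]] by fastforce
    then show ?thesis
      by (rule has_vector_derivative_at_within)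
  qed
  ultimately have "((\<lambda>r. F r (chart_inv c x) + (s * \<phi> (r, x)) *\<^sub>R e) has_vector_derivative X s (t, x)) (at t within {0..T})"
    unfolding X_def by (rule has_vector_derivative_add)
  moreover have "(\<lambda>r. F r (chart_inv c x) + (s * \<phi> (r, x)) *\<^sub>R e) = (\<lambda>r. f s r (chart_inv c x))"
    by (simp add: f_def \<Phi>_def chart_bump_chart_inv[OF bump x])
  ultimately show ?thesis
    unfolding velocity_def using vector_derivative_within_cbox[OF T, unfolded box_real, OF t] by simp
qed

private lemma big: "cbox (0, lo) (T, hi) = {0..T} \<times> cbox lo hi" "cbox (0, lo) (T, hi) \<subseteq> {0..T} \<times> chart_img c"
  using box by (auto simp: cbox_Pair_eq)

private lemma cont_\<phi>: "continuous_on S (dd u \<phi>)"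
  by (rule continuous_on_subset[OF Ck_on_continuous[OF Ck_on_dd[OF spec[OF \<phi>]]]]) simp

private lemma cont_f_vol: "continuous_on (cbox (0, lo) (T, hi)) (\<lambda>z. vol_density c (f s (fst z)) (snd z))"
proof (rule continuous_on_eq)
  show "continuous_on (cbox (0, lo) (T, hi)) (\<lambda>z. sqrt (det (\<chi> i j. A s z i \<bullet> A s z j)))"
  proof (intro continuous_on_real_sqrt continuous_on_det)
    show "continuous_on (cbox (0, lo) (T, hi)) (\<lambda>z. (\<chi> i j. A s z i \<bullet> A s z j) $ i $ j)" for i j
      unfolding A_def vec_lambda_beta
      by (intro continuous_intros continuous_on_subset[OF cont_a big(2)] cont_\<phi>)
  qed
  fix z assume "z \<in> cbox (0, lo) (T, hi)"
  then have "fst z \<in> {0..T}" "snd z \<in> chart_img c"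
    using big(2) by auto
  then show "sqrt (det (\<chi> i j. A s z i \<bullet> A s z j)) = vol_density c (f s (fst z)) (snd z)"
    by (simp add: f_vol_density)
qed

private lemma cont_f_kin: "continuous_on (cbox (0, lo) (T, hi))
    (\<lambda>z. (norm (velocity T (f s) (fst z) (chart_inv c (snd z))))\<^sup>2 / 2)"
proof (rule continuous_on_eq)
  show "continuous_on (cbox (0, lo) (T, hi)) (\<lambda>z. (norm (X s z))\<^sup>2 / 2)"
    unfolding X_def by (intro continuous_intros continuous_on_subset[OF cont_V big(2)] cont_\<phi>) simp_all
  fix z assume "z \<in> cbox (0, lo) (T, hi)"
  then have "fst z \<in> {0..T}" "snd z \<in> chart_img c"
    using big(2) by auto
  then show "(norm (X s z))\<^sup>2 / 2 = (norm (velocity T (f s) (fst z) (chart_inv c (snd z))))\<^sup>2 / 2"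
    by (simp add: f_velocity)
qed

private definition "vol_part s = integral (cbox (0, lo) (T, hi)) (\<lambda>z. 1 * vol_density c (f s (fst z)) (snd z))"
private definition "kin_part s = integral (cbox (0, lo) (T, hi))
  (\<lambda>z. (norm (velocity T (f s) (fst z) (chart_inv c (snd z))))\<^sup>2 / 2 * vol_density c (f s (fst z)) (snd z))"

private lemma f_0: "f 0 = F"
  by (simp add: f_def fun_eq_iff)

private lemma f_off: "p \<notin> chart_inv c ` cbox lo hi \<Longrightarrow> f s t p = F t p"
  by (simp add: f_def off)

private lemma velocity_off: "p \<notin> chart_inv c ` cbox lo hi \<Longrightarrow> velocity T (f s) t p = velocity T F t p"
  by (simp add: velocity_def f_off)

text \<open>In either branch of \<open>stationary\<close> there are a region D and a number C such
  that, for every s, the action over D is the box part plus C. Only the box part remains after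
  differentiation.\<close>

private lemma actions_box_derivative:
  "((\<lambda>s. real CARD('n) / 2 * vol_part s - kin_part s) has_real_derivative 0) (at 0)"
proof -
  let ?K = "chart_inv c ` cbox lo hi"
  let ?J = "\<lambda>D s. J_V M T D (f s) - J_K M T D (f s)"
  have C1: "\<forall>t\<in>{0..T}. C1_field M (f s t)" for s
    using f_C1 by blast
  have one: "continuous_on (cbox (0, lo) (T, hi)) (\<lambda>z. 1 :: real)"
    by (rule continuous_on_const)
  have test: "test_field M T \<Phi>"
    unfolding \<Phi>_def by (rule test_field_chart_bump[OF bump N'(2)])
  have fs: "(\<lambda>t p. F t p + s *\<^sub>R \<Phi> t p) = f s" for s
    by (simp add: f_def fun_eq_iff)
  have st: "if finite_actions M T F then (?J ({0..T} \<times> UNIV) has_real_derivative 0) (at 0)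
      else (\<forall>D. compact D \<and> supp \<Phi> \<subseteq> D \<and> D \<subseteq> {0..T} \<times> UNIV \<longrightarrow> (?J D has_real_derivative 0) (at 0))"
    using mp[OF spec[OF stat[unfolded stationary_def Let_def], of \<Phi>] test] unfolding fs .
  have "\<exists>D C. (?J D has_real_derivative 0) (at 0) \<and> (\<forall>s. ?J D s = real CARD('n) / 2 * vol_part s - kin_part s + C)"
  proof (cases "finite_actions M T F")
    case True
    let ?D = "{0..T} \<times> (UNIV :: 'm set)"
    have fin: "\<forall>t\<in>{0..T}. integrable (volume_measure M (F t)) (\<lambda>p. 1 :: real)"
      "\<forall>t\<in>{0..T}. integrable (volume_measure M (F t)) (\<lambda>p. (norm (velocity T F t p))\<^sup>2 / 2)"
      "set_integrable lborel {0..T} (\<lambda>t. LINT p|volume_measure M (F t). (1 :: real))"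
      "set_integrable lborel {0..T} (\<lambda>t. LINT p|volume_measure M (F t). (norm (velocity T F t p))\<^sup>2 / 2)"
      using True unfolding finite_actions_def by auto
    have U: "(LINT t:{0..T}|lborel. LINT p:{p. (t, p) \<in> ?D}|volume_measure M (f s t). h t p) =
        (LINT t:{0..T}|lborel. LINT p|volume_measure M (f s t). h t p)" for s and h :: "real \<Rightarrow> 'm \<Rightarrow> real"
      by (rule set_lebesgue_integral_cong) (auto simp: set_lebesgue_integral_def)
    have "J_V M T ?D (f s) = real CARD('n) / 2 * (vol_part s + (LINT t:{0..T}|lborel. LINT p:- ?K|volume_measure M (F t). 1))" for s
      unfolding J_V_def U vol_part_def
      by (subst action_univ[OF M c C1 C1[of 0, unfolded f_0] box one cont_f_vol one cont_f_vol[of 0, unfolded f_0]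
            f_off refl fin(1) fin(3)]) simp_all
    moreover have "J_K M T ?D (f s) = kin_part s + (LINT t:{0..T}|lborel. LINT p:- ?K|volume_measure M (F t). (norm (velocity T F t p))\<^sup>2 / 2)" for s
      unfolding J_K_def U kin_part_def
      by (rule action_univ[OF M c C1 C1[of 0, unfolded f_0] box cont_f_kin cont_f_vol cont_f_kin[of 0, unfolded f_0]
            cont_f_vol[of 0, unfolded f_0] f_off _ fin(2) fin(4)]) (use velocity_off in simp_all)
    moreover have "(?J ?D has_real_derivative 0) (at 0)"
      using st True by (simp only: if_True)
    ultimately show ?thesis
      by (intro exI[of _ ?D] exI[of _ "real CARD('n) / 2 * (LINT t:{0..T}|lborel. LINT p:- ?K|volume_measure M (F t). 1)
        - (LINT t:{0..T}|lborel. LINT p:- ?K|volume_measure M (F t). (norm (velocity T F t p))\<^sup>2 / 2)"])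
        (simp add: algebra_simps)
  next
    case False
    \<comment> \<open>A compact region containing the support, since N lies over the box. The
      actions over it are the box integrals themselves, so C is 0.\<close>
    let ?D = "{0..T} \<times> ?K"
    have U: "(LINT t:{0..T}|lborel. LINT p:{p. (t, p) \<in> ?D}|volume_measure M (f s t). h t p) =
        (LINT t:{0..T}|lborel. LINT p:?K|volume_measure M (f s t). h t p)" for s and h :: "real \<Rightarrow> 'm \<Rightarrow> real"
      by (rule set_lebesgue_integral_cong) auto
    have "J_V M T ?D (f s) = real CARD('n) / 2 * vol_part s" for s
      unfolding J_V_def U vol_part_def by (subst action_box[OF M c C1 box one cont_f_vol]) simp
    moreover have "J_K M T ?D (f s) = kin_part s" for s
      unfolding J_K_def U kin_part_def by (rule action_box[OF M c C1 box cont_f_kin cont_f_vol])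
    moreover have "(?J ?D has_real_derivative 0) (at 0)"
    proof -
      have "compact ?K"
        by (intro compact_continuous_image continuous_on_subset[OF continuous_on_chart_inv[OF c_chart] box] compact_cbox)
      then have "compact ?D"
        by (intro compact_Times compact_Icc)
      moreover have "supp \<Phi> \<subseteq> ?D"
      proof
        have sub: "supp \<Phi> \<subseteq> (\<lambda>z. (fst z, chart_inv c (snd z))) ` N"
          unfolding \<Phi>_def by (rule supp_chart_bump[OF bump])
        fix y assume "y \<in> supp \<Phi>"
        from subsetD[OF sub this] obtain z where z: "y = (fst z, chart_inv c (snd z))" "z \<in> N"
          by (rule imageE)
        then have "fst z \<in> {0<..<T}" "snd z \<in> cbox lo hi"
          using N(2) by auto
        then show "y \<in> ?D"
          by (simp add: z(1))
      qed
      moreover have "\<forall>D. compact D \<and> supp \<Phi> \<subseteq> D \<and> D \<subseteq> {0..T} \<times> UNIV \<longrightarrow> (?J D has_real_derivative 0) (at 0)"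
        using st False by (simp only: if_False)
      ultimately show ?thesis
        by auto
    qed
    ultimately show ?thesis
      by (intro exI[of _ ?D] exI[of _ 0]) simp
  qed
  then obtain D C where D: "(?J D has_real_derivative 0) (at 0)" "\<forall>s. ?J D s = real CARD('n) / 2 * vol_part s - kin_part s + C"
    by blast
  have "((\<lambda>s. ?J D s - C) has_real_derivative 0 - 0) (at 0)"
    by (intro DERIV_diff D(1) DERIV_const)
  then show ?thesis
    by (simp add: D(2))
qed

text \<open>The derivative of the box part is computed a second time, by
  \<open>first_variation_integral\<close>, and compared with the value 0; the immersion property
  makes the Gram determinant positive at s = 0.\<close>

private lemma stationary_weak:
  "integral (cbox (0, lo) (T, hi)) (\<lambda>z. - (V z \<bullet> e) * vel \<phi> z * sqrt (det (\<chi> i j. a i z \<bullet> a j z)) +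
    (real CARD('n) - V z \<bullet> V z) / 2 * sqrt (det (\<chi> i j. a i z \<bullet> a j z)) *
      (\<Sum>i\<in>UNIV. \<Sum>j\<in>UNIV. matrix_inv (\<chi> i j. a i z \<bullet> a j z) $ i $ j * (a i z \<bullet> e) * sd j \<phi> z)) = 0"
    (is "integral ?B ?E = 0")
proof -
  let ?L = "\<lambda>s z. (real CARD('n) - X s z \<bullet> X s z) / 2" and ?G = "\<lambda>s z. \<chi> i j. A s z i \<bullet> A s z j"
  have Jeq: "real CARD('n) / 2 * vol_part s - kin_part s = integral ?B (\<lambda>z. ?L s z * sqrt (det (?G s z)))" for s
  proof -
    let ?v = "\<lambda>z. vol_density c (f s (fst z)) (snd z)"
    let ?k = "\<lambda>z. (norm (velocity T (f s) (fst z) (chart_inv c (snd z))))\<^sup>2 / 2"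
    have "real CARD('n) / 2 * vol_part s - kin_part s = integral ?B (\<lambda>z. real CARD('n) / 2 * ?v z - ?k z * ?v z)"
    proof -
      have "(\<lambda>z. real CARD('n) / 2 * ?v z) integrable_on ?B" "(\<lambda>z. ?k z * ?v z) integrable_on ?B"
        by (intro integrable_continuous continuous_on_mult continuous_on_const cont_f_vol cont_f_kin)+
      then show ?thesis
        unfolding vol_part_def kin_part_def by (subst integral_diff) simp_all
    qed
    also have "\<dots> = integral ?B (\<lambda>z. ?L s z * sqrt (det (?G s z)))"
    proof (rule integral_cong)
      fix z assume "z \<in> ?B"
      then have "fst z \<in> {0..T}" "snd z \<in> chart_img c"
        using big(2) by auto
      then have "?v z = sqrt (det (?G s z))" "?k z = X s z \<bullet> X s z / 2"
        by (simp_all add: f_vol_density f_velocity power2_norm_eq_inner)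
      then show "real CARD('n) / 2 * ?v z - ?k z * ?v z = ?L s z * sqrt (det (?G s z))"
        by (simp add: algebra_simps diff_divide_distrib)
    qed
    finally show ?thesis .
  qed
  have zero: "((\<lambda>s. integral ?B (\<lambda>z. ?L s z * sqrt (det (?G s z)))) has_real_derivative 0) (at 0)"
    using actions_box_derivative unfolding Jeq .
  have pos: "det (\<chi> i j. (a i z + (0 * sd i \<phi> z) *\<^sub>R e) \<bullet> (a j z + (0 * sd j \<phi> z) *\<^sub>R e)) > 0" if "z \<in> ?B" for z
  proof -
    have "fst z \<in> {0..T}" "snd z \<in> chart_img c"
      using big(2) that by auto
    then show ?thesis
      using immersion_gram_pos[OF M c _ , of "F (fst z)" "snd z"] imm by (simp add: a_def)
  qed
  have "((\<lambda>s. integral ?B (\<lambda>z. ?L s z * sqrt (det (?G s z)))) has_real_derivative integral ?B ?E) (at 0)"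
    using first_variation_integral[of "(0, lo)" "(T, hi)" a V "\<lambda>i. sd i \<phi>" "vel \<phi>" e "real CARD('n)",
      OF continuous_on_subset[OF cont_a big(2)] continuous_on_subset[OF cont_V big(2)] cont_\<phi> cont_\<phi> pos]
    by (simp add: A_def X_def)
  then show ?thesis
    using zero by (rule DERIV_unique)
qed

text \<open>The same identity without the private abbreviations, for use outside this
  context.\<close>

lemmas stationary_weak_identity = stationary_weak[unfolded V_def a_def]

end

end

section \<open>The equation of motion\<close>

lemma euler_lagrange_open_cong:
  fixes f g :: "real \<times> (real^'n::finite) \<Rightarrow> 'v::euclidean_space"
  assumes X: "open X" "z \<in> X" and eq: "\<And>y. y \<in> X \<Longrightarrow> f y = g y"
  shows "euler_lagrange f z \<longleftrightarrow> euler_lagrange g z"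
proof -
  have d: "dd u f y = dd u g y" if "y \<in> X" for u y
    by (rule dd_open_cong[OF X(1) that eq])
  have gram: "gram f y = gram g y" if "y \<in> X" for y
    by (simp add: gram_def d[OF that])
  have "vel (mom f) z = vel (mom g) z"
    by (rule dd_open_cong[OF X]) (simp add: mom_def gvol_def d gram)
  moreover have "sd j (\<lambda>z. lag f z *\<^sub>R flux f j z) z = sd j (\<lambda>z. lag g z *\<^sub>R flux g j z) z" for j
    by (rule dd_open_cong[OF X]) (simp add: lag_def flux_def gvol_def d gram)
  ultimately show ?thesis
    by (simp add: euler_lagrange_def)
qed

lemma sum_UNIV_option: "(\<Sum>k\<in>UNIV. f k) = f None + (\<Sum>j\<in>UNIV. f (Some j))"
  for f :: "'n::finite option \<Rightarrow> real"
  by (simp add: UNIV_option_conv sum.reindex)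

lemma integral_cbox_superset:
  fixes f :: "'a::euclidean_space \<Rightarrow> real"
  assumes "continuous_on (cbox a b) f" "cbox a b \<subseteq> cbox a' b'" "\<And>z. z \<notin> cbox a b \<Longrightarrow> f z = 0"
  shows "integral (cbox a' b') f = integral (cbox a b) f"
  by (rule integral_unique)
    (rule has_integral_on_superset[OF integrable_integral[OF integrable_continuous[OF assms(1)]] assms(3,2)])

section \<open>The Euler-Lagrange equation at interior times and at the end points\<close>

context
  fixes M :: "('m::{t2_space, second_countable_topology}, 'n::finite) chart set"
    and F :: "real \<Rightarrow> 'm \<Rightarrow> 'v::euclidean_space" and T :: real and c
  assumes T: "T > 0" and M: "smooth_atlas M" and F: "smooth_family M {0..T} F"
    and imm: "\<forall>t\<in>{0..T}. immersion M (F t)" and stat: "stationary M T F"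
    and c: "c \<in> M"
begin

private lemma chart_c: "is_chart c"
  by (rule smooth_atlas_is_chart[OF M c])

private definition "u z = F (fst z) (chart_inv c (snd z))"

private lemma open_interior: "open ({0<..<T} \<times> chart_img c)"
  by (intro open_Times open_chart_img[OF chart_c]) simp

private lemma ext_u: "local_ext c T ({0<..<T} \<times> chart_img c) u F"
  unfolding local_ext_def
proof (intro conjI allI impI)
  show "Ck_on k ({0<..<T} \<times> chart_img c) u" for k
  proof (rule Ck_on_local)
    fix z assume z: "z \<in> {0<..<T} \<times> chart_img c"
    then have "fst z \<in> {0..T}" "snd z \<in> chart_img c"
      by auto
    from local_ext_exists[OF M F c this] obtain W g where W: "(fst z, snd z) \<in> W" and ext: "local_ext c T W g F" .
    let ?W = "W \<inter> {0<..<T} \<times> chart_img c"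
    have o: "open ?W"
      by (intro open_Int open_interior local_ext_open[OF T ext])
    have "Ck_on k ?W u"
    proof (rule Ck_on_cong[OF o])
      show "Ck_on k ?W g"
        by (rule Ck_on_subset[OF local_ext_Ck[OF T ext]]) simp
      show "g y = u y" if "y \<in> ?W" for y
        using local_ext_eq[OF T ext, of "fst y" "snd y"] that by (auto simp: u_def)
    qed
    then show "\<exists>W. open W \<and> z \<in> W \<and> Ck_on k W u"
      using o W z by (intro exI[of _ ?W] conjI) simp_all
  qed
qed (use open_interior in \<open>auto simp: u_def\<close>)

lemma local_ext_gram:
  assumes ext: "local_ext c T W g F" and z: "(t, x) \<in> W" "t \<in> {0..T}"
  shows "det (gram g (t, x)) > 0"
  using immersion_gram_pos[OF M c bspec[OF imm z(2)] local_ext_img[OF T ext z(1)]]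
  by (simp add: local_ext_slice(1)[OF T ext z] gram_def)

text \<open>Pairing with a constant vector e turns the equation into the vanishing of a scalar
  space-time divergence. Its weak form for bumps near z0 is what
  \<open>stationary_weak_identity\<close> provides.\<close>

private lemma euler_lagrange_u:
  assumes z0: "z0 \<in> {0<..<T} \<times> chart_img c"
  shows "euler_lagrange u z0"
proof -
  let ?O = "{0<..<T} \<times> chart_img c"
  have pos: "\<forall>z\<in>?O. det (gram u z) > 0"
    using local_ext_gram[OF ext_u] by auto
  have Ck: "Ck_on (Suc k) ?O u" for k
    by (rule local_ext_Ck[OF T ext_u])
  have Ckm: "Ck_on k ?O (mom u)" and Ckf: "Ck_on k ?O (\<lambda>z. lag u z *\<^sub>R flux u j z)" for k j
    by (intro Ck_on_scaleR open_interior Ck_on_mom[OF open_interior Ck pos] Ck_on_lag[OF open_interior Ck pos]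
        Ck_on_flux[OF open_interior Ck pos])+
  have eq: "vel (mom u) z0 \<bullet> e = (\<Sum>j\<in>UNIV. sd j (\<lambda>z. lag u z *\<^sub>R flux u j z) z0) \<bullet> e" for e
  proof -
    \<comment> \<open>\<open>None\<close> is the time direction, paired with minus the momentum;
      \<open>Some j\<close> is the j-th coordinate direction, paired with the Lagrangian times the
      flux.\<close>
    define d :: "'n option \<Rightarrow> real \<times> (real^'n)" where
      "d k = (case k of None \<Rightarrow> (1, 0) | Some j \<Rightarrow> (0, axis j 1))" for k
    define P where "P k = (\<lambda>z. case k of None \<Rightarrow> - (mom u z \<bullet> e) | Some j \<Rightarrow> (lag u z *\<^sub>R flux u j z) \<bullet> e)" for k
    have CkP: "Ck_on 1 ?O (P k)" for k
    proof (cases k)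
      case None
      have "Ck_on 1 ?O (\<lambda>z. - (mom u z \<bullet> e))"
        by (intro Ck_on_bounded_linear_comp[OF bounded_linear_minus[OF bounded_linear_ident] open_interior]
            Ck_on_inner open_interior Ckm Ck_on_const)
      then show ?thesis
        by (simp only: P_def None option.case)
    next
      case (Some j)
      have "Ck_on 1 ?O (\<lambda>z. (lag u z *\<^sub>R flux u j z) \<bullet> e)"
        by (intro Ck_on_inner open_interior Ckf Ck_on_const)
      then show ?thesis
        by (simp only: P_def Some option.case)
    qed
    have "(\<Sum>k\<in>UNIV. dd (d k) (P k) z0) = 0"
    proof (rule weak_divergence_imp_strong[OF _ open_interior z0])
      show "Ck_on 1 ?O (P k)" for k
        by (rule CkP)
      fix \<phi> :: "real \<times> (real^'n) \<Rightarrow> real" and r a b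
      assume \<phi>: "\<And>k. Ck_on k UNIV \<phi>" and r: "r > 0" "cball z0 (2 * r) \<subseteq> cbox a b" and ab: "cbox a b \<subseteq> ?O"
        and \<phi>_0: "\<And>z. z \<notin> cball z0 r \<Longrightarrow> \<phi> z = 0"
      have sub: "cball z0 r \<subseteq> cbox a b"
      proof -
        have "cball z0 r \<subseteq> cball z0 (2 * r)"
          using r by (intro subset_cball) simp
        then show ?thesis
          using r(2) by (rule subset_trans)
      qed
      have "z0 \<in> cbox a b"
        using sub r by auto
      have abx: "cbox a b = {fst a..fst b} \<times> cbox (snd a) (snd b)"
        using cbox_Pair_eq[of "fst a" "snd a" "fst b" "snd b"] by simp
      then have ne: "fst z0 \<in> {fst a..fst b}" "snd z0 \<in> cbox (snd a) (snd b)"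
        using \<open>z0 \<in> cbox a b\<close> by (auto simp: mem_Times_iff)
      have t: "{fst a..fst b} \<subseteq> {0<..<T}" and box: "cbox (snd a) (snd b) \<subseteq> chart_img c"
        using ab[unfolded abx times_subset_iff] ne by auto
      have "cball z0 r \<subseteq> {0<..<T} \<times> cbox (snd a) (snd b)"
        by (rule subset_trans[OF sub[unfolded abx] Sigma_mono[OF t subset_refl]])
      note weak = stationary_weak_identity[OF T M F imm stat c box _ compact_cball this, of \<phi> e]
      let ?E = "\<lambda>z. \<Sum>k\<in>UNIV. dd (d k) \<phi> z * P k z"
      let ?a = "\<lambda>i z. dd (axis i 1) (\<lambda>x. F (fst z) (chart_inv c x)) (snd z)"
      let ?V = "\<lambda>z. velocity T F (fst z) (chart_inv c (snd z))"
      let ?E' = "\<lambda>z. - (?V z \<bullet> e) * vel \<phi> z * sqrt (det (\<chi> i j. ?a i z \<bullet> ?a j z)) +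
        (real CARD('n) - ?V z \<bullet> ?V z) / 2 * sqrt (det (\<chi> i j. ?a i z \<bullet> ?a j z)) *
        (\<Sum>i\<in>UNIV. \<Sum>j\<in>UNIV. matrix_inv (\<chi> i j. ?a i z \<bullet> ?a j z) $ i $ j * (?a i z \<bullet> e) * sd j \<phi> z)"
      have E: "?E' z = ?E z" if z: "z \<in> cbox a b" for z
      proof -
        have zO: "(fst z, snd z) \<in> ?O" and z1: "fst z \<in> {0..T}"
          using subsetD[OF ab z] by auto
        have V: "?V z = vel u z"
          using local_ext_eq[OF T local_ext_velocity[OF T ext_u] zO z1] by simp
        have a: "?a i z = sd i u z" for i
          using local_ext_slice(1)[OF T ext_u zO z1] by simp
        have "(\<Sum>j\<in>UNIV. dd (d (Some j)) \<phi> z * P (Some j) z) =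
            lag u z * gvol u z * (\<Sum>i\<in>UNIV. \<Sum>j\<in>UNIV. matrix_inv (gram u z) $ i $ j * (sd i u z \<bullet> e) * sd j \<phi> z)"
          by (subst sum.swap) (simp add: d_def P_def flux_def inner_sum_left sum_distrib_left sum_distrib_right mult_ac)
        then show ?thesis
          unfolding V a gram_def[symmetric] sum_UNIV_option
          by (simp add: d_def P_def mom_def lag_def gvol_def mult_ac)
      qed
      have far: "dd v \<phi> z = 0" if "z \<notin> cball z0 r" for v z
      proof -
        have "dd v \<phi> z = dd v (\<lambda>_. 0) z"
          by (rule dd_open_cong[where W = "- cball z0 r"]) (use that \<phi>_0 in \<open>auto intro: open_Compl\<close>)
        then show ?thesis
          by (simp add: frechet_derivative_const)
      qed
      have cP: "continuous_on (cbox a b) (P k)" for k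
        by (rule continuous_on_subset[OF Ck_on_continuous[OF CkP] ab])
      have c\<phi>: "continuous_on (cbox a b) (dd v \<phi>)" for v
        by (rule continuous_on_subset[OF Ck_on_continuous[OF Ck_on_dd[OF \<phi>]]]) simp
      have "continuous_on (cbox a b) ?E"
        by (intro continuous_on_sum continuous_on_mult c\<phi> cP)
      then have cE: "continuous_on (cbox a b) ?E'"
        by (rule continuous_on_eq) (simp only: E)
      have "integral (cbox a b) ?E = integral (cbox a b) ?E'"
        by (rule integral_cong) (simp only: E)
      \<comment> \<open>Stationarity integrates over all of [0, T], so the time side of the box is
        enlarged; the derivatives of \<phi> vanish on the added part.\<close>
      also have "\<dots> = integral (cbox (0, snd a) (T, snd b)) ?E'"
      proof (rule integral_cbox_superset[OF cE, symmetric])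
        show "cbox a b \<subseteq> cbox (0, snd a) (T, snd b)"
          using t unfolding abx by (auto simp: cbox_Pair_eq)
        show "?E' z = 0" if "z \<notin> cbox a b" for z
        proof -
          have "z \<notin> cball z0 r"
            using that sub by blast
          then show ?thesis
            by (simp add: far)
        qed
      qed
      also have "\<dots> = 0"
        by (rule weak) (use \<phi> \<phi>_0 in blast)+
      finally show "integral (cbox a b) ?E = 0" .
    qed simp
    moreover have "dd (d None) (P None) z0 = - (vel (mom u) z0 \<bullet> e)"
    proof -
      have "mom u differentiable (at z0)"
        by (rule Ck_on_differentiable[OF Ckm z0])
      then have "((\<lambda>z. - (mom u z \<bullet> e)) has_derivative (\<lambda>v. - (dd v (mom u) z0 \<bullet> e))) (at z0)"
        by (intro has_derivative_minus has_derivative_inner_left has_derivative_frechet)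
      from dd_eq[OF this] show ?thesis
        by (simp add: P_def d_def)
    qed
    moreover have "dd (d (Some j)) (P (Some j)) z0 = sd j (\<lambda>z. lag u z *\<^sub>R flux u j z) z0 \<bullet> e" for j
      using dd_inner_const[OF Ck_on_differentiable[OF Ckf z0]] by (simp add: P_def d_def)
    ultimately show ?thesis
      by (simp add: sum_UNIV_option inner_sum_left)
  qed
  show ?thesis
    unfolding euler_lagrange_def by (rule vector_eq_rdot[THEN iffD1], rule allI, rule eq)
qed

text \<open>At interior times g agrees with u near the point and inherits its equation. The
  difference of the two sides is continuous on all of W, so at t it is the limit of zeros taken from
  inside the interval.\<close>

lemma euler_lagrange_local_ext:
  assumes ext: "local_ext c T W g F" and pos: "\<forall>z\<in>W. det (gram g z) > 0" and z: "(t, x) \<in> W" "t \<in> {0..T}"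
  shows "euler_lagrange g (t, x)"
proof -
  let ?E = "\<lambda>z. vel (mom g) z - (\<Sum>j\<in>UNIV. sd j (\<lambda>z. lag g z *\<^sub>R flux g j z) z)"
  have W: "open W" and Ck: "Ck_on (Suc k) W g" for k
    by (rule local_ext_open[OF T ext], rule local_ext_Ck[OF T ext])
  have Ckm: "Ck_on k W (mom g)" and Ckf: "Ck_on k W (\<lambda>z. lag g z *\<^sub>R flux g j z)" for k j
    by (intro Ck_on_scaleR W Ck_on_mom[OF W Ck pos] Ck_on_lag[OF W Ck pos] Ck_on_flux[OF W Ck pos])+
  have "continuous_on W ?E"
    by (intro continuous_on_diff continuous_on_sum Ck_on_continuous[OF Ck_on_dd[OF Ckm]] Ck_on_continuous[OF Ck_on_dd[OF Ckf]])
  then have cE: "isCont ?E (t, x)"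
    using W z(1) by (simp add: continuous_on_eq_continuous_at)
  have "isCont (\<lambda>r. (r, x)) t"
    by (intro continuous_intros)
  then have "isCont (\<lambda>r. ?E (r, x)) t"
    by (rule isCont_o2) (rule cE)
  then have lim: "((\<lambda>r. ?E (r, x)) \<longlongrightarrow> ?E (t, x)) (at t within {0<..<T})"
    unfolding isCont_def by (rule tendsto_within_subset) simp
  have "open ((\<lambda>r. (r, x)) -` W)"
    using W by (intro open_vimage continuous_intros)
  then have "\<forall>\<^sub>F r in at t within {0<..<T}. (r, x) \<in> W"
    using z(1) by (auto simp: eventually_at_topological intro!: exI[of _ "(\<lambda>r. (r, x)) -` W"])
  then have "\<forall>\<^sub>F r in at t within {0<..<T}. ?E (r, x) = 0"
  proof (rule eventually_rev_mp)
    show "\<forall>\<^sub>F r in at t within {0<..<T}. (r, x) \<in> W \<longrightarrow> ?E (r, x) = 0"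
    proof (unfold eventually_at_filter, intro always_eventually allI impI)
      fix r assume r: "r \<in> {0<..<T}" "(r, x) \<in> W"
      let ?X = "W \<inter> {0<..<T} \<times> chart_img c"
      have rX: "(r, x) \<in> ?X" and X: "open ?X"
        using r local_ext_img[OF T ext r(2)] W open_interior by (auto intro: open_Int)
      have "euler_lagrange u (r, x)"
        by (rule euler_lagrange_u) (use rX in blast)
      moreover have "g y = u y" if "y \<in> ?X" for y
        using local_ext_eq[OF T ext, of "fst y" "snd y"] that by (auto simp: u_def)
      ultimately have "euler_lagrange g (r, x)"
        using euler_lagrange_open_cong[OF X rX, of g u] by simp
      then show "?E (r, x) = 0"
        by (simp add: euler_lagrange_def)
    qed
  qed
  then have "((\<lambda>r. ?E (r, x)) \<longlongrightarrow> 0) (at t within {0<..<T})"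
    by (rule tendsto_eventually)
  \<comment> \<open>As T > 0, every t in [0, T], the end points included, is a limit point of the
    open interval, so the limit is unique.\<close>
  moreover have "at t within {0<..<T} \<noteq> bot"
  proof -
    have "t islimpt {0<..<T}"
    proof (cases "t > 0")
      case True
      from islimpt_greaterThanLessThan2[OF this] show ?thesis
        by (rule islimpt_subset) (use z(2) in auto)
    next
      case False
      then have "t < T"
        using T by simp
      from islimpt_greaterThanLessThan1[OF this] show ?thesis
        by (rule islimpt_subset) (use z(2) in auto)
    qed
    then show ?thesis
      by (simp add: trivial_limit_within)
  qed
  ultimately have "?E (t, x) = 0"
    using lim by (intro tendsto_unique)
  then show ?thesis
    by (simp add: euler_lagrange_def)
qed

end

text \<open>\<open>partial\<close> sees h only through the slice at time t, so a space-time function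
  agreeing with it there may be differentiated instead.\<close>

lemma partial_local_eq:
  fixes c :: "('m::topological_space, 'n::finite) chart" and k :: "real \<times> (real^'n) \<Rightarrow> 'b::real_normed_vector"
  assumes cc: "is_chart c" and W: "open W" "(t, x) \<in> W" and x: "x \<in> chart_img c"
    and eq: "\<And>y. (t, y) \<in> W \<Longrightarrow> h (chart_inv c y) = k (t, y)" and k: "k differentiable (at (t, x))"
  shows "partial c i h (chart_inv c x) = sd i k (t, x)"
proof -
  have X: "open ((\<lambda>y. (t, y)) -` W)" "x \<in> (\<lambda>y. (t, y)) -` W"
    using W by (auto intro!: open_vimage continuous_intros)
  have "partial c i h (chart_inv c x) = dd (axis i 1) (\<lambda>y. h (chart_inv c y)) x"
    by (rule partial_chart_inv[OF cc x])
  also have "\<dots> = dd (axis i 1) (\<lambda>y. k (t, y)) x"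
    by (rule dd_open_cong[OF X]) (simp add: eq)
  also have "\<dots> = sd i k (t, x)"
    by (rule dd_slice(1)[OF k])
  finally show ?thesis .
qed

theorem proposition3p2:
  fixes M :: "('m::{t2_space, second_countable_topology}, 'n::finite) chart set"
    and F \<nu> :: "real \<Rightarrow> 'm \<Rightarrow> real ^ 'k"
    and T :: real
  assumes "CARD('k) = CARD('n) + 1"
    and "T > 0"
    and "smooth_atlas M"
    and "orientable M"
    and "smooth_family M {0..T} F"
    and "\<forall>t\<in>{0..T}. immersion M (F t)"
    and "unit_normal M T F \<nu>"
    and "stationary M T F"
  shows "\<forall>t\<in>{0..T}. \<forall>c\<in>M. \<forall>p\<in>chart_dom c.
    (let n = real CARD('n);
         v = velocity T F t;
         H = mean_curv c (F t) (\<nu> t) p;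
         \<sigma> = v p \<bullet> \<nu> t p;
         S = tangential_velocity c (F t) v;
         S_up = (\<lambda>k. raise c (F t) S k p);
         S_sq = covector_norm_sq c (F t) S p;
         div_S = covector_div c (F t) S p;
         e = (\<lambda>q. ((norm (v q))\<^sup>2 + n) / 2);
         grad_e = (\<lambda>k. raise c (F t) (\<lambda>l. partial c l e) k p);
         \<alpha> = (e p - S_sq) * H - \<sigma> * div_S;
         A = (\<lambda>k. (\<sigma> * H - div_S) * S_up k - grad_e k)
     in acceleration T F t p = \<alpha> *\<^sub>R \<nu> t p + (\<Sum>k\<in>UNIV. A k *\<^sub>R partial c k (F t) p))"
proof (intro ballI)
  fix t c p assume t: "t \<in> {0..T}" and c: "c \<in> M" and p: "p \<in> chart_dom c"
  note T = assms(2) and M = assms(3) and F = assms(5)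
  note cc = smooth_atlas_is_chart[OF M c]
  define x where "x = chart_map c p"
  have x: "x \<in> chart_img c" and p_eq: "chart_inv c x = p"
    using p by (auto simp: x_def chart_inv_map[OF cc])
  obtain W0 g where z0: "(t, x) \<in> W0" and ext0: "local_ext c T W0 g F"
    using local_ext_exists[OF M F c t x] .
  \<comment> \<open>Being an immersion controls the Gram determinant only at times in [0, T]; by
    continuity of the determinant of g it stays positive near (t, x).\<close>
  define W where "W = W0 \<inter> (\<lambda>z. det (gram g z)) -` {0<..}"
  have W0: "open W0"
    by (rule local_ext_open[OF T ext0])
  have "continuous_on W0 (\<lambda>z. det (gram g z))"
    unfolding gram_def by (intro continuous_on_det) (simp only: vec_lambda_beta,
      intro continuous_on_inner Ck_on_continuous[OF Ck_on_dd[OF local_ext_Ck[OF T ext0, of "Suc 0"]]])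
  then have W: "open W"
    unfolding W_def using W0 by (rule continuous_open_preimage) simp
  have zW: "(t, x) \<in> W"
    using z0 local_ext_gram[OF T M F assms(6,8) c ext0 z0 t] by (simp add: W_def)
  have pos: "\<forall>z\<in>W. det (gram g z) > 0"
    by (simp add: W_def)
  have ext: "local_ext c T W g F"
    using ext0 W unfolding local_ext_def W_def by (auto intro: Ck_on_subset simp del: Ck_on.simps)
  note ext' = local_ext_velocity[OF T ext]
  note ext'' = local_ext_velocity[OF T ext']
  have EL: "euler_lagrange g (t, x)"
    by (rule euler_lagrange_local_ext[OF T M F assms(6,8) c ext pos zW t])
  have g2: "Ck_on (Suc (Suc 0)) W g"
    by (rule local_ext_Ck[OF T ext])
  define N where "N y = \<nu> t (chart_inv c y)" for y
  have nu: "smooth_family M {0..T} \<nu>" "\<And>p. norm (\<nu> t p) = 1"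
    "\<And>p i. p \<in> chart_dom c \<Longrightarrow> \<nu> t p \<bullet> partial c i (F t) p = 0"
    using assms(7) t c unfolding unit_normal_def by auto
  have N_diff: "N differentiable (at x)"
    unfolding N_def by (rule Ck_on_differentiable[OF smooth_family_slice[OF M nu(1) c t T] x])
  have N_unit: "N x \<bullet> N x = 1"
    using nu(2) by (simp add: N_def norm_eq_sqrt_inner)
  have N_normal: "N y \<bullet> sd i g (t, y) = 0" if "(t, y) \<in> W" for y i
    using nu(3)[OF chart_inv_mem[OF cc local_ext_img[OF T ext that]], of i] local_ext_partial[OF T ext cc that t]
    by (simp add: N_def)
  note frame = euler_lagrange_imp_equation[OF assms(1) W zW g2 pos N_diff N_unit N_normal EL]
  let ?z = "(t, x)" and ?I = "matrix_inv (gram g (t, x))"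
  have diff: "dd w g differentiable (at ?z)" for w
    by (rule Ck_on_differentiable[OF Ck_on_dd[OF g2] zW])
  have sym: "sd i (sd j g) ?z = sd j (sd i g) ?z" for i j
    by (rule dd_symmetric[OF W zW]) (use g2 in \<open>simp only: numeral_2_eq_2\<close>)
  have vel: "velocity T F t (chart_inv c y) = vel g (t, y)" if "(t, y) \<in> W" for y
    by (rule local_ext_eq[OF T ext' that t])
  have par: "partial c i (F t) (chart_inv c y) = sd i g (t, y)" if "(t, y) \<in> W" for i y
    by (rule local_ext_partial[OF T ext cc that t])
  have metric: "metric c (F t) (chart_inv c y) = gram g (t, y)" if "(t, y) \<in> W" for y
    by (simp add: metric_def gram_def par[OF that])
  have inv: "inv_metric c (F t) p = ?I"
    unfolding inv_metric_def metric[OF zW, unfolded p_eq] ..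
  have acc: "acceleration T F t p = vel (vel g) ?z"
    using local_ext_eq[OF T ext'' zW t] by (simp add: acceleration_def p_eq)
  have S: "tangential_velocity c (F t) (velocity T F t) i (chart_inv c y) = vel g (t, y) \<bullet> sd i g (t, y)"
    if "(t, y) \<in> W" for i y
    by (simp add: tangential_velocity_def vel[OF that] par[OF that])
  have dS: "partial c i (tangential_velocity c (F t) (velocity T F t) j) p =
      sd i (vel g) ?z \<bullet> sd j g ?z + vel g ?z \<bullet> sd i (sd j g) ?z" for i j
  proof -
    have "partial c i (tangential_velocity c (F t) (velocity T F t) j) (chart_inv c x) = sd i (\<lambda>z. vel g z \<bullet> sd j g z) ?z"
    proof (rule partial_local_eq[OF cc W zW x])
      show "tangential_velocity c (F t) (velocity T F t) j (chart_inv c y) = vel g (t, y) \<bullet> sd j g (t, y)"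
        if "(t, y) \<in> W" for y
        by (rule S[OF that])
    qed (intro differentiable_inner diff)
    then show ?thesis
      unfolding p_eq dd_inner[OF diff diff] by simp
  qed
  have dG: "partial c i (\<lambda>q. metric c (F t) q $ j $ l) p = sd j g ?z \<bullet> sd i (sd l g) ?z + sd i (sd j g) ?z \<bullet> sd l g ?z" for i j l
  proof -
    have "partial c i (\<lambda>q. metric c (F t) q $ j $ l) (chart_inv c x) = sd i (\<lambda>z. sd j g z \<bullet> sd l g z) ?z"
    proof (rule partial_local_eq[OF cc W zW x])
      show "metric c (F t) (chart_inv c y) $ j $ l = sd j g (t, y) \<bullet> sd l g (t, y)" if "(t, y) \<in> W" for y
        by (simp add: metric[OF that] gram_def)
    qed (intro differentiable_inner diff)
    then show ?thesis
      unfolding p_eq dd_inner[OF diff diff] .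
  qed
  have de: "partial c l (\<lambda>q. ((norm (velocity T F t q))\<^sup>2 + real CARD('n)) / 2) p = vel g ?z \<bullet> sd l (vel g) ?z" for l
  proof -
    have d: "((\<lambda>z. (vel g z \<bullet> vel g z + real CARD('n)) / 2) has_derivative
        (\<lambda>w. (vel g ?z \<bullet> dd w (vel g) ?z + dd w (vel g) ?z \<bullet> vel g ?z + 0) / 2)) (at ?z)"
      by (rule bounded_linear.has_derivative[OF bounded_linear_divide
            has_derivative_add[OF has_derivative_inner[OF has_derivative_frechet[OF diff] has_derivative_frechet[OF diff]]
              has_derivative_const]])
    have "partial c l (\<lambda>q. ((norm (velocity T F t q))\<^sup>2 + real CARD('n)) / 2) (chart_inv c x) =
        sd l (\<lambda>z. (vel g z \<bullet> vel g z + real CARD('n)) / 2) ?z"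
    proof (rule partial_local_eq[OF cc W zW x])
      show "((norm (velocity T F t (chart_inv c y)))\<^sup>2 + real CARD('n)) / 2 =
          (vel g (t, y) \<bullet> vel g (t, y) + real CARD('n)) / 2" if "(t, y) \<in> W" for y
        by (simp add: vel[OF that] power2_norm_eq_inner)
    qed (rule differentiableI[OF d])
    then show ?thesis
      unfolding p_eq dd_eq[OF d] by (simp add: inner_commute)
  qed
  \<comment> \<open>Koszul's formula: by symmetry of second derivatives the six terms from the
    product rule collapse to 2 F_ij . F_l, cancelling the 1/2 in \<open>christoffel\<close>.\<close>
  have \<Gamma>: "christoffel c (F t) k i j p = (\<Sum>l\<in>UNIV. ?I $ k $ l * (sd i (sd j g) ?z \<bullet> sd l g ?z))" for k i j
    unfolding christoffel_def inv dG
  proof (intro sum.cong refl)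
    fix l
    have "(sd j g ?z \<bullet> sd i (sd l g) ?z + sd i (sd j g) ?z \<bullet> sd l g ?z) +
        (sd i g ?z \<bullet> sd j (sd l g) ?z + sd j (sd i g) ?z \<bullet> sd l g ?z) -
        (sd i g ?z \<bullet> sd l (sd j g) ?z + sd l (sd i g) ?z \<bullet> sd j g ?z) = 2 * (sd i (sd j g) ?z \<bullet> sd l g ?z)"
      using sym[of j l] sym[of i l] sym[of j i] by (simp add: inner_commute)
    then show "?I $ k $ l / 2 * (sd j g ?z \<bullet> sd i (sd l g) ?z + sd i (sd j g) ?z \<bullet> sd l g ?z +
        (sd i g ?z \<bullet> sd j (sd l g) ?z + sd j (sd i g) ?z \<bullet> sd l g ?z) -
        (sd i g ?z \<bullet> sd l (sd j g) ?z + sd l (sd i g) ?z \<bullet> sd j g ?z)) = ?I $ k $ l * (sd i (sd j g) ?z \<bullet> sd l g ?z)"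
      by simp
  qed
  have H: "mean_curv c (F t) (\<nu> t) p = (\<Sum>i\<in>UNIV. \<Sum>j\<in>UNIV. ?I $ i $ j * (sd i (sd j g) ?z \<bullet> N x))"
  proof -
    have "partial c j (\<nu> t) p = dd (axis j 1) N x" for j
      using partial_chart_inv[OF cc x, of j "\<nu> t"] unfolding p_eq N_def .
    \<comment> \<open>\<open>second_fund\<close> pairs F_i with the j-th derivative of \<nu>, so the
      frame identity is used with the indices interchanged.\<close>
    then have "second_fund c (F t) (\<nu> t) i j p = sd i (sd j g) ?z \<bullet> N x" for i j
      using par[OF zW, unfolded p_eq] frame(2)[where i = j and j = i] sym[of i j] by (simp add: second_fund_def)
    then show ?thesis
      by (simp only: mean_curv_def inv)
  qed
  have vp: "velocity T F t p = vel g ?z" and Sp: "tangential_velocity c (F t) (velocity T F t) i p = vel g ?z \<bullet> sd i g ?z"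
    and ap: "partial c i (F t) p = sd i g ?z" and Np: "\<nu> t p = N x" for i
    using vel[OF zW] S[OF zW] par[OF zW] by (simp_all add: p_eq N_def)
  show "let n = real CARD('n);
         v = velocity T F t;
         H = mean_curv c (F t) (\<nu> t) p;
         \<sigma> = v p \<bullet> \<nu> t p;
         S = tangential_velocity c (F t) v;
         S_up = (\<lambda>k. raise c (F t) S k p);
         S_sq = covector_norm_sq c (F t) S p;
         div_S = covector_div c (F t) S p;
         e = (\<lambda>q. ((norm (v q))\<^sup>2 + n) / 2);
         grad_e = (\<lambda>k. raise c (F t) (\<lambda>l. partial c l e) k p);
         \<alpha> = (e p - S_sq) * H - \<sigma> * div_S;
         A = (\<lambda>k. (\<sigma> * H - div_S) * S_up k - grad_e k)
     in acceleration T F t p = \<alpha> *\<^sub>R \<nu> t p + (\<Sum>k\<in>UNIV. A k *\<^sub>R partial c k (F t) p)"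
    \<comment> \<open>Every geometric quantity at p becomes an expression in derivatives of g at (t,
      x), in the shape of the pointwise algebraic identity with \<open>w i = sd i (vel g)\<close>
      and \<open>b i j = sd i (sd j g)\<close> at that point.\<close>
    unfolding Let_def raise_def covector_norm_sq_def covector_div_def cov_deriv_def acc H inv \<Gamma> dS de vp Sp ap Np
    unfolding power2_norm_eq_inner
    by (rule hypersurface_frame.equation_of_motion_algebra[OF frame(1) frame(3)])
qed

end
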